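(* Let $I\subset\mathbb{R}$ be a finite interval and let $G\colon\mathbb{R}^N\to[0,\infty)$ satisfy conditions $(G_1)$--$(G_7)$ listed in the context. Let $F\colon I\times\mathbb{R}^N\times\mathbb{R}^N\to\mathbb{R}$, $(t,x,v)\mapsto F(t,x,v)$, be of class $C^1$, and suppose that there are $a\in C(\mathbb{R}_+,\mathbb{R}_+)$ and $b,c\in L^1(I,\mathbb{R}_+)$ such that for all $(t,x,v)\in I\times\mathbb{R}^N\times\mathbb{R}^N$ $$|F(t,x,v)|\le a(|x|)\,(b(t)+G(v)),$$ $$|F_x(t,x,v)|\le a(|x|)\,(b(t)+G(v)),$$ $$G^{\ast}(F_v(t,x,v))\le a(|x|)\,\bigl(c(t)+G^{\ast}(\nabla G(v))\bigr).$$ Define $\mathcal{I}(u)=\int_I F(t,u(t),\dot u(t))\,dt$ for $u\in \mathbf{W}^1\mathbf{L}^G(I,\mathbb{R}^N)$. Then $\mathcal{I}\in C^1(\mathbf{W}^1\mathbf{L}^G(I,\mathbb{R}^N),\mathbb{R})$, and for all $u,\varphi\in \mathbf{W}^1\mathbf{L}^G(I,\mathbb{R}^N)$ $$\mathcal{I}'(u)\varphi=\int_I\langle F_x(t,u,\dot u),\varphi\rangle\,dt+\int_I\langle F_v(t,u,\dot u),\dot\varphi\rangle\,dt .$$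
   Context: $\langle\cdot,\cdot\rangle$ is the standard inner product on $\mathbb{R}^N$, $|\cdot|$ the induced norm, $\mathbb{R}_+=[0,\infty)$; $F_x,F_v$ are the gradients of $F$ in the variables $x$ and $v$. Conditions on $G\colon\mathbb{R}^N\to[0,\infty)$: $(G_1)$ $G(0)=0$; $(G_2)$ $G$ is convex; $(G_3)$ $G$ is even; $(G_4)$ $\lim_{|x|\to\infty}G(x)/|x|=\infty$; $(G_5)$ ($\Delta_2$) there exist $K_1\ge 2$, $M_1>0$ with $G(2x)\le K_1G(x)$ for all $|x|\ge M_1$; $(G_6)$ ($\nabla_2$) there exist $K_2\ge1$, $M_2>0$ with $G(x)\le\frac{1}{2K_2}G(K_2x)$ for all $|x|\ge M_2$; $(G_7)$ $G$ is of class $C^1$. Fenchel conjugate: $G^\ast(y)=\sup_{x\in\mathbb{R}^N}\{\langle x,y\rangle-G(x)\}$. Orlicz space: $\mathbf{L}^G(I,\mathbb{R}^N)$ is the set of measurable $u\colon I\to\mathbb{R}^N$ (identified when equal a.e.) with $\int_I G(u)\,dt<\infty$, with the Luxemburg norm $\|u\|_{\mathbf{L}^G}=\inf\{\alpha>0:\int_I G(u/\alpha)\,dt\le1\}$. Orlicz-Sobolev space: $\mathbf{W}^1\mathbf{L}^G(I,\mathbb{R}^N)=\{u\in\mathbf{L}^G(I,\mathbb{R}^N):\dot u\in\mathbf{L}^G(I,\mathbb{R}^N)\}$, where $\dot u$ is the weak derivative, with norm $\|u\|_{\mathbf{W}^1\mathbf{L}^G}=\|u\|_{\mathbf{L}^G}+\|\dot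 u\|_{\mathbf{L}^G}$. $C^1(\mathbf{W}^1\mathbf{L}^G,\mathbb{R})$ denotes the (finite-valued) continuously differentiable functionals on this Banach space. *)

theory Defs
  imports "HOL-Analysis.Analysis"
begin

text \<open>At points of \<open>S\<close> that are not interior, the derivative is taken within \<open>S\<close> (one-sided in \<open>t\<close>
  at an endpoint of an interval).\<close>

definition C1_on :: "'a::real_normed_vector set \<Rightarrow> ('a \<Rightarrow> real) \<Rightarrow> bool" where
  "C1_on S f \<longleftrightarrow> (\<exists>f' :: 'a \<Rightarrow> 'a \<Rightarrow>\<^sub>L real.
     (\<forall>x\<in>S. (f has_derivative blinfun_apply (f' x)) (at x within S)) \<and> continuous_on S f')"

definition grad :: "('a::real_inner \<Rightarrow> real) \<Rightarrow> 'a \<Rightarrow> 'a" where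
  "grad f x = (THE D. GDERIV f x :> D)"

text \<open>The supremum is taken in \<open>real\<close>; it is over a set that is bounded above as soon as \<open>G\<close> is
  superlinear and bounded below, which is the only case in which this definition is used.\<close>

definition fenchel_conj :: "('a::real_inner \<Rightarrow> real) \<Rightarrow> 'a \<Rightarrow> real" where
  "fenchel_conj G y = (SUP x. x \<bullet> y - G x)"

text \<open>Elements of the function spaces are represented by functions \<open>real \<Rightarrow> 'a\<close>, of which only the
  values on \<open>I\<close> matter; two functions represent the same element iff they agree almost everywhere
  on \<open>I\<close>.\<close>

definition orlicz_space :: "real set \<Rightarrow> ('a::euclidean_space \<Rightarrow> real) \<Rightarrow> (real \<Rightarrow> 'a) set" where
  "orlicz_space I G =
     {u \<in> borel_measurable (lebesgue_on I). (\<integral>\<^sup>+t. ennreal (G (u t)) \<partial>lebesgue_on I) < \<infinity>}"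

definition luxemburg_norm :: "real set \<Rightarrow> ('a::euclidean_space \<Rightarrow> real) \<Rightarrow> (real \<Rightarrow> 'a) \<Rightarrow> real" where
  "luxemburg_norm I G u =
     Inf {\<alpha>. \<alpha> > 0 \<and> (\<integral>\<^sup>+t. ennreal (G (u t /\<^sub>R \<alpha>)) \<partial>lebesgue_on I) \<le> 1}"

definition test_function :: "real set \<Rightarrow> (real \<Rightarrow> real) \<Rightarrow> bool" where
  "test_function I \<phi> \<longleftrightarrow>
     (\<forall>k t. (deriv ^^ k) \<phi> differentiable (at t)) \<and>
     compact (closure {t. \<phi> t \<noteq> 0}) \<and> closure {t. \<phi> t \<noteq> 0} \<subseteq> interior I"

definition locally_integrable :: "real set \<Rightarrow> (real \<Rightarrow> 'a::euclidean_space) \<Rightarrow> bool" where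
  "locally_integrable I u \<longleftrightarrow>
     (\<forall>K. compact K \<and> K \<subseteq> interior I \<longrightarrow> u absolutely_integrable_on K)"

definition has_weak_deriv :: "real set \<Rightarrow> (real \<Rightarrow> 'a::euclidean_space) \<Rightarrow> (real \<Rightarrow> 'a) \<Rightarrow> bool" where
  "has_weak_deriv I u v \<longleftrightarrow> locally_integrable I u \<and> locally_integrable I v \<and>
     (\<forall>\<phi>. test_function I \<phi> \<longrightarrow>
        (\<integral>t. deriv \<phi> t *\<^sub>R u t \<partial>lebesgue_on I) = - (\<integral>t. \<phi> t *\<^sub>R v t \<partial>lebesgue_on I))"

text \<open>A weak derivative is determined only up to a null set, so \<open>weak_deriv\<close> selects a representative.\<close>

definition weak_deriv :: "real set \<Rightarrow> (real \<Rightarrow> 'a::euclidean_space) \<Rightarrow> real \<Rightarrow> 'a" where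
  "weak_deriv I u = (SOME v. has_weak_deriv I u v)"

definition orlicz_sobolev_space ::
    "real set \<Rightarrow> ('a::euclidean_space \<Rightarrow> real) \<Rightarrow> (real \<Rightarrow> 'a) set" where
  "orlicz_sobolev_space I G =
     {u \<in> orlicz_space I G. (\<exists>v. has_weak_deriv I u v) \<and> weak_deriv I u \<in> orlicz_space I G}"

definition orlicz_sobolev_norm ::
    "real set \<Rightarrow> ('a::euclidean_space \<Rightarrow> real) \<Rightarrow> (real \<Rightarrow> 'a) \<Rightarrow> real" where
  "orlicz_sobolev_norm I G u = luxemburg_norm I G u + luxemburg_norm I G (weak_deriv I u)"

text \<open>Differential calculus on a linear space \<open>W\<close> of functions with a seminorm \<open>nrm\<close>. The space depends
  on parameters that are terms, so it is a carrier set and not a type. A functional on the quotient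
  of \<open>W\<close> by the null space of \<open>nrm\<close> is a functional on \<open>W\<close> that does not distinguish functions at distance
  zero; the continuous linear functionals and the functionals with a Frechet derivative at every
  point of \<open>W\<close>, as defined here, have this property.\<close>

definition bounded_linear_functional ::
    "('s \<Rightarrow> 'a::real_vector) set \<Rightarrow> (('s \<Rightarrow> 'a) \<Rightarrow> real) \<Rightarrow> (('s \<Rightarrow> 'a) \<Rightarrow> real) \<Rightarrow> bool" where
  "bounded_linear_functional W nrm L \<longleftrightarrow>
     (\<forall>u\<in>W. \<forall>w\<in>W. L (\<lambda>t. u t + w t) = L u + L w) \<and>
     (\<forall>r. \<forall>u\<in>W. L (\<lambda>t. r *\<^sub>R u t) = r * L u) \<and>
     (\<exists>C. \<forall>u\<in>W. \<bar>L u\<bar> \<le> C * nrm u)"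

definition has_frechet_deriv ::
    "('s \<Rightarrow> 'a::real_vector) set \<Rightarrow> (('s \<Rightarrow> 'a) \<Rightarrow> real) \<Rightarrow>
     (('s \<Rightarrow> 'a) \<Rightarrow> real) \<Rightarrow> (('s \<Rightarrow> 'a) \<Rightarrow> real) \<Rightarrow> ('s \<Rightarrow> 'a) \<Rightarrow> bool" where
  "has_frechet_deriv W nrm J L u \<longleftrightarrow> bounded_linear_functional W nrm L \<and>
     (\<forall>\<epsilon>>0. \<exists>\<delta>>0. \<forall>\<phi>\<in>W. nrm \<phi> < \<delta> \<longrightarrow>
        \<bar>J (\<lambda>t. u t + \<phi> t) - J u - L \<phi>\<bar> \<le> \<epsilon> * nrm \<phi>)"

text \<open>The last line bounds the dual norm of \<open>J' w - J' u\<close> by \<open>\<epsilon>\<close>.\<close>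

definition C1_functional ::
    "('s \<Rightarrow> 'a::real_vector) set \<Rightarrow> (('s \<Rightarrow> 'a) \<Rightarrow> real) \<Rightarrow> (('s \<Rightarrow> 'a) \<Rightarrow> real) \<Rightarrow> bool" where
  "C1_functional W nrm J \<longleftrightarrow> (\<exists>J'.
     (\<forall>u\<in>W. has_frechet_deriv W nrm J (J' u) u) \<and>
     (\<forall>u\<in>W. \<forall>\<epsilon>>0. \<exists>\<delta>>0. \<forall>w\<in>W. nrm (\<lambda>t. w t - u t) < \<delta> \<longrightarrow>
        (\<forall>\<phi>\<in>W. \<bar>J' w \<phi> - J' u \<phi>\<bar> \<le> \<epsilon> * nrm \<phi>)))"

definition action_integrand ::
    "real set \<Rightarrow> (real \<Rightarrow> 'a::euclidean_space \<Rightarrow> 'a \<Rightarrow> real) \<Rightarrow> (real \<Rightarrow> 'a) \<Rightarrow> real \<Rightarrow> real" where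
  "action_integrand I F u t = F t (u t) (weak_deriv I u t)"

definition action ::
    "real set \<Rightarrow> (real \<Rightarrow> 'a::euclidean_space \<Rightarrow> 'a \<Rightarrow> real) \<Rightarrow> (real \<Rightarrow> 'a) \<Rightarrow> real" where
  "action I F u = (\<integral>t. action_integrand I F u t \<partial>lebesgue_on I)"

definition grad_x :: "(real \<Rightarrow> 'a::euclidean_space \<Rightarrow> 'a \<Rightarrow> real) \<Rightarrow> real \<Rightarrow> 'a \<Rightarrow> 'a \<Rightarrow> 'a" where
  "grad_x F t x v = grad (\<lambda>y. F t y v) x"

definition grad_v :: "(real \<Rightarrow> 'a::euclidean_space \<Rightarrow> 'a \<Rightarrow> real) \<Rightarrow> real \<Rightarrow> 'a \<Rightarrow> 'a \<Rightarrow> 'a" where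
  "grad_v F t x v = grad (\<lambda>y. F t x y) v"

end

theory Submission
  imports Defs
begin

text \<open>The functional is differentiated along segments, and the derivative found in this way depends
  continuously on the base point; the mean value theorem then turns it into a Frechet derivative.

  Growth of \<open>F\<^sub>v\<close>. Convexity of \<open>G\<close> gives \<open>G\<^sup>*(\<nabla>G(v)) \<le> G(2v)\<close> (\<open>conj_grad_le\<close>), so the third growth condition
  implies \<open>G\<^sup>*(F\<^sub>v(t,x,v)) \<le> a(|x|) (c(t) + G(2v))\<close>, and \<open>\<Delta>\<^sub>2\<close> makes the right-hand side integrable along
  every \<open>v\<close> in the Orlicz space. The condition \<open>\<nabla>\<^sub>2\<close> on \<open>G\<close> is used only as \<open>\<Delta>\<^sub>2\<close> for \<open>G\<^sup>*\<close> (\<open>conj_scaleR_le\<close>):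
  it bounds \<open>G\<^sup>*(r (p - q))\<close> by \<open>G\<^sup>*(p)\<close> and \<open>G\<^sup>*(q)\<close> for every factor \<open>r\<close>.

  Sobolev functions. The only facts needed about weak derivatives are that they are unique almost
  everywhere (hence linear in the function) and that \<open>|u| \<le> C \<parallel>u\<parallel>\<close> almost everywhere on \<open>I\<close>. Both come from
  testing with smooth bumps \<open>\<sigma>(n(t - c)) \<sigma>(n(d - t))\<close>, \<open>\<sigma>(t) = exp(-1/t)\<close>, which converge boundedly to the
  indicator of \<open>(c,d)\<close>. The difference of the antiderivatives of two normalized bumps is a test function
  with values in \<open>[-1,1]\<close>, so two averages of \<open>u\<close> over subintervals differ by at most the integral of the
  weak derivative; a function whose averages over all subintervals are at most \<open>M\<close> is itself at most
  \<open>M\<close> almost everywhere (\<open>AE_le_of_interval_integrals_le\<close>). No absolutely continuous representative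
  is constructed.

  Continuity of the derivative (\<open>J'_continuous\<close>). If it fails at \<open>u\<close>, there are \<open>w\<^sub>n\<close> with
  \<open>\<parallel>w\<^sub>n - u\<parallel> < 4\<^sup>-\<^sup>n\<^sup>-\<^sup>2\<close>. By convexity the integrals of \<open>G(2\<^sup>n\<^sup>+\<^sup>2 (w\<^sub>n - u)')\<close> are at most \<open>2\<^sup>-\<^sup>n\<close>, so their sum is an
  integrable majorant; it bounds the right-hand sides of the growth conditions and forces \<open>w\<^sub>n' \<rightarrow> u'\<close> almost everywhere, even
  though \<open>G\<close> may vanish near the origin. Dominated convergence yields \<open>F\<^sub>x(w\<^sub>n) \<rightarrow> F\<^sub>x(u)\<close> in \<open>L\<^sup>1\<close> and
  \<open>\<integral> G\<^sup>*(r (F\<^sub>v(w\<^sub>n) - F\<^sub>v(u))) \<rightarrow> 0\<close> for every \<open>r\<close> (\<open>superposition_continuous\<close>). Young's inequality, applied with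
  the factor \<open>r\<close>, turns this into smallness of the dual norm (\<open>J'_diff_le\<close>).\<close>

section \<open>Smooth functions and bumps on the line\<close>

text \<open>Infinitely differentiable real functions, in the form used by test functions.\<close>
definition smooth :: "(real \<Rightarrow> real) \<Rightarrow> bool" where
  "smooth f \<longleftrightarrow> (\<forall>k t. (deriv ^^ k) f differentiable (at t))"

text \<open>Coinduction: a set of differentiable functions that is closed under differentiation consists of
  smooth functions.\<close>
lemma smoothI_closed:
  assumes f: "f \<in> S"
    and S: "\<And>g. g \<in> S \<Longrightarrow> (\<forall>t. g differentiable (at t)) \<and> deriv g \<in> S"
  shows "smooth f"
proof -
  have "(deriv ^^ k) f \<in> S" for k
    by (induction k) (use f S in auto)
  then show ?thesis using S by (auto simp: smooth_def)
qed

lemma smooth_imp_differentiable: "smooth f \<Longrightarrow> f differentiable (at t)"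
  unfolding smooth_def by (drule spec[where x = 0]) simp

lemma smooth_imp_DERIV: "smooth f \<Longrightarrow> (f has_real_derivative deriv f t) (at t)"
  using smooth_imp_differentiable DERIV_deriv_iff_real_differentiable by blast

lemma smooth_deriv: "smooth f \<Longrightarrow> smooth (deriv f)"
  unfolding smooth_def
proof (intro allI)
  fix k t assume "\<forall>k t. (deriv ^^ k) f differentiable (at t)"
  then have "(deriv ^^ Suc k) f differentiable (at t)" by blast
  then show "(deriv ^^ k) (deriv f) differentiable (at t)" by (simp add: funpow_swap1)
qed

lemma smooth_antiderivative:
  assumes f: "smooth f" and F: "\<And>t. (F has_real_derivative f t) (at t)"
  shows "smooth F"
  unfolding smooth_def
proof (intro allI)
  fix k t
  have dF: "deriv F = f" using F DERIV_imp_deriv by blast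
  show "(deriv ^^ k) F differentiable (at t)"
  proof (cases k)
    case 0
    then show ?thesis using F real_differentiable_def by auto
  next
    case (Suc j)
    then show ?thesis using f by (simp add: funpow_swap1 dF smooth_def)
  qed
qed

lemma smooth_affine:
  assumes "smooth f" shows "smooth (\<lambda>t. r * f (m * t + d))"
proof (rule smoothI_closed[where S = "{h. \<exists>g r. smooth g \<and> h = (\<lambda>t. r * g (m * t + d))}"])
  show "(\<lambda>t. r * f (m * t + d)) \<in> {h. \<exists>g r. smooth g \<and> h = (\<lambda>t. r * g (m * t + d))}"
    using assms by blast
  fix h assume "h \<in> {h. \<exists>g r. smooth g \<and> h = (\<lambda>t. r * g (m * t + d))}"
  then obtain g r where g: "smooth g" and h: "h = (\<lambda>t. r * g (m * t + d))" by blast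
  have D: "(h has_real_derivative (r * m) * deriv g (m * t + d)) (at t)" for t
    unfolding h
    by (auto intro!: derivative_eq_intros DERIV_chain2[OF smooth_imp_DERIV[OF g]])
  then have "deriv h = (\<lambda>t. (r * m) * deriv g (m * t + d))"
    using DERIV_imp_deriv by blast
  moreover have "\<forall>t. h differentiable (at t)"
    using D real_differentiable_def by blast
  ultimately show "(\<forall>t. h differentiable (at t)) \<and>
      deriv h \<in> {h. \<exists>g r. smooth g \<and> h = (\<lambda>t. r * g (m * t + d))}"
    using smooth_deriv[OF g] by blast
qed

text \<open>The smallest set that contains the products of smooth functions and is closed under addition. By the
  product rule it is closed under differentiation.\<close>
inductive_set product_sums :: "(real \<Rightarrow> real) set" where
  prod: "smooth f \<Longrightarrow> smooth g \<Longrightarrow> (\<lambda>t. f t * g t) \<in> product_sums"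
| add: "p \<in> product_sums \<Longrightarrow> q \<in> product_sums \<Longrightarrow> (\<lambda>t. p t + q t) \<in> product_sums"

lemma product_sums_deriv:
  assumes "h \<in> product_sums"
  shows "\<exists>h' \<in> product_sums. \<forall>t. (h has_real_derivative h' t) (at t)"
  using assms
proof induction
  case (prod f g)
  have "(\<lambda>t. deriv f t * g t + f t * deriv g t) \<in> product_sums"
    by (intro product_sums.intros smooth_deriv prod)
  then show ?case
    by (rule bexI[rotated])
       (auto intro!: derivative_eq_intros smooth_imp_DERIV prod)
next
  case (add p q)
  then obtain p' q' where "p' \<in> product_sums" "\<forall>t. (p has_real_derivative p' t) (at t)"
    "q' \<in> product_sums" "\<forall>t. (q has_real_derivative q' t) (at t)" by blast
  then show ?case
    by (intro bexI[where x = "\<lambda>t. p' t + q' t"])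
       (auto intro!: derivative_eq_intros product_sums.add)
qed

lemma smooth_product_sums: "h \<in> product_sums \<Longrightarrow> smooth h"
proof (erule smoothI_closed)
  fix g assume "g \<in> product_sums"
  then obtain g' where g': "g' \<in> product_sums" "\<And>t. (g has_real_derivative g' t) (at t)"
    using product_sums_deriv by blast
  then have "deriv g = g'" using DERIV_imp_deriv by blast
  then show "(\<forall>t. g differentiable (at t)) \<and> deriv g \<in> product_sums"
    using g' real_differentiable_def by auto
qed

lemma smooth_mult: "smooth f \<Longrightarrow> smooth g \<Longrightarrow> smooth (\<lambda>t. f t * g t)"
  by (rule smooth_product_sums[OF product_sums.prod])

lemma smooth_const: "smooth (\<lambda>t. r)"
proof (rule smoothI_closed[where S = "range (\<lambda>r t. r)"])
  fix g :: "real \<Rightarrow> real" assume "g \<in> range (\<lambda>r t. r)"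
  then obtain r where "g = (\<lambda>t. r)" by blast
  then show "(\<forall>t. g differentiable (at t)) \<and> deriv g \<in> range (\<lambda>r t. r)" by auto
qed auto

lemma smooth_diff: "smooth f \<Longrightarrow> smooth g \<Longrightarrow> smooth (\<lambda>t. f t - g t)"
  using smooth_product_sums[OF product_sums.add[OF product_sums.prod[of f "\<lambda>_. 1"]
      product_sums.prod[of g "\<lambda>_. - 1"]]] smooth_const by simp

text \<open>\<open>p(1/t) exp(-1/t)\<close> for \<open>t > 0\<close>, extended by \<open>0\<close>. Allowing a polynomial factor makes the family closed
  under differentiation; \<open>p = 1\<close> is the classical flat function.\<close>
definition flat_exp :: "real poly \<Rightarrow> real \<Rightarrow> real" where
  "flat_exp p t = (if 0 < t then poly p (1 / t) * exp (- (1 / t)) else 0)"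

lemma poly_times_exp_minus_tendsto_0: "((\<lambda>x::real. poly p x * exp (- x)) \<longlongrightarrow> 0) at_top"
proof -
  have "((\<lambda>x. \<Sum>i\<le>degree p. coeff p i * (x ^ i / exp x)) \<longlongrightarrow> (\<Sum>i\<le>degree p. coeff p i * 0)) at_top"
    by (intro tendsto_intros tendsto_power_div_exp_0)
  moreover have "(\<Sum>i\<le>degree p. coeff p i * (x ^ i / exp x)) = poly p x * exp (- x)" for x
    by (simp add: poly_altdef sum_distrib_right exp_minus divide_inverse mult.assoc)
  ultimately show ?thesis by simp
qed

lemma flat_exp_tendsto_0: "((\<lambda>t. flat_exp p t / t) \<longlongrightarrow> 0) (at 0)"
proof (rule filterlim_split_at)
  show "((\<lambda>t. flat_exp p t / t) \<longlongrightarrow> 0) (at_left 0)"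
    by (rule tendsto_eventually) (auto simp: flat_exp_def eventually_at_filter)
  have "((\<lambda>t. poly (pCons 0 p) (inverse t) * exp (- inverse t)) \<longlongrightarrow> 0) (at_right 0)"
    by (rule filterlim_compose[OF poly_times_exp_minus_tendsto_0 filterlim_inverse_at_top_right])
  then show "((\<lambda>t. flat_exp p t / t) \<longlongrightarrow> 0) (at_right 0)"
    by (rule Lim_transform_eventually)
       (auto simp: flat_exp_def eventually_at_filter field_simps)
qed

lemma flat_exp_deriv:
  "(flat_exp p has_real_derivative flat_exp ([:0, 0, 1:] * (p - pderiv p)) t) (at t)"
proof -
  consider "t < 0" | "t = 0" | "0 < t" by linarith
  then show ?thesis
  proof cases
    case 1
    have "((\<lambda>_. 0) has_real_derivative 0) (at t)" by simp
    then have "(flat_exp p has_real_derivative 0) (at t)"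
      by (rule DERIV_cong_ev[THEN iffD1, rotated -1, OF _])
         (use 1 in \<open>auto simp: flat_exp_def eventually_nhds intro!: exI[of _ "{..<0}"]\<close>)
    then show ?thesis using 1 by (simp add: flat_exp_def)
  next
    case 2
    then show ?thesis
      using flat_exp_tendsto_0[of p] by (simp add: DERIV_def flat_exp_def)
  next
    case 3
    have "((\<lambda>t. poly p (1 / t) * exp (- (1 / t))) has_real_derivative
       poly ([:0, 0, 1:] * (p - pderiv p)) (1 / t) * exp (- (1 / t))) (at t)"
      using 3 by (auto intro!: derivative_eq_intros DERIV_chain2[OF poly_DERIV]
          simp: field_simps power2_eq_square)
    then have "(flat_exp p has_real_derivative
       poly ([:0, 0, 1:] * (p - pderiv p)) (1 / t) * exp (- (1 / t))) (at t)"
      by (rule DERIV_cong_ev[THEN iffD1, rotated -1, OF _])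
         (use 3 in \<open>auto simp: flat_exp_def eventually_nhds intro!: exI[of _ "{0<..}"]\<close>)
    then show ?thesis using 3 by (simp add: flat_exp_def)
  qed
qed

lemma smooth_flat_exp: "smooth (flat_exp p)"
proof (rule smoothI_closed[where S = "range flat_exp"])
  fix g assume "g \<in> range flat_exp"
  then obtain p where g: "g = flat_exp p" by blast
  have "deriv g = flat_exp ([:0, 0, 1:] * (p - pderiv p))"
    unfolding g using flat_exp_deriv DERIV_imp_deriv by blast
  then show "(\<forall>t. g differentiable (at t)) \<and> deriv g \<in> range flat_exp"
    using flat_exp_deriv real_differentiable_def unfolding g by blast
qed auto

text \<open>A smooth function with values in \<open>[0,1]\<close> that vanishes outside \<open>(c,d)\<close>. As \<open>n\<close> grows it converges
  pointwise to the indicator of \<open>(c,d)\<close>, since \<open>exp(-1/(n s)) \<rightarrow> 1\<close> for \<open>s > 0\<close>.\<close>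
definition bump :: "real \<Rightarrow> real \<Rightarrow> nat \<Rightarrow> real \<Rightarrow> real" where
  "bump c d n t = flat_exp 1 (real n * (t - c)) * flat_exp 1 (real n * (d - t))"

lemma smooth_bump: "smooth (bump c d n)"
proof -
  have "smooth (\<lambda>t. (1 * flat_exp 1 (real n * t + - (real n * c))) *
      (1 * flat_exp 1 (- real n * t + real n * d)))"
    by (intro smooth_mult smooth_affine smooth_flat_exp)
  moreover have "bump c d n = (\<lambda>t. (1 * flat_exp 1 (real n * t + - (real n * c))) *
      (1 * flat_exp 1 (- real n * t + real n * d)))"
    by (simp add: bump_def fun_eq_iff algebra_simps)
  ultimately show ?thesis by simp
qed

lemma bump_nonneg: "0 \<le> bump c d n t"
  by (simp add: bump_def flat_exp_def)

lemma bump_le_1: "bump c d n t \<le> 1"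
  unfolding bump_def by (rule mult_le_one) (auto simp: flat_exp_def)

lemma bump_eq_0: "t \<notin> {c<..<d} \<Longrightarrow> bump c d n t = 0"
  by (auto simp: bump_def flat_exp_def zero_less_mult_iff)

lemma bump_pos: "t \<in> {c<..<d} \<Longrightarrow> 0 < n \<Longrightarrow> 0 < bump c d n t"
  by (auto simp: bump_def flat_exp_def)

lemma bump_tendsto: "(\<lambda>n. bump c d n t) \<longlonglongrightarrow> indicator {c<..<d} t"
proof (cases "t \<in> {c<..<d}")
  case True
  have lim: "(\<lambda>n. flat_exp 1 (real n * s)) \<longlonglongrightarrow> 1" if "0 < s" for s
  proof -
    have "(\<lambda>n. exp (- (inverse (real n) * (1 / s)))) \<longlonglongrightarrow> exp (- (0 * (1 / s)))"
      by (intro tendsto_intros tendsto_inverse_0_at_top filterlim_real_sequentially)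
    moreover have "\<forall>\<^sub>F n in sequentially. exp (- (inverse (real n) * (1 / s))) = flat_exp 1 (real n * s)"
      using eventually_gt_at_top[of 0]
      by eventually_elim (use that in \<open>simp add: flat_exp_def divide_inverse\<close>)
    ultimately have "(\<lambda>n. flat_exp 1 (real n * s)) \<longlonglongrightarrow> exp (- (0 * (1 / s)))"
      by (rule Lim_transform_eventually)
    then show ?thesis by simp
  qed
  have "(\<lambda>n. bump c d n t) \<longlonglongrightarrow> 1 * 1"
    unfolding bump_def by (intro tendsto_mult lim) (use True in auto)
  then show ?thesis using True by simp
next
  case False
  then show ?thesis by (simp add: bump_eq_0)
qed

lemma continuous_on_bump: "continuous_on S (bump c d n)"
  by (meson smooth_imp_DERIV[OF smooth_bump] DERIV_isCont continuous_at_imp_continuous_on)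

lemma test_functionI:
  assumes "smooth \<phi>" and "\<And>t. t \<notin> {c..d} \<Longrightarrow> \<phi> t = 0" and "{c..d} \<subseteq> interior I"
  shows "test_function I \<phi>"
proof -
  have "closure {t. \<phi> t \<noteq> 0} \<subseteq> {c..d}"
    by (rule closure_minimal) (use assms(2) in blast, simp)
  then show ?thesis
    using assms(1,3) compact_Int_closed[of "{c..d}" "closure {t. \<phi> t \<noteq> 0}"]
    unfolding test_function_def smooth_def by (simp add: Int_absorb1)
qed

lemma test_function_bump: "{c..d} \<subseteq> interior I \<Longrightarrow> test_function I (bump c d n)"
  by (rule test_functionI[OF smooth_bump]) (auto intro: bump_eq_0)

text \<open>The antiderivative of a normalized bump: a smooth step from \<open>0\<close> to \<open>1\<close>.\<close>
lemma smooth_step_of_bump: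
  assumes cd: "c < d" and n: "0 < n"
  shows "\<exists>P. smooth P \<and>
     (\<forall>t. (P has_real_derivative bump c d n t / integral {c..d} (bump c d n)) (at t)) \<and>
     (\<forall>t\<le>c. P t = 0) \<and> (\<forall>t\<ge>d. P t = 1) \<and> (\<forall>t. 0 \<le> P t \<and> P t \<le> 1)"
proof -
  define m where "m = integral {c..d} (bump c d n)"
  let ?p = "\<lambda>t. bump c d n t / m"
  have "\<exists>F. \<forall>x. - \<infinity> < ereal x \<longrightarrow> ereal x < \<infinity> \<longrightarrow> (F has_vector_derivative bump c d n x) (at x)"
    by (rule einterval_antiderivative)
       (use continuous_on_bump[of UNIV c d n] in \<open>auto simp: continuous_on_eq_continuous_at\<close>)
  then obtain F where F: "\<And>t. (F has_real_derivative bump c d n t) (at t)"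
    by (auto simp: has_real_derivative_iff_has_vector_derivative)
  have mono: "F s \<le> F t" if "s \<le> t" for s t
    by (rule DERIV_nonneg_imp_nondecreasing[OF that]) (meson F bump_nonneg)
  have bump_ex: "\<exists>y. (F has_real_derivative y) (at x) \<and> y \<le> 0" if "x \<le> c \<or> d \<le> x" for x
    using F[of x] bump_eq_0[of x c d n] that by (intro exI[of _ "bump c d n x"]) auto
  have left: "F t = F c" if "t \<le> c" for t
  proof (rule order.antisym[OF mono[OF that]])
    show "F c \<le> F t"
      by (rule DERIV_nonpos_imp_nonincreasing[OF that])
         (use bump_ex in blast)
  qed
  have right: "F t = F d" if "d \<le> t" for t
  proof (rule order.antisym[OF _ mono[OF that]])
    show "F t \<le> F d"
      by (rule DERIV_nonpos_imp_nonincreasing[OF that])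
         (use bump_ex in blast)
  qed
  have "(bump c d n has_integral (F d - F c)) {c..d}"
    using F cd by (intro fundamental_theorem_of_calculus)
      (auto simp: has_real_derivative_iff_has_vector_derivative[symmetric]
        intro: has_field_derivative_at_within)
  then have m: "m = F d - F c" by (simp add: m_def integral_unique)
  have "F c < F d"
  proof (rule DERIV_pos_imp_increasing_open[OF cd])
    show "\<exists>y. (F has_real_derivative y) (at x) \<and> 0 < y" if "c < x" "x < d" for x
      using F[of x] bump_pos[of x c d n] that n by (intro exI conjI) auto
    show "continuous_on {c..d} F"
      by (meson F DERIV_isCont continuous_at_imp_continuous_on)
  qed
  then have mpos: "0 < m" using m by simp
  define P where "P = (\<lambda>t. (F t - F c) / m)"
  have P: "(P has_real_derivative ?p t) (at t)" for t
    unfolding P_def using mpos by (auto intro!: derivative_eq_intros F)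
  have "smooth ?p"
    using smooth_mult[OF smooth_bump smooth_const, of c d n "1 / m"] by simp
  then have "smooth P" using P by (rule smooth_antiderivative)
  moreover have "P t = 0" if "t \<le> c" for t using left[OF that] by (simp add: P_def)
  moreover have "P t = 1" if "d \<le> t" for t using right[OF that] mpos m by (simp add: P_def)
  moreover have "0 \<le> P t \<and> P t \<le> 1" for t
  proof -
    have "F c \<le> F t" using mono[of c t] left[of t] by (cases "c \<le> t") auto
    moreover have "F t \<le> F d" using mono[of t d] right[of t] by (cases "t \<le> d") auto
    ultimately show ?thesis using mpos m by (simp add: P_def)
  qed
  ultimately show ?thesis using P unfolding m_def by (intro exI[of _ P]) simp
qed

section \<open>Pointwise bounds from bounds on interval integrals\<close>

lemma emeasure_density_le_of_integral_le_0:
  fixes f :: "real \<Rightarrow> real"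
  assumes f: "integrable lborel f" and S: "S \<in> sets borel"
    and le: "(\<integral>x. indicator S x * f x \<partial>lborel) \<le> 0"
  shows "emeasure (density lborel (\<lambda>x. ennreal (f x))) S
       \<le> emeasure (density lborel (\<lambda>x. ennreal (- f x))) S"
proof -
  let ?g = "\<lambda>x. indicator S x * f x"
  have g: "integrable lborel ?g"
    using integrable_real_mult_indicator[OF _ f, of S] S by (simp add: mult.commute)
  have [measurable]: "f \<in> borel_measurable borel" "S \<in> sets borel"
    using f S by auto
  have e1: "emeasure (density lborel (\<lambda>x. ennreal (f x))) S = (\<integral>\<^sup>+ x. ennreal (?g x) \<partial>lborel)"
    by (subst emeasure_density) (auto intro!: nn_integral_cong simp: indicator_def)
  have e2: "emeasure (density lborel (\<lambda>x. ennreal (- f x))) S = (\<integral>\<^sup>+ x. ennreal (- ?g x) \<partial>lborel)"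
    by (subst emeasure_density) (auto intro!: nn_integral_cong simp: indicator_def)
  have fin: "(\<integral>\<^sup>+ x. ennreal (?g x) \<partial>lborel) < \<infinity>" "(\<integral>\<^sup>+ x. ennreal (- ?g x) \<partial>lborel) < \<infinity>"
    using g real_integrable_def[of lborel ?g] by (auto simp: top.not_eq_extremum)
  have "enn2real (\<integral>\<^sup>+ x. ennreal (?g x) \<partial>lborel) \<le> enn2real (\<integral>\<^sup>+ x. ennreal (- ?g x) \<partial>lborel)"
    using le real_lebesgue_integral_def[OF g] by simp
  from ennreal_leI[OF this] show ?thesis
    using fin by (simp only: e1 e2 ennreal_enn2real infinity_ennreal_def)
qed

text \<open>The measures with densities \<open>f\<^sup>+\<close> and \<open>f\<^sup>-\<close> are compared on intervals, then on open sets (countable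
  disjoint unions of intervals), then by outer regularity on the Borel set \<open>{f > 0}\<close>, where the second
  one vanishes.\<close>
lemma AE_le_0_of_integral_open_connected_le_0:
  fixes f :: "real \<Rightarrow> real"
  assumes f: "integrable lborel f"
    and le: "\<And>S. open S \<Longrightarrow> connected S \<Longrightarrow> (\<integral>x. indicator S x * f x \<partial>lborel) \<le> 0"
  shows "AE x in lborel. f x \<le> 0"
proof -
  define \<mu> where "\<mu> = density lborel (\<lambda>x. ennreal (f x))"
  define \<nu> where "\<nu> = density lborel (\<lambda>x. ennreal (- f x))"
  have [measurable]: "f \<in> borel_measurable borel" using f by auto
  have fin: "emeasure \<mu> (space \<mu>) \<noteq> \<infinity>" "emeasure \<nu> (space \<nu>) \<noteq> \<infinity>"
    using f real_integrable_def[of lborel f] by (auto simp: \<mu>_def \<nu>_def emeasure_density)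
  have sets: "sets \<mu> = sets borel" "sets \<nu> = sets borel" by (auto simp: \<mu>_def \<nu>_def)
  have opn: "emeasure \<mu> U \<le> emeasure \<nu> U" if U: "open U" for U
  proof -
    let ?C = "components U"
    have op: "open S" if "S \<in> ?C" for S using open_components[OF U that] .
    have cnt: "countable ?C"
      using countable_disjoint_nonempty_interior_subsets[of ?C] pairwise_disjoint_components[of U] op
      by (auto simp: pairwise_def disjnt_def interior_open)
    have disj: "disjoint_family_on (\<lambda>S. S) ?C"
      using pairwise_disjoint_components[of U] by (auto simp: pairwise_def disjoint_family_on_def)
    have "emeasure \<mu> (\<Union>((\<lambda>S. S) ` ?C)) = (\<integral>\<^sup>+S. emeasure \<mu> S \<partial>count_space ?C)"
      by (rule emeasure_UN_countable[OF _ cnt disj]) (use op sets in auto)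
    also have "\<dots> \<le> (\<integral>\<^sup>+S. emeasure \<nu> S \<partial>count_space ?C)"
      unfolding \<mu>_def \<nu>_def
      by (intro nn_integral_mono emeasure_density_le_of_integral_le_0 f le)
         (use op in_components_connected in auto)
    also have "\<dots> = emeasure \<nu> (\<Union>((\<lambda>S. S) ` ?C))"
      by (rule emeasure_UN_countable[OF _ cnt disj, symmetric]) (use op sets in auto)
    finally show ?thesis by simp
  qed
  define B where "B = {x. 0 < f x}"
  have B[measurable]: "B \<in> sets borel" by (simp add: B_def)
  have "emeasure \<mu> B = (INF U \<in> {U. B \<subseteq> U \<and> open U}. emeasure \<mu> U)"
    by (rule outer_regular[OF sets(1) fin(1) B])
  also have "\<dots> \<le> (INF U \<in> {U. B \<subseteq> U \<and> open U}. emeasure \<nu> U)"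
    by (rule INF_mono) (use opn in blast)
  also have "\<dots> = emeasure \<nu> B"
    by (rule outer_regular[OF sets(2) fin(2) B, symmetric])
  also have "\<dots> = (\<integral>\<^sup>+x. ennreal (- f x) * indicator B x \<partial>lborel)"
    unfolding \<nu>_def by (subst emeasure_density) auto
  also have "(\<lambda>x. ennreal (- f x) * indicator B x) = (\<lambda>x. 0)"
    by (auto simp: fun_eq_iff B_def indicator_def ennreal_neg)
  finally have "(\<integral>\<^sup>+x. ennreal (f x) * indicator B x \<partial>lborel) = 0"
    by (simp add: \<mu>_def emeasure_density)
  then have "AE x in lborel. ennreal (f x) * indicator B x = 0"
    by (subst (asm) nn_integral_0_iff_AE) measurable
  then show ?thesis
  proof eventually_elim
    case (elim x)
    then show ?case
      by (cases "0 < f x") (simp_all add: B_def indicator_def ennreal_eq_0_iff)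
  qed
qed

lemma bounded_open_connected_real:
  fixes S :: "real set"
  assumes S: "open S" "connected S" "bounded S" "S \<noteq> {}"
  shows "S = {Inf S<..<Sup S}" "Inf S < Sup S"
proof -
  have bdd: "bdd_below S" "bdd_above S" using S bounded_imp_bdd_below bounded_imp_bdd_above by auto
  have mem: "Inf S < x \<and> x < Sup S" if x: "x \<in> S" for x
  proof -
    obtain e where e: "0 < e" "\<And>y. dist y x < e \<Longrightarrow> y \<in> S"
      using S(1) x by (auto simp: open_dist)
    have "x - e / 2 \<in> S" "x + e / 2 \<in> S" using e by (auto simp: dist_real_def)
    then show ?thesis
      using cInf_lower[OF _ bdd(1), of "x - e / 2"] cSup_upper[OF _ bdd(2), of "x + e / 2"] e(1) by simp
  qed
  show "S = {Inf S<..<Sup S}"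
  proof (intro set_eqI iffI)
    fix x assume x: "x \<in> {Inf S<..<Sup S}"
    then obtain y z where "y \<in> S" "y < x" "z \<in> S" "x < z"
      using cInf_less_iff[OF S(4) bdd(1)] less_cSup_iff[OF S(4) bdd(2)] by auto
    then show "x \<in> S" using connectedD_interval[OF S(2), of y z x] by simp
  qed (use mem in auto)
  show "Inf S < Sup S" using mem S(4) by (meson all_not_in_conv order_less_trans)
qed

text \<open>The averages of \<open>f\<close> over subintervals bound \<open>f\<close>, without recourse to the Lebesgue differentiation theorem.\<close>
lemma AE_le_of_interval_integrals_le:
  fixes f :: "real \<Rightarrow> real"
  assumes f: "\<And>c d. \<alpha> < c \<Longrightarrow> c < d \<Longrightarrow> d < \<beta> \<Longrightarrow> f absolutely_integrable_on {c..d}"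
    and le: "\<And>c d. \<alpha> < c \<Longrightarrow> c < d \<Longrightarrow> d < \<beta> \<Longrightarrow> (LINT t:{c<..<d}|lebesgue. f t) \<le> M * (d - c)"
  shows "AE t in lebesgue. t \<in> {\<alpha><..<\<beta>} \<longrightarrow> f t \<le> M"
proof -
  have ind: "integrable lebesgue (indicat_real {c<..<d})" for c d :: real
    using bounded_set_imp_lmeasurable[of "{c<..<d}"] by (simp add: lmeasurable_iff_integrable)
  have *: "AE t in lebesgue. t \<in> {c<..<d} \<longrightarrow> f t \<le> M" if cd: "\<alpha> < c" "c < d" "d < \<beta>" for c d
  proof -
    define g where "g = (\<lambda>t. indicator {c<..<d} t * (f t - M))"
    have "set_integrable lebesgue {c<..<d} f"
      by (rule set_integrable_subset[OF f[OF cd]]) auto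
    then have "integrable lebesgue (\<lambda>t. indicator {c<..<d} t *\<^sub>R f t - indicator {c<..<d} t *\<^sub>R M)"
      unfolding set_integrable_def
      by (intro Bochner_Integration.integrable_diff integrable_scaleR_left ind)
    then have g: "integrable lebesgue g"
      by (simp add: g_def algebra_simps)
    then have "g \<in> borel_measurable lebesgue" by auto
    then obtain g' where g'm[measurable]: "g' \<in> borel_measurable lborel" and ae: "AE x in lborel. g x = g' x"
      using completion_ex_borel_measurable_real by blast
    have ae': "AE x in lebesgue. g x = g' x" using ae by (rule AE_completion)
    have g'm'[measurable]: "g' \<in> borel_measurable lebesgue" using g'm by (simp add: measurable_completion)
    have "integrable lebesgue g'"
      using g ae' by (subst integrable_cong_AE[symmetric, of g]) auto
    then have g'i: "integrable lborel g'" by (simp add: integrable_completion)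
    have "AE x in lborel. g' x \<le> 0"
    proof (rule AE_le_0_of_integral_open_connected_le_0[OF g'i])
      fix S :: "real set" assume S: "open S" "connected S"
      have Sm[measurable]: "S \<in> sets borel" using S by auto
      then have Sm': "S \<in> sets lebesgue" by auto
      have "(\<integral>x. indicator S x * g' x \<partial>lborel) = (\<integral>x. indicator S x * g' x \<partial>lebesgue)"
        by (intro integral_completion[symmetric]) measurable
      also have "\<dots> = (\<integral>x. indicator S x * g x \<partial>lebesgue)"
      proof (rule integral_cong_AE)
        show "(\<lambda>x. indicat_real S x * g' x) \<in> borel_measurable lebesgue"
          "(\<lambda>x. indicat_real S x * g x) \<in> borel_measurable lebesgue"
          using g Sm' by (intro borel_measurable_times g'm' borel_measurable_integrable
              borel_measurable_indicator; simp)+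
        show "AE x in lebesgue. indicat_real S x * g' x = indicat_real S x * g x"
          using ae' by eventually_elim simp
      qed
      also have "\<dots> = (LINT t:S \<inter> {c<..<d}|lebesgue. f t - M)"
        by (auto simp: g_def set_lebesgue_integral_def indicator_def intro!: Bochner_Integration.integral_cong)
      also have "\<dots> \<le> 0"
      proof (cases "S \<inter> {c<..<d} = {}")
        case True then show ?thesis by (simp add: set_lebesgue_integral_def)
      next
        case False
        define c' d' where "c' = Inf (S \<inter> {c<..<d})" and "d' = Sup (S \<inter> {c<..<d})"
        have conn: "connected (S \<inter> {c<..<d})"
          using S is_interval_Int[of S "{c<..<d}"] by (simp add: is_interval_connected_1)
        have bo: "open (S \<inter> {c<..<d})" "bounded (S \<inter> {c<..<d})"
          using S by (auto simp: bounded_Int)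
        note ocb = bounded_open_connected_real[OF bo(1) conn bo(2) False]
        have eq: "S \<inter> {c<..<d} = {c'<..<d'}" and lt: "c' < d'"
          unfolding c'_def d'_def by (rule ocb)+
        have "{c'<..<d'} \<subseteq> {c<..<d}" using eq by blast
        then have cd': "c \<le> c'" "d' \<le> d" using lt by (simp_all add: greaterThanLessThan_subseteq_greaterThanLessThan)
        have fi: "f absolutely_integrable_on {c'..d'}" using cd cd' lt by (intro f) auto
        have fi': "set_integrable lebesgue {c'<..<d'} f"
          by (rule set_integrable_subset[OF fi]) auto
        have "(LINT t:{c'<..<d'}|lebesgue. f t - M)
            = (LINT t:{c'<..<d'}|lebesgue. f t) - (LINT t:{c'<..<d'}|lebesgue. M)"
          by (intro set_integral_diff fi') (simp add: set_integrable_def ind)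
        also have "(LINT t:{c'<..<d'}|lebesgue. M) = M * (d' - c')"
          using lt ind[of c' d'] by (simp add: set_lebesgue_integral_def)
        also have "(LINT t:{c'<..<d'}|lebesgue. f t) \<le> M * (d' - c')"
          using cd cd' lt by (intro le) auto
        finally show ?thesis by (simp add: eq)
      qed
      finally show "(\<integral>x. indicator S x * g' x \<partial>lborel) \<le> 0" .
    qed
    then have "AE x in lebesgue. g' x \<le> 0" by (rule AE_completion)
    with ae' show ?thesis by eventually_elim (auto simp: g_def)
  qed
  have "AE t in lebesgue. \<forall>n::nat. t \<in> {\<alpha> + 1 / Suc n<..<\<beta> - 1 / Suc n} \<longrightarrow> f t \<le> M"
    unfolding AE_all_countable
  proof
    fix n :: nat
    show "AE t in lebesgue. t \<in> {\<alpha> + 1 / Suc n<..<\<beta> - 1 / Suc n} \<longrightarrow> f t \<le> M"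
    proof (cases "\<alpha> + 1 / Suc n < \<beta> - 1 / Suc n")
      case True then show ?thesis by (intro *) auto
    qed auto
  qed
  then show ?thesis
  proof eventually_elim
    case (elim t)
    show ?case
    proof
      assume t: "t \<in> {\<alpha><..<\<beta>}"
      then obtain n :: nat where "1 / Suc n < min (t - \<alpha>) (\<beta> - t)"
        using nat_approx_posE[of "min (t - \<alpha>) (\<beta> - t)"] by auto
      then show "f t \<le> M" using elim[rule_format, of n] by auto
    qed
  qed
qed

section \<open>Weak derivatives\<close>

lemma bump_integral_tendsto:
  fixes g :: "real \<Rightarrow> 'a::euclidean_space"
  assumes g: "g absolutely_integrable_on {c..d}" and I: "{c..d} \<subseteq> I" "I \<in> sets lebesgue"
  shows "(\<lambda>n. \<integral>t. bump c d n t *\<^sub>R g t \<partial>lebesgue_on I) \<longlonglongrightarrow> (LINT t:{c<..<d}|lebesgue. g t)"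
proof -
  let ?g = "\<lambda>t. indicator {c..d} t *\<^sub>R g t"
  have gi: "integrable lebesgue ?g" using g by (simp add: set_integrable_def)
  have bm[measurable]: "bump c d n \<in> borel_measurable lebesgue" for n
    using borel_measurable_continuous_onI[OF continuous_on_bump[of UNIV c d n]]
    by (simp add: measurable_completion)
  have [measurable]: "?g \<in> borel_measurable lebesgue" using gi by auto
  have "(\<lambda>n. \<integral>t. bump c d n t *\<^sub>R ?g t \<partial>lebesgue) \<longlonglongrightarrow> (\<integral>t. indicator {c<..<d} t *\<^sub>R ?g t \<partial>lebesgue)"
  proof (rule integral_dominated_convergence[where w = "\<lambda>t. norm (?g t)"])
    show "AE t in lebesgue. (\<lambda>n. bump c d n t *\<^sub>R ?g t) \<longlonglongrightarrow> indicator {c<..<d} t *\<^sub>R ?g t"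
      by (intro AE_I2 tendsto_scaleR bump_tendsto tendsto_const)
    show "AE t in lebesgue. norm (bump c d n t *\<^sub>R ?g t) \<le> norm (?g t)" for n
      using bump_nonneg[of c d n] bump_le_1[of c d n]
      by (intro AE_I2) (simp add: mult_left_le_one_le mult.assoc)
    show "(\<lambda>t. indicat_real {c<..<d} t *\<^sub>R ?g t) \<in> borel_measurable lebesgue"
      by (intro borel_measurable_scaleR borel_measurable_indicator borel_measurable_integrable[OF gi]) auto
    show "(\<lambda>t. bump c d n t *\<^sub>R ?g t) \<in> borel_measurable lebesgue" for n
      by (intro borel_measurable_scaleR bm borel_measurable_integrable[OF gi])
    show "integrable lebesgue (\<lambda>t. norm (?g t))" by (rule integrable_norm[OF gi])
  qed
  moreover have "(\<integral>t. indicator {c<..<d} t *\<^sub>R ?g t \<partial>lebesgue) = (LINT t:{c<..<d}|lebesgue. g t)"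
    unfolding set_lebesgue_integral_def
    by (intro Bochner_Integration.integral_cong) (auto simp: indicator_def)
  moreover have "(\<integral>t. bump c d n t *\<^sub>R ?g t \<partial>lebesgue) = (\<integral>t. bump c d n t *\<^sub>R g t \<partial>lebesgue_on I)" for n
  proof -
    have "bump c d n t *\<^sub>R ?g t = indicator I t *\<^sub>R (bump c d n t *\<^sub>R g t)" for t
      using I(1) bump_eq_0[of t c d n] by (cases "t \<in> {c..d}") (auto simp: indicator_def)
    then have "(\<integral>t. bump c d n t *\<^sub>R ?g t \<partial>lebesgue) = (\<integral>t. indicator I t *\<^sub>R (bump c d n t *\<^sub>R g t) \<partial>lebesgue)"
      by (simp only:)
    moreover have "I \<inter> space lebesgue \<in> sets lebesgue" using I(2) by simp
    ultimately show ?thesis by (simp only: integral_restrict_space)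
  qed
  ultimately show ?thesis by simp
qed

lemma integrable_lebesgue_on_imp_absolutely_integrable:
  fixes g :: "real \<Rightarrow> 'a::euclidean_space"
  assumes "integrable (lebesgue_on I) g" "I \<in> sets lebesgue" "{c..d} \<subseteq> I"
  shows "g absolutely_integrable_on {c..d}"
  using assms by (intro set_integrable_subset[of lebesgue I g "{c..d}"]) (auto simp: set_integrable_eq)

lemma set_integral_inner_left:
  fixes p :: "'b \<Rightarrow> 'a::euclidean_space"
  assumes "set_integrable M A p"
  shows "(LINT t:A|M. p t \<bullet> b) = (LINT t:A|M. p t) \<bullet> b"
proof -
  have "(LINT t|M. (indicator A t *\<^sub>R p t) \<bullet> b) = (LINT t|M. indicator A t *\<^sub>R p t) \<bullet> b"
    using assms unfolding set_integrable_def by (intro integral_inner_left)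
  then show ?thesis by (simp add: set_lebesgue_integral_def)
qed

lemma has_weak_derivD:
  "has_weak_deriv I u v \<Longrightarrow> test_function I \<phi> \<Longrightarrow>
    (\<integral>t. deriv \<phi> t *\<^sub>R u t \<partial>lebesgue_on I) = - (\<integral>t. \<phi> t *\<^sub>R v t \<partial>lebesgue_on I)"
  by (simp add: has_weak_deriv_def)

lemma has_weak_deriv_AE_unique:
  fixes v w :: "real \<Rightarrow> 'a::euclidean_space"
  assumes v: "has_weak_deriv I u v" and w: "has_weak_deriv I u w"
    and I: "interior I = {\<alpha><..<\<beta>}" "I \<in> sets lebesgue"
  shows "AE t in lebesgue. t \<in> interior I \<longrightarrow> v t = w t"
proof -
  have ai: "v absolutely_integrable_on {c..d}" "w absolutely_integrable_on {c..d}"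
    if "\<alpha> < c" "d < \<beta>" for c d
  proof -
    have "compact {c..d} \<and> {c..d} \<subseteq> interior I" using that by (auto simp: I(1))
    then show "v absolutely_integrable_on {c..d}" "w absolutely_integrable_on {c..d}"
      using v w unfolding has_weak_deriv_def locally_integrable_def by simp_all
  qed
  have eq: "(LINT t:{c<..<d}|lebesgue. v t) = (LINT t:{c<..<d}|lebesgue. w t)"
    if cd: "\<alpha> < c" "d < \<beta>" for c d
  proof -
    have sub: "{c..d} \<subseteq> interior I" using cd unfolding I(1) by auto
    then have sub': "{c..d} \<subseteq> I" using interior_subset by blast
    have "(\<integral>t. bump c d n t *\<^sub>R v t \<partial>lebesgue_on I) = (\<integral>t. bump c d n t *\<^sub>R w t \<partial>lebesgue_on I)" for n
      using has_weak_derivD[OF v test_function_bump[OF sub, of n]]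
        has_weak_derivD[OF w test_function_bump[OF sub, of n]] by simp
    then show ?thesis
      using LIMSEQ_unique[OF bump_integral_tendsto[OF ai(1)[OF cd] sub' I(2)]]
        bump_integral_tendsto[OF ai(2)[OF cd] sub' I(2)] by simp
  qed
  have le: "AE t in lebesgue. t \<in> {\<alpha><..<\<beta>} \<longrightarrow> (p t - q t) \<bullet> b \<le> 0"
    if p: "\<And>c d. \<alpha> < c \<Longrightarrow> d < \<beta> \<Longrightarrow> p absolutely_integrable_on {c..d}"
      and q: "\<And>c d. \<alpha> < c \<Longrightarrow> d < \<beta> \<Longrightarrow> q absolutely_integrable_on {c..d}"
      and pq: "\<And>c d. \<alpha> < c \<Longrightarrow> d < \<beta> \<Longrightarrow> (LINT t:{c<..<d}|lebesgue. p t) = (LINT t:{c<..<d}|lebesgue. q t)"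
    for p q :: "real \<Rightarrow> 'a" and b
  proof (rule AE_le_of_interval_integrals_le)
    fix c d assume cd: "\<alpha> < c" "c < d" "d < \<beta>"
    show "(\<lambda>t. (p t - q t) \<bullet> b) absolutely_integrable_on {c..d}"
      by (rule absolutely_integrable_component[OF set_integral_diff(1)[OF p[OF cd(1,3)] q[OF cd(1,3)]]])
    have sub: "{c<..<d} \<in> sets lebesgue" "{c<..<d} \<subseteq> {c..d}"
      by (auto simp: greaterThanLessThan_subseteq_atLeastAtMost_iff)
    note pi = set_integrable_subset[OF p[OF cd(1,3)] sub] set_integrable_subset[OF q[OF cd(1,3)] sub]
    have "(LINT t:{c<..<d}|lebesgue. (p t - q t) \<bullet> b) = (LINT t:{c<..<d}|lebesgue. p t - q t) \<bullet> b"
      by (rule set_integral_inner_left[OF set_integral_diff(1)[OF pi]])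
    also have "\<dots> = 0"
      using set_integral_diff(2)[OF pi] pq[of c d] cd by simp
    finally show "(LINT t:{c<..<d}|lebesgue. (p t - q t) \<bullet> b) \<le> 0 * (d - c)" by simp
  qed
  have "AE t in lebesgue. \<forall>b\<in>Basis. t \<in> {\<alpha><..<\<beta>} \<longrightarrow> (v t - w t) \<bullet> b \<le> 0 \<and> (w t - v t) \<bullet> b \<le> 0"
  proof (rule AE_finite_allI[OF finite_Basis])
    fix b :: 'a
    have "AE t in lebesgue. t \<in> {\<alpha><..<\<beta>} \<longrightarrow> (v t - w t) \<bullet> b \<le> 0"
      by (rule le) (rule ai eq; assumption)+
    moreover have "AE t in lebesgue. t \<in> {\<alpha><..<\<beta>} \<longrightarrow> (w t - v t) \<bullet> b \<le> 0"
      by (rule le) (rule ai eq[symmetric]; assumption)+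
    ultimately show "AE t in lebesgue. t \<in> {\<alpha><..<\<beta>} \<longrightarrow> (v t - w t) \<bullet> b \<le> 0 \<and> (w t - v t) \<bullet> b \<le> 0"
      by eventually_elim blast
  qed
  then show ?thesis
  proof eventually_elim
    case (elim t)
    show ?case
    proof
      assume "t \<in> interior I"
      then have t: "t \<in> {\<alpha><..<\<beta>}" by (simp only: I(1))
      have "v t \<bullet> b = w t \<bullet> b" if "b \<in> Basis" for b
        using elim[rule_format, OF that t] by (simp add: inner_diff_left)
      then show "v t = w t" by (rule euclidean_eqI)
    qed
  qed
qed

lemma integral_bump_tendsto:
  assumes "c < d" shows "(\<lambda>n. integral {c..d} (bump c d n)) \<longlonglongrightarrow> d - c"
proof -
  have "(\<lambda>n. \<integral>t. bump c d n t *\<^sub>R (1::real) \<partial>lebesgue_on {c..d}) \<longlonglongrightarrow> (LINT t:{c<..<d}|lebesgue. 1::real)"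
    by (rule bump_integral_tendsto) auto
  moreover have "(LINT t:{c<..<d}|lebesgue. 1::real) = d - c"
    using assms by (simp add: set_lebesgue_integral_def)
  moreover have "(\<integral>t. bump c d n t *\<^sub>R (1::real) \<partial>lebesgue_on {c..d}) = integral {c..d} (bump c d n)" for n
    using lebesgue_integral_eq_integral[of "{c..d}" "bump c d n"]
      continuous_imp_integrable_real[OF continuous_on_bump[of "{c..d}" c d n]] by simp
  ultimately show ?thesis by simp
qed

text \<open>The test function is the difference \<open>P - Q\<close> of two smooth steps, whose derivative is a difference of
  normalized bumps.\<close>
lemma average_diff_le_integral_norm_weak_deriv:
  fixes u v :: "real \<Rightarrow> 'a::euclidean_space"
  assumes uv: "has_weak_deriv I u v"
    and v: "integrable (lebesgue_on I) v"
    and I: "I \<in> sets lebesgue"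
    and cd: "c < d" "{c..d} \<subseteq> interior I" "c' < d'" "{c'..d'} \<subseteq> interior I"
    and hull: "{min c c'..max d d'} \<subseteq> interior I"
  shows "norm ((LINT t:{c<..<d}|lebesgue. u t) /\<^sub>R (d - c) - (LINT t:{c'<..<d'}|lebesgue. u t) /\<^sub>R (d' - c'))
      \<le> (\<integral>t. norm (v t) \<partial>lebesgue_on I)"
proof -
  have sub: "{c..d} \<subseteq> I" "{c'..d'} \<subseteq> I" using cd interior_subset by blast+
  have ai: "u absolutely_integrable_on {c..d}" "u absolutely_integrable_on {c'..d'}"
    using uv cd compact_Icc[of c d] compact_Icc[of c' d']
    unfolding has_weak_deriv_def locally_integrable_def by blast+
  define m where "m = (\<lambda>n. integral {c..d} (bump c d n))"
  define m' where "m' = (\<lambda>n. integral {c'..d'} (bump c' d' n))"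
  define A where "A = (\<lambda>n. \<integral>t. bump c d n t *\<^sub>R u t \<partial>lebesgue_on I)"
  define A' where "A' = (\<lambda>n. \<integral>t. bump c' d' n t *\<^sub>R u t \<partial>lebesgue_on I)"
  have bi: "integrable (lebesgue_on I) (\<lambda>t. bump p q n t *\<^sub>R u t)"
    if ai: "u absolutely_integrable_on {p..q}" and sub: "{p..q} \<subseteq> I" for p q n
  proof -
    have ui: "integrable lebesgue (\<lambda>t. indicator {p..q} t *\<^sub>R u t)"
      using ai by (simp add: set_integrable_def)
    have bm: "bump p q n \<in> borel_measurable lebesgue"
      using borel_measurable_continuous_onI[OF continuous_on_bump[of UNIV p q n]]
      by (simp add: measurable_completion)
    have "integrable lebesgue (\<lambda>t. bump p q n t *\<^sub>R (indicator {p..q} t *\<^sub>R u t))"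
    proof (rule Bochner_Integration.integrable_bound[OF ui])
      show "(\<lambda>t. bump p q n t *\<^sub>R (indicator {p..q} t *\<^sub>R u t)) \<in> borel_measurable lebesgue"
        by (intro borel_measurable_scaleR bm borel_measurable_integrable[OF ui])
      show "AE t in lebesgue. norm (bump p q n t *\<^sub>R (indicator {p..q} t *\<^sub>R u t)) \<le> norm (indicator {p..q} t *\<^sub>R u t)"
        using bump_nonneg[of p q n] bump_le_1[of p q n]
        by (intro AE_I2) (simp add: mult_left_le_one_le mult.assoc)
    qed
    moreover have "(\<lambda>t. bump p q n t *\<^sub>R (indicator {p..q} t *\<^sub>R u t)) = (\<lambda>t. indicator I t *\<^sub>R (bump p q n t *\<^sub>R u t))"
    proof
      show "bump p q n t *\<^sub>R (indicator {p..q} t *\<^sub>R u t) = indicator I t *\<^sub>R (bump p q n t *\<^sub>R u t)" for t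
        using sub bump_eq_0[of t p q n] by (cases "t \<in> {p..q}") (auto simp: indicator_def)
    qed
    moreover have "I \<inter> space lebesgue \<in> sets lebesgue" using I by simp
    ultimately show ?thesis by (simp only: integrable_restrict_space)
  qed
  have bound: "norm (A n /\<^sub>R m n - A' n /\<^sub>R m' n) \<le> (\<integral>t. norm (v t) \<partial>lebesgue_on I)" if n: "0 < n" for n
  proof -
    obtain P where P: "smooth P" "\<And>t. (P has_real_derivative bump c d n t / m n) (at t)"
      "\<And>t. t \<le> c \<Longrightarrow> P t = 0" "\<And>t. d \<le> t \<Longrightarrow> P t = 1" "\<And>t. 0 \<le> P t" "\<And>t. P t \<le> 1"
      using smooth_step_of_bump[OF cd(1) n] unfolding m_def by blast
    obtain Q where Q: "smooth Q" "\<And>t. (Q has_real_derivative bump c' d' n t / m' n) (at t)"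
      "\<And>t. t \<le> c' \<Longrightarrow> Q t = 0" "\<And>t. d' \<le> t \<Longrightarrow> Q t = 1" "\<And>t. 0 \<le> Q t" "\<And>t. Q t \<le> 1"
      using smooth_step_of_bump[OF cd(3) n] unfolding m'_def by blast
    \<comment> \<open>both steps are \<open>0\<close> to the left and \<open>1\<close> to the right of the two intervals, so \<open>W\<close> has compact support\<close>
    define W where "W = (\<lambda>t. P t - Q t)"
    have sW: "smooth W" unfolding W_def using P(1) Q(1) by (rule smooth_diff)
    have tf: "test_function I W"
    proof (rule test_functionI[OF sW _ hull])
      show "W t = 0" if "t \<notin> {min c c'..max d d'}" for t
        using that P(3,4)[of t] Q(3,4)[of t] cd by (cases "t < min c c'") (auto simp: W_def)
    qed
    have W1: "\<bar>W t\<bar> \<le> 1" for t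
      using P(5,6)[of t] Q(5,6)[of t] by (simp add: W_def abs_le_iff)
    have "(W has_real_derivative bump c d n t / m n - bump c' d' n t / m' n) (at t)" for t
      unfolding W_def by (intro DERIV_diff P Q)
    then have dW: "deriv W t = bump c d n t / m n - bump c' d' n t / m' n" for t
      by (rule DERIV_imp_deriv)
    have "(\<integral>t. deriv W t *\<^sub>R u t \<partial>lebesgue_on I)
        = (\<integral>t. (bump c d n t *\<^sub>R u t) /\<^sub>R m n - (bump c' d' n t *\<^sub>R u t) /\<^sub>R m' n \<partial>lebesgue_on I)"
      by (simp add: dW scaleR_left_diff_distrib divide_inverse mult.commute)
    also have "\<dots> = A n /\<^sub>R m n - A' n /\<^sub>R m' n"
      unfolding A_def A'_def
      by (subst Bochner_Integration.integral_diff)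
         (simp_all only: integral_scaleR_right integrable_scaleR_right bi[OF ai(1) sub(1)] bi[OF ai(2) sub(2)])
    finally have "norm (A n /\<^sub>R m n - A' n /\<^sub>R m' n) = norm (\<integral>t. W t *\<^sub>R v t \<partial>lebesgue_on I)"
      using has_weak_derivD[OF uv tf] norm_minus_cancel[of "\<integral>t. W t *\<^sub>R v t \<partial>lebesgue_on I"] by simp
    also have "\<dots> \<le> (\<integral>t. norm (W t *\<^sub>R v t) \<partial>lebesgue_on I)"
      by (rule integral_norm_bound)
    also have "\<dots> \<le> (\<integral>t. norm (v t) \<partial>lebesgue_on I)"
    proof (rule integral_mono')
      show "norm (W t *\<^sub>R v t) \<le> norm (v t)" for t
        using mult_right_mono[OF W1[of t] norm_ge_zero[of "v t"]] by simp
    qed (use v in auto)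
    finally show ?thesis .
  qed
  have "(\<lambda>n. A n /\<^sub>R m n - A' n /\<^sub>R m' n) \<longlonglongrightarrow>
      (LINT t:{c<..<d}|lebesgue. u t) /\<^sub>R (d - c) - (LINT t:{c'<..<d'}|lebesgue. u t) /\<^sub>R (d' - c')"
    unfolding A_def A'_def m_def m'_def using cd(1,3)
    by (intro tendsto_diff tendsto_scaleR tendsto_inverse integral_bump_tendsto
        bump_integral_tendsto ai sub I) auto
  then show ?thesis
    by (rule LIMSEQ_le_const2[OF tendsto_norm]) (intro exI[of _ 1] allI impI bound, simp)
qed

text \<open>The embedding of \<open>W\<^sup>1\<^sup>,\<^sup>1\<close> into \<open>L\<^sup>\<infinity>\<close>.\<close>
lemma AE_norm_le_of_weak_deriv:
  fixes u v :: "real \<Rightarrow> 'a::euclidean_space"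
  assumes uv: "has_weak_deriv I u v"
    and u: "integrable (lebesgue_on I) u" and v: "integrable (lebesgue_on I) v"
    and I: "I \<in> sets lebesgue" "interior I = {\<alpha><..<\<beta>}" "\<alpha> < \<beta>"
  shows "AE t in lebesgue. t \<in> interior I \<longrightarrow> norm (u t) \<le>
     DIM('a) * (2 / (\<beta> - \<alpha>) * (\<integral>t. norm (u t) \<partial>lebesgue_on I) + (\<integral>t. norm (v t) \<partial>lebesgue_on I))"
proof -
  define M where "M = 2 / (\<beta> - \<alpha>) * (\<integral>t. norm (u t) \<partial>lebesgue_on I) + (\<integral>t. norm (v t) \<partial>lebesgue_on I)"
  \<comment> \<open>the average over a fixed compact subinterval controls all other averages\<close>
  define c' d' where "c' = \<alpha> + (\<beta> - \<alpha>) / 4" and "d' = \<beta> - (\<beta> - \<alpha>) / 4"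
  have c': "\<alpha> < c'" "c' < d'" "d' < \<beta>" using I(3) by (simp_all add: c'_def d'_def field_simps)
  have len: "d' - c' = (\<beta> - \<alpha>) / 2" by (simp add: c'_def d'_def field_simps)
  have sI: "{c..d} \<subseteq> I" if "\<alpha> < c" "d < \<beta>" for c d
  proof -
    have "{c..d} \<subseteq> interior I" using that by (auto simp: I(2))
    then show ?thesis using interior_subset by blast
  qed
  have ai: "u absolutely_integrable_on {c..d}" if "\<alpha> < c" "d < \<beta>" for c d
    by (rule integrable_lebesgue_on_imp_absolutely_integrable[OF u I(1) sI[OF that]])
  have avg: "norm (LINT t:{c<..<d}|lebesgue. u t) \<le> M * (d - c)" if cd: "\<alpha> < c" "c < d" "d < \<beta>" for c d
  proof -
    let ?a = "(LINT t:{c<..<d}|lebesgue. u t) /\<^sub>R (d - c)"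
    let ?b = "(LINT t:{c'<..<d'}|lebesgue. u t) /\<^sub>R (d' - c')"
    have "norm (?a - ?b) \<le> (\<integral>t. norm (v t) \<partial>lebesgue_on I)"
      by (rule average_diff_le_integral_norm_weak_deriv[OF uv v I(1)])
         (use cd c' in \<open>auto simp: I(2)\<close>)
    moreover have "norm ?b \<le> 2 / (\<beta> - \<alpha>) * (\<integral>t. norm (u t) \<partial>lebesgue_on I)"
    proof -
      have i: "integrable lebesgue (\<lambda>t. indicator I t *\<^sub>R norm (u t))"
        using integrable_norm[OF u] I(1) by (simp add: integrable_restrict_space)
      have "norm (LINT t:{c'<..<d'}|lebesgue. u t) \<le> (\<integral>t. norm (indicator {c'<..<d'} t *\<^sub>R u t) \<partial>lebesgue)"
        unfolding set_lebesgue_integral_def by (rule integral_norm_bound)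
      also have "\<dots> \<le> (\<integral>t. indicator I t *\<^sub>R norm (u t) \<partial>lebesgue)"
        by (rule integral_mono'[OF i]) (use subsetD[OF sI[OF c'(1,3)]] in \<open>auto simp: indicator_def\<close>)
      also have "\<dots> = (\<integral>t. norm (u t) \<partial>lebesgue_on I)"
        using I(1) by (simp add: integral_restrict_space)
      finally have "inverse ((\<beta> - \<alpha>) / 2) * norm (LINT t:{c'<..<d'}|lebesgue. u t)
          \<le> inverse ((\<beta> - \<alpha>) / 2) * (\<integral>t. norm (u t) \<partial>lebesgue_on I)"
        using I(3) by (intro mult_left_mono) auto
      moreover have "norm ?b = inverse ((\<beta> - \<alpha>) / 2) * norm (LINT t:{c'<..<d'}|lebesgue. u t)"
        unfolding len norm_scaleR using I(3) by (subst abs_of_pos) auto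
      ultimately show ?thesis by (simp only: inverse_divide)
    qed
    ultimately have "norm ?a \<le> M"
      using norm_triangle_sub[of ?a ?b] by (simp add: M_def)
    then show ?thesis using cd by (simp add: divide_simps mult.commute)
  qed
  have "AE t in lebesgue. \<forall>b\<in>Basis. t \<in> {\<alpha><..<\<beta>} \<longrightarrow> \<bar>u t \<bullet> b\<bar> \<le> M"
  proof (rule AE_finite_allI[OF finite_Basis])
    fix b :: 'a assume b: "b \<in> Basis"
    have *: "AE t in lebesgue. t \<in> {\<alpha><..<\<beta>} \<longrightarrow> u t \<bullet> x \<le> M" if x: "norm x = 1" for x
    proof (rule AE_le_of_interval_integrals_le)
      fix c d assume cd: "\<alpha> < c" "c < d" "d < \<beta>"
      show "(\<lambda>t. u t \<bullet> x) absolutely_integrable_on {c..d}"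
        by (rule absolutely_integrable_component[OF ai[OF cd(1,3)]])
      have sub: "{c<..<d} \<in> sets lebesgue" "{c<..<d} \<subseteq> {c..d}"
        by (auto simp: greaterThanLessThan_subseteq_atLeastAtMost_iff)
      have "(LINT t:{c<..<d}|lebesgue. u t \<bullet> x) = (LINT t:{c<..<d}|lebesgue. u t) \<bullet> x"
        by (rule set_integral_inner_left[OF set_integrable_subset[OF ai[OF cd(1,3)] sub]])
      also have "\<dots> \<le> norm (LINT t:{c<..<d}|lebesgue. u t) * norm x" by (rule norm_cauchy_schwarz)
      also have "\<dots> \<le> M * (d - c)" using avg[OF cd] x by simp
      finally show "(LINT t:{c<..<d}|lebesgue. u t \<bullet> x) \<le> M * (d - c)" .
    qed
    have "AE t in lebesgue. t \<in> {\<alpha><..<\<beta>} \<longrightarrow> u t \<bullet> b \<le> M"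
      "AE t in lebesgue. t \<in> {\<alpha><..<\<beta>} \<longrightarrow> u t \<bullet> - b \<le> M"
      by (rule *, simp add: b)+
    then show "AE t in lebesgue. t \<in> {\<alpha><..<\<beta>} \<longrightarrow> \<bar>u t \<bullet> b\<bar> \<le> M"
      by eventually_elim auto
  qed
  then show ?thesis
  proof eventually_elim
    case (elim t)
    show ?case
    proof
      assume t: "t \<in> interior I"
      have "norm (u t) \<le> (\<Sum>b\<in>Basis. \<bar>u t \<bullet> b\<bar>)" by (rule norm_le_l1)
      also have "\<dots> \<le> (\<Sum>b\<in>(Basis::'a set). M)" by (rule sum_mono) (use elim t in \<open>auto simp: I(2)\<close>)
      finally show "norm (u t) \<le> DIM('a) * (2 / (\<beta> - \<alpha>) * (\<integral>t. norm (u t) \<partial>lebesgue_on I)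
          + (\<integral>t. norm (v t) \<partial>lebesgue_on I))"
        by (simp add: M_def)
    qed
  qed
qed

text \<open>For the empty interval \<open>\<alpha> = 1\<close>, \<open>\<beta> = 0\<close>; for a point \<open>\<alpha> = \<beta>\<close>. In both cases the interior is empty, so that
  degenerate intervals need no separate treatment.\<close>
lemma bounded_interval_interior:
  fixes I :: "real set"
  assumes I: "is_interval I" "bounded I"
  obtains \<alpha> \<beta> where "interior I = {\<alpha><..<\<beta>}" "I \<subseteq> {\<alpha>..\<beta>}"
proof (cases "I = {}")
  case True
  then show ?thesis by (intro that[of 1 0]) auto
next
  case False
  have bdd: "bdd_below I" "bdd_above I" using I bounded_imp_bdd_below bounded_imp_bdd_above by auto
  have sub: "I \<subseteq> {Inf I..Sup I}"
    using cInf_lower[OF _ bdd(1)] cSup_upper[OF _ bdd(2)] by auto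
  have "{Inf I<..<Sup I} \<subseteq> I"
  proof
    fix x assume x: "x \<in> {Inf I<..<Sup I}"
    then obtain y z where "y \<in> I" "y < x" "z \<in> I" "x < z"
      using cInf_less_iff[OF False bdd(1)] less_cSup_iff[OF False bdd(2)] by auto
    then show "x \<in> I" using I(1)[unfolded is_interval_1, rule_format, of y z x] by simp
  qed
  then have "{Inf I<..<Sup I} \<subseteq> interior I" by (simp add: interior_maximal)
  moreover have "interior I \<subseteq> {Inf I<..<Sup I}"
    using interior_mono[OF sub] by (simp add: interior_atLeastAtMost_real)
  ultimately have "interior I = {Inf I<..<Sup I}" by (rule subset_antisym[rotated])
  then show ?thesis using sub by (rule that)
qed

lemma bounded_interval_lmeasurable:
  fixes I :: "real set"
  shows "is_interval I \<Longrightarrow> bounded I \<Longrightarrow> I \<in> lmeasurable"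
  by (simp add: is_interval_convex measurable_convex)

lemma AE_lebesgue_on_interiorI:
  fixes I :: "real set"
  assumes I: "is_interval I" "bounded I"
    and P: "AE t in lebesgue. t \<in> interior I \<longrightarrow> P t"
  shows "AE t in lebesgue_on I. P t"
proof -
  obtain \<alpha> \<beta> where ab: "interior I = {\<alpha><..<\<beta>}" "I \<subseteq> {\<alpha>..\<beta>}"
    using bounded_interval_interior[OF I] .
  have m: "I \<in> sets lebesgue" using bounded_interval_lmeasurable[OF I] by auto
  have "{\<alpha>, \<beta>} \<in> null_sets lebesgue"
    by (simp add: negligible_iff_null_sets[symmetric])
  then have "AE t in lebesgue. t \<notin> {\<alpha>, \<beta>}" by (rule AE_not_in)
  with P have "AE t in lebesgue. t \<in> I \<longrightarrow> P t"
  proof eventually_elim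
    case (elim t)
    then show ?case using ab(2) by (fastforce simp: ab(1))
  qed
  then show ?thesis using m by (simp add: AE_restrict_space_iff)
qed

lemma integrable_supported_mult:
  fixes u :: "real \<Rightarrow> 'a::euclidean_space" and h :: "real \<Rightarrow> real"
  assumes h: "continuous_on UNIV h" "\<And>t. t \<notin> K \<Longrightarrow> h t = 0"
    and K: "compact K" "K \<subseteq> I" and u: "u absolutely_integrable_on K" and I: "I \<in> sets lebesgue"
  shows "integrable (lebesgue_on I) (\<lambda>t. h t *\<^sub>R u t)"
proof -
  have "bounded (h ` K)"
    by (intro compact_imp_bounded compact_continuous_image continuous_on_subset[OF h(1)] K) simp
  then obtain B where B: "\<And>t. t \<in> K \<Longrightarrow> \<bar>h t\<bar> \<le> B"
    by (auto simp: bounded_iff)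
  have hm: "h \<in> borel_measurable lebesgue"
    using borel_measurable_continuous_onI[OF h(1)] by (simp add: measurable_completion)
  have ui: "integrable lebesgue (\<lambda>t. B *\<^sub>R (indicator K t *\<^sub>R u t))"
    using u unfolding set_integrable_def by (rule integrable_scaleR_right)
  have ui': "integrable lebesgue (\<lambda>t. indicator K t *\<^sub>R u t)"
    using u unfolding set_integrable_def .
  have "integrable lebesgue (\<lambda>t. h t *\<^sub>R (indicator K t *\<^sub>R u t))"
  proof (rule Bochner_Integration.integrable_bound[OF ui])
    show "(\<lambda>t. h t *\<^sub>R (indicator K t *\<^sub>R u t)) \<in> borel_measurable lebesgue"
      by (intro borel_measurable_scaleR hm borel_measurable_integrable[OF ui'])
    show "AE t in lebesgue. norm (h t *\<^sub>R (indicator K t *\<^sub>R u t)) \<le> norm (B *\<^sub>R (indicator K t *\<^sub>R u t))"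
    proof (rule AE_I2)
      show "norm (h t *\<^sub>R (indicator K t *\<^sub>R u t)) \<le> norm (B *\<^sub>R (indicator K t *\<^sub>R u t))" for t
        using B[of t] by (cases "t \<in> K") (auto intro!: mult_right_mono)
    qed
  qed
  moreover have "(\<lambda>t. h t *\<^sub>R (indicator K t *\<^sub>R u t)) = (\<lambda>t. indicator I t *\<^sub>R (h t *\<^sub>R u t))"
  proof
    show "h t *\<^sub>R (indicator K t *\<^sub>R u t) = indicator I t *\<^sub>R (h t *\<^sub>R u t)" for t
      using h(2)[of t] K(2) by (cases "t \<in> K") (auto simp: indicator_def)
  qed
  moreover have "I \<inter> space lebesgue \<in> sets lebesgue" using I by simp
  ultimately show ?thesis by (simp only: integrable_restrict_space)
qed

lemma test_function_integrable:
  fixes u :: "real \<Rightarrow> 'a::euclidean_space"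
  assumes \<phi>: "test_function I \<phi>" and u: "locally_integrable I u" and I: "I \<in> sets lebesgue"
  shows "integrable (lebesgue_on I) (\<lambda>t. \<phi> t *\<^sub>R u t)"
    and "integrable (lebesgue_on I) (\<lambda>t. deriv \<phi> t *\<^sub>R u t)"
proof -
  define K where "K = closure {t. \<phi> t \<noteq> 0}"
  have K: "compact K" "K \<subseteq> interior I" and sm: "smooth \<phi>"
    using \<phi> unfolding K_def test_function_def smooth_def by simp_all
  then have KI: "K \<subseteq> I" using interior_subset by blast
  have ui: "u absolutely_integrable_on K"
    using u K unfolding locally_integrable_def by blast
  have c: "continuous_on UNIV f" if "smooth f" for f
    using smooth_imp_DERIV[OF that] by (meson DERIV_isCont continuous_at_imp_continuous_on)
  have z: "\<phi> t = 0" if "t \<notin> K" for t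
    using that closure_subset[of "{t. \<phi> t \<noteq> 0}"] unfolding K_def by auto
  have z': "deriv \<phi> t = 0" if t: "t \<notin> K" for t
  proof -
    have "open (- K)" using K(1) by (simp add: compact_imp_closed open_Compl)
    then have "\<forall>\<^sub>F s in nhds t. \<phi> s = 0"
      using t z by (auto simp: eventually_nhds intro!: exI[of _ "- K"])
    then have "deriv \<phi> t = deriv (\<lambda>_. 0) t" by (intro deriv_cong_ev) auto
    then show ?thesis by simp
  qed
  show "integrable (lebesgue_on I) (\<lambda>t. \<phi> t *\<^sub>R u t)"
    by (rule integrable_supported_mult[OF c[OF sm] z K(1) KI ui I])
  show "integrable (lebesgue_on I) (\<lambda>t. deriv \<phi> t *\<^sub>R u t)"
    by (rule integrable_supported_mult[OF c[OF smooth_deriv[OF sm]] z' K(1) KI ui I])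
qed

lemma has_weak_deriv_add:
  assumes u: "has_weak_deriv I u v" and w: "has_weak_deriv I u' v'" and I: "I \<in> sets lebesgue"
  shows "has_weak_deriv I (\<lambda>t. u t + u' t) (\<lambda>t. v t + v' t)"
proof -
  have li: "locally_integrable I u" "locally_integrable I v" "locally_integrable I u'" "locally_integrable I v'"
    using u w by (auto simp: has_weak_deriv_def)
  have "locally_integrable I (\<lambda>t. u t + u' t)" "locally_integrable I (\<lambda>t. v t + v' t)"
    using li unfolding locally_integrable_def by (auto intro!: set_integral_add(1))
  moreover have "(\<integral>t. deriv \<phi> t *\<^sub>R (u t + u' t) \<partial>lebesgue_on I) = - (\<integral>t. \<phi> t *\<^sub>R (v t + v' t) \<partial>lebesgue_on I)"
    if \<phi>: "test_function I \<phi>" for \<phi>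
    using has_weak_derivD[OF u \<phi>] has_weak_derivD[OF w \<phi>]
    by (simp add: scaleR_add_right Bochner_Integration.integral_add test_function_integrable[OF \<phi> _ I] li)
  ultimately show ?thesis by (simp add: has_weak_deriv_def)
qed

lemma has_weak_deriv_scaleR:
  assumes u: "has_weak_deriv I u v"
  shows "has_weak_deriv I (\<lambda>t. r *\<^sub>R u t) (\<lambda>t. r *\<^sub>R v t)"
proof -
  have "locally_integrable I (\<lambda>t. r *\<^sub>R u t)" "locally_integrable I (\<lambda>t. r *\<^sub>R v t)"
    using u unfolding locally_integrable_def has_weak_deriv_def by (auto intro!: set_integrable_scaleR_right)
  moreover have "(\<integral>t. deriv \<phi> t *\<^sub>R (r *\<^sub>R u t) \<partial>lebesgue_on I) = - (\<integral>t. \<phi> t *\<^sub>R (r *\<^sub>R v t) \<partial>lebesgue_on I)"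
    if \<phi>: "test_function I \<phi>" for \<phi>
  proof -
    have "(\<integral>t. f t *\<^sub>R (r *\<^sub>R g t) \<partial>lebesgue_on I) = r *\<^sub>R (\<integral>t. f t *\<^sub>R g t \<partial>lebesgue_on I)"
      for f :: "real \<Rightarrow> real" and g :: "real \<Rightarrow> 'a"
      by (simp only: scaleR_left_commute integral_scaleR_right)
    then show ?thesis using has_weak_derivD[OF u \<phi>] by simp
  qed
  ultimately show ?thesis by (simp add: has_weak_deriv_def)
qed

lemma has_weak_deriv_cong_AE:
  fixes u w :: "real \<Rightarrow> 'a::euclidean_space"
  assumes u: "has_weak_deriv I u v" and ae: "AE t in lebesgue_on I. u t = w t"
    and w: "locally_integrable I w" and I: "I \<in> sets lebesgue"
  shows "has_weak_deriv I w v"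
proof -
  have "(\<integral>t. deriv \<phi> t *\<^sub>R w t \<partial>lebesgue_on I) = (\<integral>t. deriv \<phi> t *\<^sub>R u t \<partial>lebesgue_on I)"
    if \<phi>: "test_function I \<phi>" for \<phi>
  proof (rule integral_cong_AE)
    show "(\<lambda>t. deriv \<phi> t *\<^sub>R w t) \<in> borel_measurable (lebesgue_on I)"
      "(\<lambda>t. deriv \<phi> t *\<^sub>R u t) \<in> borel_measurable (lebesgue_on I)"
      using u w by (auto simp: has_weak_deriv_def intro!: borel_measurable_integrable test_function_integrable(2)[OF \<phi> _ I])
    show "AE t in lebesgue_on I. deriv \<phi> t *\<^sub>R w t = deriv \<phi> t *\<^sub>R u t"
      using ae by eventually_elim simp
  qed
  then show ?thesis using u w by (simp add: has_weak_deriv_def)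
qed

lemma has_weak_deriv_weak_deriv: "has_weak_deriv I u v \<Longrightarrow> has_weak_deriv I u (weak_deriv I u)"
  unfolding weak_deriv_def by (rule someI[of "has_weak_deriv I u"])

lemma weak_deriv_AE_eq:
  fixes v :: "real \<Rightarrow> 'a::euclidean_space"
  assumes I: "is_interval I" "bounded I" and u: "has_weak_deriv I u v"
  shows "AE t in lebesgue_on I. weak_deriv I u t = v t"
proof -
  obtain \<alpha> \<beta> where ab: "interior I = {\<alpha><..<\<beta>}"
    using bounded_interval_interior[OF I] .
  have m: "I \<in> sets lebesgue" using bounded_interval_lmeasurable[OF I] by auto
  show ?thesis
    by (rule AE_lebesgue_on_interiorI[OF I has_weak_deriv_AE_unique[OF has_weak_deriv_weak_deriv[OF u] u ab m]])
qed

text \<open>The constant depends on the interval only. If the interior of \<open>I\<close> is empty, then \<open>I\<close> is a null set and the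
  bound is void.\<close>
lemma weak_deriv_sup_bound:
  assumes I: "is_interval I" "bounded I"
  shows "\<exists>C\<ge>0. \<forall>u v :: real \<Rightarrow> 'a::euclidean_space. has_weak_deriv I u v \<longrightarrow> integrable (lebesgue_on I) u \<longrightarrow>
     integrable (lebesgue_on I) v \<longrightarrow> (AE t in lebesgue_on I. norm (u t) \<le>
       C * ((\<integral>t. norm (u t) \<partial>lebesgue_on I) + (\<integral>t. norm (v t) \<partial>lebesgue_on I)))"
proof -
  obtain \<alpha> \<beta> where ab: "interior I = {\<alpha><..<\<beta>}" "I \<subseteq> {\<alpha>..\<beta>}"
    using bounded_interval_interior[OF I] .
  have m: "I \<in> sets lebesgue" using bounded_interval_lmeasurable[OF I] by auto
  define C where "C = DIM('a) * max 1 (2 / (\<beta> - \<alpha>))"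
  have "AE t in lebesgue_on I. norm (u t) \<le>
       C * ((\<integral>t. norm (u t) \<partial>lebesgue_on I) + (\<integral>t. norm (v t) \<partial>lebesgue_on I))"
    if uv: "has_weak_deriv I u v" "integrable (lebesgue_on I) u" "integrable (lebesgue_on I) v"
    for u v :: "real \<Rightarrow> 'a"
  proof (rule AE_lebesgue_on_interiorI[OF I])
    show "AE t in lebesgue. t \<in> interior I \<longrightarrow> norm (u t) \<le>
       C * ((\<integral>t. norm (u t) \<partial>lebesgue_on I) + (\<integral>t. norm (v t) \<partial>lebesgue_on I))"
    proof (cases "\<alpha> < \<beta>")
      case True
      let ?p = "\<integral>t. norm (u t) \<partial>lebesgue_on I" and ?q = "\<integral>t. norm (v t) \<partial>lebesgue_on I"
      have "2 / (\<beta> - \<alpha>) * ?p + 1 * ?q \<le> max 1 (2 / (\<beta> - \<alpha>)) * ?p + max 1 (2 / (\<beta> - \<alpha>)) * ?q"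
        by (intro add_mono mult_right_mono) auto
      then have "DIM('a) * (2 / (\<beta> - \<alpha>) * ?p + ?q) \<le> DIM('a) * (max 1 (2 / (\<beta> - \<alpha>)) * (?p + ?q))"
        by (intro mult_left_mono) (simp_all add: distrib_left)
      then have le: "DIM('a) * (2 / (\<beta> - \<alpha>) * ?p + ?q) \<le> C * (?p + ?q)"
        by (simp only: C_def mult.assoc)
      from AE_norm_le_of_weak_deriv[OF uv m ab(1) True] show ?thesis
        by eventually_elim (use le in auto)
    qed (simp add: ab(1))
  qed
  moreover have "0 \<le> C" by (simp add: C_def)
  ultimately show ?thesis by blast
qed

section \<open>The convex function and its conjugate\<close>

text \<open>The standing assumptions on \<open>G\<close>.\<close>
locale orlicz_function =
  fixes G :: "'a::euclidean_space \<Rightarrow> real"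
  assumes nonneg: "\<And>x. 0 \<le> G x"
    and zero: "G 0 = 0"
    and convex: "convex_on UNIV G"
    and even: "\<And>x. G (- x) = G x"
    and superlinear: "filterlim (\<lambda>x. G x / norm x) at_top at_infinity"
    and Delta2: "\<exists>K\<ge>2. \<exists>M>0. \<forall>x. norm x \<ge> M \<longrightarrow> G (2 *\<^sub>R x) \<le> K * G x"
    and Nabla2: "\<exists>K\<ge>1. \<exists>M>0. \<forall>x. norm x \<ge> M \<longrightarrow> G x \<le> 1 / (2 * K) * G (K *\<^sub>R x)"
    and C1: "C1_on UNIV G"
begin

lemma G_continuous: "continuous_on UNIV G"
  by (rule convex_on_continuous[OF open_UNIV convex])

lemma G_measurable[measurable]: "G \<in> borel_measurable borel"
  by (rule borel_measurable_continuous_onI[OF G_continuous])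

lemma G_scaleR_le: "0 \<le> s \<Longrightarrow> s \<le> 1 \<Longrightarrow> G (s *\<^sub>R x) \<le> s * G x"
  using convex_onD[OF convex, of s 0 x] by (simp add: zero)

lemma G_scaleR_abs: "G (\<bar>s\<bar> *\<^sub>R x) = G (s *\<^sub>R x)"
  using even[of "s *\<^sub>R x"] by (cases "0 \<le> s") auto

lemma G_scaleR_mono:
  assumes "\<bar>s\<bar> \<le> \<bar>r\<bar>" shows "G (s *\<^sub>R x) \<le> G (r *\<^sub>R x)"
proof (cases "r = 0")
  case False
  have "G ((\<bar>s\<bar> / \<bar>r\<bar>) *\<^sub>R (\<bar>r\<bar> *\<^sub>R x)) \<le> (\<bar>s\<bar> / \<bar>r\<bar>) * G (\<bar>r\<bar> *\<^sub>R x)"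
    using assms False by (intro G_scaleR_le) auto
  also have "\<dots> \<le> 1 * G (\<bar>r\<bar> *\<^sub>R x)"
    using assms False by (intro mult_right_mono nonneg) auto
  finally show ?thesis using False G_scaleR_abs[of s x] G_scaleR_abs[of r x] by simp
qed (use assms in simp)

lemma G_add_le: "G (x + y) \<le> G (2 *\<^sub>R x) + G (2 *\<^sub>R y)"
proof -
  have "G ((1 - 1 / 2) *\<^sub>R (2 *\<^sub>R x) + (1 / 2) *\<^sub>R (2 *\<^sub>R y)) \<le> (1 - 1 / 2) * G (2 *\<^sub>R x) + (1 / 2) * G (2 *\<^sub>R y)"
    by (rule convex_onD[OF convex]) auto
  then show ?thesis using nonneg[of "2 *\<^sub>R x"] nonneg[of "2 *\<^sub>R y"] by simp
qed

lemma G_bounded_on_ball: "\<exists>C\<ge>0. \<forall>x. norm x \<le> R \<longrightarrow> G x \<le> C"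
proof -
  have "bounded (G ` cball 0 R)"
    by (intro compact_imp_bounded compact_continuous_image continuous_on_subset[OF G_continuous]) auto
  then obtain C where C: "\<forall>y\<in>G ` cball 0 R. norm y \<le> C" unfolding bounded_iff by blast
  have "G x \<le> max C 0" if "norm x \<le> R" for x
    using bspec[OF C, of "G x"] that nonneg[of x] by simp
  then show ?thesis by (intro exI[of _ "max C 0"]) simp
qed

lemma G_superlinear_bound: "\<exists>C\<ge>0. \<forall>x. K * norm x \<le> G x + C"
proof -
  have "\<forall>\<^sub>F x in at_infinity. \<bar>K\<bar> \<le> G x / norm x"
    using superlinear by (simp add: filterlim_at_top)
  then obtain R where R: "\<And>x. R \<le> norm x \<Longrightarrow> \<bar>K\<bar> \<le> G x / norm x"
    by (auto simp: eventually_at_infinity)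
  have "K * norm x \<le> G x + \<bar>K\<bar> * \<bar>R\<bar>" for x
  proof (cases "R \<le> norm x \<and> x \<noteq> 0")
    case True
    then have "\<bar>K\<bar> * norm x \<le> G x" using R[of x] by (simp add: pos_le_divide_eq)
    moreover have "K * norm x \<le> \<bar>K\<bar> * norm x" by (rule mult_right_mono) auto
    moreover have "0 \<le> \<bar>K\<bar> * \<bar>R\<bar>" by simp
    ultimately show ?thesis by linarith
  next
    case False
    have "K * norm x \<le> \<bar>K\<bar> * \<bar>R\<bar>" using False by (intro mult_mono) auto
    then show ?thesis using nonneg[of x] by linarith
  qed
  then show ?thesis by (intro exI[of _ "\<bar>K\<bar> * \<bar>R\<bar>"]) auto
qed

text \<open>\<open>\<Delta>\<^sub>2\<close> at all points, at the price of an additive constant.\<close>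
lemma G_double_le: "\<exists>K\<ge>0. \<exists>C\<ge>0. \<forall>x. G (2 *\<^sub>R x) \<le> K * G x + C"
proof -
  obtain K M where K: "K \<ge> 2" "\<And>x. M \<le> norm x \<Longrightarrow> G (2 *\<^sub>R x) \<le> K * G x" using Delta2 by blast
  obtain C where C: "C \<ge> 0" "\<And>x. norm x \<le> 2 * M \<Longrightarrow> G x \<le> C" using G_bounded_on_ball by blast
  have "G (2 *\<^sub>R x) \<le> K * G x + C" for x
  proof (cases "M \<le> norm x")
    case True then show ?thesis using K(2)[of x] C(1) by linarith
  next
    case False
    then have "G (2 *\<^sub>R x) \<le> C" by (intro C(2)) simp
    moreover have "0 \<le> K * G x" using K(1) nonneg[of x] by simp
    ultimately show ?thesis by linarith
  qed
  then show ?thesis using K(1) C(1) by (intro exI[of _ K] conjI exI[of _ C] allI) auto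
qed

text \<open>Superlinear growth makes the supremum in the conjugate finite everywhere.\<close>

lemma conj_bdd_above: "bdd_above (range (\<lambda>x. x \<bullet> y - G x))"
proof -
  obtain C where C: "\<And>x. norm y * norm x \<le> G x + C" using G_superlinear_bound by blast
  have "x \<bullet> y - G x \<le> C" for x
    using C[of x] norm_cauchy_schwarz[of x y] by (simp add: mult.commute)
  then show ?thesis by (intro bdd_aboveI[of _ C]) auto
qed

lemma Young_ineq: "x \<bullet> y \<le> G x + fenchel_conj G y"
  using cSUP_upper[OF UNIV_I conj_bdd_above, of x y] by (simp add: fenchel_conj_def)

lemma conj_le_iff: "fenchel_conj G y \<le> r \<longleftrightarrow> (\<forall>x. x \<bullet> y - G x \<le> r)"
  unfolding fenchel_conj_def by (subst cSUP_le_iff[OF _ conj_bdd_above]) auto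

lemma conj_nonneg: "0 \<le> fenchel_conj G y"
  using Young_ineq[of 0 y] by (simp add: zero)

lemma conj_0: "fenchel_conj G 0 = 0"
  by (rule antisym) (simp_all add: conj_le_iff nonneg conj_nonneg)

lemma conj_even: "fenchel_conj G (- y) = fenchel_conj G y"
proof -
  have *: "fenchel_conj G (- y) \<le> fenchel_conj G y" for y
    unfolding conj_le_iff
  proof
    show "x \<bullet> - y - G x \<le> fenchel_conj G y" for x
      using Young_ineq[of "- x" y] by (simp add: even)
  qed
  show ?thesis using *[of y] *[of "- y"] by simp
qed

lemma Young_ineq_abs: "\<bar>x \<bullet> y\<bar> \<le> G x + fenchel_conj G y"
  using Young_ineq[of x y] Young_ineq[of "- x" y] by (simp add: even abs_le_iff)

lemma conj_convex: "convex_on UNIV (fenchel_conj G)"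
proof (rule convex_onI)
  fix s :: real and y z :: 'a assume s: "0 < s" "s < 1"
  show "fenchel_conj G ((1 - s) *\<^sub>R y + s *\<^sub>R z) \<le> (1 - s) * fenchel_conj G y + s * fenchel_conj G z"
    unfolding conj_le_iff
  proof
    fix x
    have "(1 - s) * (x \<bullet> y - G x) + s * (x \<bullet> z - G x) \<le> (1 - s) * fenchel_conj G y + s * fenchel_conj G z"
      using Young_ineq[of x y] Young_ineq[of x z] s by (intro add_mono mult_left_mono) auto
    then show "x \<bullet> ((1 - s) *\<^sub>R y + s *\<^sub>R z) - G x \<le> (1 - s) * fenchel_conj G y + s * fenchel_conj G z"
      by (simp add: inner_add_right algebra_simps)
  qed
qed auto

lemma conj_continuous: "continuous_on UNIV (fenchel_conj G)"
  by (rule convex_on_continuous[OF open_UNIV conj_convex])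

lemma conj_measurable[measurable]: "fenchel_conj G \<in> borel_measurable borel"
  by (rule borel_measurable_continuous_onI[OF conj_continuous])

lemma conj_add_le: "fenchel_conj G (x + y) \<le> fenchel_conj G (2 *\<^sub>R x) + fenchel_conj G (2 *\<^sub>R y)"
proof -
  have "fenchel_conj G ((1 - 1 / 2) *\<^sub>R (2 *\<^sub>R x) + (1 / 2) *\<^sub>R (2 *\<^sub>R y))
      \<le> (1 - 1 / 2) * fenchel_conj G (2 *\<^sub>R x) + (1 / 2) * fenchel_conj G (2 *\<^sub>R y)"
    by (rule convex_onD[OF conj_convex]) auto
  then show ?thesis using conj_nonneg[of "2 *\<^sub>R x"] conj_nonneg[of "2 *\<^sub>R y"] by simp
qed

text \<open>\<open>\<nabla>\<^sub>2\<close> for \<open>G\<close> gives \<open>\<Delta>\<^sub>2\<close> for the conjugate: from \<open>G(x) \<le> G(Kx)/(2K) + C\<close>, Young's inequality at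
  \<open>x = z/K\<close> and multiplication by \<open>2K\<close>, one gets \<open>\<langle>z,2y\<rangle> - G(z) \<le> 2K (G\<^sup>*(y) + C)\<close>.\<close>
lemma conj_double_le: "\<exists>K\<ge>0. \<exists>C\<ge>0. \<forall>y. fenchel_conj G (2 *\<^sub>R y) \<le> K * fenchel_conj G y + C"
proof -
  obtain K M where K: "K \<ge> 1" "\<And>x. M \<le> norm x \<Longrightarrow> G x \<le> 1 / (2 * K) * G (K *\<^sub>R x)" using Nabla2 by blast
  obtain C where C: "C \<ge> 0" "\<And>x. norm x \<le> M \<Longrightarrow> G x \<le> C" using G_bounded_on_ball by blast
  have G: "G x \<le> 1 / (2 * K) * G (K *\<^sub>R x) + C" for x
  proof (cases "M \<le> norm x")
    case True then show ?thesis using K(2)[of x] C(1) by linarith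
  next
    case False
    moreover have "0 \<le> 1 / (2 * K) * G (K *\<^sub>R x)" using K(1) nonneg[of "K *\<^sub>R x"] by simp
    ultimately show ?thesis using C(2)[of x] by linarith
  qed
  have "fenchel_conj G (2 *\<^sub>R y) \<le> (2 * K) * fenchel_conj G y + (2 * K) * C" for y
    unfolding conj_le_iff
  proof
    fix z :: 'a
    define x where "x = (1 / K) *\<^sub>R z"
    have "K \<noteq> 0" using K(1) by simp
    then have z: "z = K *\<^sub>R x" unfolding x_def scaleR_scaleR by simp
    have "x \<bullet> y \<le> 1 / (2 * K) * G z + C + fenchel_conj G y"
      using Young_ineq[of x y] G[of x] by (simp add: z)
    then have "(2 * K) * (x \<bullet> y) \<le> (2 * K) * (1 / (2 * K) * G z + C + fenchel_conj G y)"
      using K(1) by (intro mult_left_mono) auto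
    also have "\<dots> = G z + (2 * K) * C + (2 * K) * fenchel_conj G y"
      using K(1) by (simp add: distrib_left)
    finally show "z \<bullet> 2 *\<^sub>R y - G z \<le> (2 * K) * fenchel_conj G y + (2 * K) * C"
      by (simp add: z)
  qed
  moreover have "0 \<le> 2 * K" "0 \<le> 2 * K * C" using K(1) C(1) by simp_all
  ultimately show ?thesis by blast
qed

lemma conj_scaleR_le: "\<exists>K\<ge>0. \<exists>C\<ge>0. \<forall>y. fenchel_conj G (r *\<^sub>R y) \<le> K * fenchel_conj G y + C"
proof -
  have *: "\<exists>K\<ge>0. \<exists>C\<ge>0. \<forall>y. fenchel_conj G ((2 ^ n) *\<^sub>R y) \<le> K * fenchel_conj G y + C" for n
  proof (induction n)
    case 0
    show ?case by (intro exI[of _ 1] conjI exI[of _ 0]) auto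
  next
    case (Suc n)
    then obtain K C where KC: "K \<ge> 0" "C \<ge> 0" "\<And>y. fenchel_conj G ((2 ^ n) *\<^sub>R y) \<le> K * fenchel_conj G y + C" by blast
    obtain K' C' where KC': "K' \<ge> 0" "C' \<ge> 0" "\<And>y. fenchel_conj G (2 *\<^sub>R y) \<le> K' * fenchel_conj G y + C'"
      using conj_double_le by blast
    have "fenchel_conj G ((2 ^ Suc n) *\<^sub>R y) \<le> (K * K') * fenchel_conj G y + (K * C' + C)" for y
    proof -
      have "fenchel_conj G ((2 ^ n) *\<^sub>R (2 *\<^sub>R y)) \<le> K * fenchel_conj G (2 *\<^sub>R y) + C" by (rule KC)
      also have "\<dots> \<le> K * (K' * fenchel_conj G y + C') + C"
        using KC by (intro add_mono mult_left_mono KC') auto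
      finally show ?thesis by (simp add: algebra_simps)
    qed
    then show ?case using KC KC'
      by (intro exI[of _ "K * K'"] conjI exI[of _ "K * C' + C"] allI) auto
  qed
  obtain n where n: "\<bar>r\<bar> < 2 ^ n" using real_arch_pow[of 2 "\<bar>r\<bar>"] by auto
  obtain K C where KC: "K \<ge> 0" "C \<ge> 0" "\<And>y. fenchel_conj G ((2 ^ n) *\<^sub>R y) \<le> K * fenchel_conj G y + C"
    using * by blast
  have "fenchel_conj G (r *\<^sub>R y) \<le> fenchel_conj G ((2 ^ n) *\<^sub>R y)" for y
  proof -
    have "fenchel_conj G (\<bar>r\<bar> *\<^sub>R y) \<le> fenchel_conj G ((2 ^ n) *\<^sub>R y)"
    proof -
      have "fenchel_conj G ((1 - \<bar>r\<bar> / 2 ^ n) *\<^sub>R 0 + (\<bar>r\<bar> / 2 ^ n) *\<^sub>R ((2 ^ n) *\<^sub>R y))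
          \<le> (1 - \<bar>r\<bar> / 2 ^ n) * fenchel_conj G 0 + (\<bar>r\<bar> / 2 ^ n) * fenchel_conj G ((2 ^ n) *\<^sub>R y)"
        using n by (intro convex_onD[OF conj_convex]) auto
      also have "\<dots> \<le> 1 * fenchel_conj G ((2 ^ n) *\<^sub>R y)"
        using mult_right_mono[of "\<bar>r\<bar> / 2 ^ n" 1, OF _ conj_nonneg[of "(2 ^ n) *\<^sub>R y"]] n
        unfolding conj_0 by simp
      finally show ?thesis by simp
    qed
    then show ?thesis using conj_even[of "r *\<^sub>R y"] by (cases "0 \<le> r") auto
  qed
  then show ?thesis using KC order_trans by blast
qed

end

lemma grad_eqI:
  assumes "(f has_derivative f') (at x)"
  shows "grad f x = (\<Sum>b\<in>Basis. f' b *\<^sub>R b)" and "\<And>h. f' h = grad f x \<bullet> h"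
proof -
  let ?D = "\<Sum>b\<in>Basis. f' b *\<^sub>R b"
  have lin: "linear f'" using assms has_derivative_linear by blast
  have D: "f' h = h \<bullet> ?D" for h
  proof -
    have "f' h = f' (\<Sum>b\<in>Basis. (h \<bullet> b) *\<^sub>R b)" by (simp add: euclidean_representation)
    also have "\<dots> = (\<Sum>b\<in>Basis. (h \<bullet> b) * f' b)"
      by (simp add: linear_sum[OF lin] linear_scale[OF lin])
    also have "\<dots> = h \<bullet> ?D" by (simp add: inner_sum_right mult.commute)
    finally show ?thesis .
  qed
  have "GDERIV f x :> ?D"
    unfolding gderiv_def using assms by (simp flip: D)
  moreover have "D = ?D" if "GDERIV f x :> D" for D
  proof -
    have "(\<lambda>h. h \<bullet> D) = f'"
      using that assms unfolding gderiv_def by (rule has_derivative_unique)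
    then have "h \<bullet> D = h \<bullet> ?D" for h using D by metis
    then show ?thesis by (intro vector_eq_ldot[THEN iffD1]) blast
  qed
  ultimately show g: "grad f x = ?D" unfolding grad_def by (rule the_equality)
  show "f' h = grad f x \<bullet> h" for h using D[of h] by (simp add: g inner_commute)
qed

context orlicz_function
begin

lemma G_above_tangent: "G v + grad G v \<bullet> (x - v) \<le> G x"
proof -
  obtain f' where f': "(G has_derivative f') (at v)"
    using C1 unfolding C1_on_def by auto
  define g where "g = (\<lambda>s. G (v + s *\<^sub>R (x - v)))"
  have "(g has_derivative (\<lambda>s. f' (s *\<^sub>R (x - v)))) (at 0)"
    unfolding g_def
    by (rule has_derivative_compose[where f = "\<lambda>s. v + s *\<^sub>R (x - v)" and g = G])
       (auto intro!: derivative_eq_intros f'[THEN has_derivative_eq_rhs])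
  then have "(g has_real_derivative (grad G v \<bullet> (x - v))) (at 0)"
    unfolding has_field_derivative_def
    by (rule has_derivative_eq_rhs) (simp add: fun_eq_iff grad_eqI(2)[OF f'] mult.commute)
  moreover have "convex_on UNIV g"
  proof (rule convex_onI)
    fix t a b :: real assume "0 < t" "t < 1"
    then have "G ((1 - t) *\<^sub>R (v + a *\<^sub>R (x - v)) + t *\<^sub>R (v + b *\<^sub>R (x - v))) \<le> (1 - t) * g a + t * g b"
      unfolding g_def by (intro convex_onD[OF convex]) auto
    then show "g ((1 - t) *\<^sub>R a + t *\<^sub>R b) \<le> (1 - t) * g a + t * g b"
      by (simp add: g_def algebra_simps)
  qed auto
  ultimately have "grad G v \<bullet> (x - v) * (1 - 0) \<le> g 1 - g 0"
    by (intro convex_on_imp_above_tangent[where A = UNIV]) (auto intro: has_field_derivative_at_within)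
  then show ?thesis by (simp add: g_def)
qed

text \<open>The tangent at \<open>v\<close> lies below \<open>G\<close> at \<open>x\<close> and at \<open>2v\<close>; the two inequalities add up to the claim.\<close>
lemma conj_grad_le: "fenchel_conj G (grad G v) \<le> G (2 *\<^sub>R v)"
  unfolding conj_le_iff
proof
  fix x
  have "G v + grad G v \<bullet> (2 *\<^sub>R v - v) \<le> G (2 *\<^sub>R v)" by (rule G_above_tangent)
  moreover have "G v + grad G v \<bullet> (x - v) \<le> G x" by (rule G_above_tangent)
  ultimately show "x \<bullet> grad G v - G x \<le> G (2 *\<^sub>R v)"
    using nonneg[of v] by (simp add: inner_diff_right inner_commute algebra_simps)
qed

end

section \<open>Orlicz spaces and the Luxemburg norm\<close>

lemma borel_measurable_lebesgue_on_AE: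
  fixes f g :: "real \<Rightarrow> 'a::euclidean_space"
  assumes f: "f \<in> borel_measurable (lebesgue_on I)" and ae: "AE t in lebesgue_on I. f t = g t"
    and I: "I \<in> sets lebesgue"
  shows "g \<in> borel_measurable (lebesgue_on I)"
proof -
  have "(\<lambda>t. if t \<in> I then f t else 0) \<in> borel_measurable lebesgue"
    using f I by (simp add: borel_measurable_if)
  moreover have "AE t in lebesgue. t \<in> I \<longrightarrow> f t = g t"
    using ae I by (simp add: AE_restrict_space_iff)
  then have "AE t in lebesgue. (if t \<in> I then f t else 0) = (if t \<in> I then g t else 0)"
    by eventually_elim simp
  ultimately have "(\<lambda>t. if t \<in> I then g t else 0) \<in> borel_measurable lebesgue"
    by (rule borel_measurable_AE)
  then show ?thesis using I by (simp add: borel_measurable_if)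
qed

text \<open>The interval \<open>I\<close> may be open, closed or half-open, and it may be degenerate.\<close>
locale orlicz_interval = orlicz_function G for G :: "'a::euclidean_space \<Rightarrow> real" +
  fixes I :: "real set"
  assumes interval: "is_interval I" and bounded: "bounded I"
begin

lemma I_sets: "I \<in> sets lebesgue"
  using bounded_interval_lmeasurable[OF interval bounded] by auto

lemma finite_measure_I: "finite_measure (lebesgue_on I)"
  by (rule finite_measure_lebesgue_on[OF bounded_interval_lmeasurable[OF interval bounded]])

lemma integrable_const_I: "integrable (lebesgue_on I) (\<lambda>t. r :: real)"
  by (rule finite_measure.integrable_const[OF finite_measure_I])

lemma orlicz_iff:
  "u \<in> orlicz_space I G \<longleftrightarrow>
     u \<in> borel_measurable (lebesgue_on I) \<and> integrable (lebesgue_on I) (\<lambda>t. G (u t))"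
  by (auto simp: orlicz_space_def integrable_iff_bounded nonneg intro: measurable_compose[OF _ G_measurable])

lemma orlicz_bound:
  assumes u: "u \<in> orlicz_space I G" and w: "w \<in> borel_measurable (lebesgue_on I)"
    and le: "\<And>t. G (w t) \<le> K * G (u t) + C" and K: "0 \<le> K"
  shows "w \<in> orlicz_space I G"
  unfolding orlicz_iff
proof
  have i: "integrable (lebesgue_on I) (\<lambda>t. K * G (u t) + C)"
    using u by (intro Bochner_Integration.integrable_add integrable_mult_right integrable_const_I) (simp add: orlicz_iff)
  show "integrable (lebesgue_on I) (\<lambda>t. G (w t))"
  proof (rule Bochner_Integration.integrable_bound[OF i])
    show "(\<lambda>t. G (w t)) \<in> borel_measurable (lebesgue_on I)" by (rule measurable_compose[OF w G_measurable])
    show "AE t in lebesgue_on I. norm (G (w t)) \<le> norm (K * G (u t) + C)"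
    proof (rule AE_I2)
      show "norm (G (w t)) \<le> norm (K * G (u t) + C)" for t
        using le[of t] nonneg[of "w t"] by simp
    qed
  qed
qed (rule w)

lemma orlicz_pow2:
  assumes u: "u \<in> orlicz_space I G" shows "(\<lambda>t. (2 ^ n) *\<^sub>R u t) \<in> orlicz_space I G"
proof (induction n)
  case (Suc n)
  obtain K C where K: "0 \<le> K" "\<And>x. G (2 *\<^sub>R x) \<le> K * G x + C" using G_double_le by blast
  have m: "(\<lambda>t. (2 ^ Suc n) *\<^sub>R u t) \<in> borel_measurable (lebesgue_on I)"
    using u by (intro borel_measurable_scaleR borel_measurable_const) (simp add: orlicz_iff)
  show ?case
    by (rule orlicz_bound[OF Suc m _ K(1)]) (use K(2)[of "(2 ^ n) *\<^sub>R u t" for t] in simp)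
qed (use u in simp)

lemma orlicz_scaleR:
  assumes u: "u \<in> orlicz_space I G" shows "(\<lambda>t. r *\<^sub>R u t) \<in> orlicz_space I G"
proof -
  obtain n where n: "\<bar>r\<bar> < 2 ^ n" using real_arch_pow[of 2 "\<bar>r\<bar>"] by auto
  have m: "(\<lambda>t. r *\<^sub>R u t) \<in> borel_measurable (lebesgue_on I)"
    using u by (intro borel_measurable_scaleR borel_measurable_const) (simp add: orlicz_iff)
  have "G (r *\<^sub>R u t) \<le> 1 * G ((2 ^ n) *\<^sub>R u t) + 0" for t
    using G_scaleR_mono[of r "2 ^ n"] n by simp
  then show ?thesis by (rule orlicz_bound[OF orlicz_pow2[OF u, of n] m]) simp
qed

lemma orlicz_integrable_scaleR:
  "u \<in> orlicz_space I G \<Longrightarrow> integrable (lebesgue_on I) (\<lambda>t. G (r *\<^sub>R u t))"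
  using orlicz_scaleR[of u r] by (simp add: orlicz_iff)

lemma orlicz_add:
  assumes u: "u \<in> orlicz_space I G" and w: "w \<in> orlicz_space I G"
  shows "(\<lambda>t. u t + w t) \<in> orlicz_space I G"
  unfolding orlicz_iff
proof
  show m: "(\<lambda>t. u t + w t) \<in> borel_measurable (lebesgue_on I)"
    using u w by (intro borel_measurable_add) (simp_all add: orlicz_iff)
  show "integrable (lebesgue_on I) (\<lambda>t. G (u t + w t))"
  proof (rule Bochner_Integration.integrable_bound)
    show "integrable (lebesgue_on I) (\<lambda>t. G (2 *\<^sub>R u t) + G (2 *\<^sub>R w t))"
      by (intro Bochner_Integration.integrable_add orlicz_integrable_scaleR u w)
    show "(\<lambda>t. G (u t + w t)) \<in> borel_measurable (lebesgue_on I)" by (rule measurable_compose[OF m G_measurable])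
    show "AE t in lebesgue_on I. norm (G (u t + w t)) \<le> norm (G (2 *\<^sub>R u t) + G (2 *\<^sub>R w t))"
      using G_add_le nonneg by (intro AE_I2) (simp add: abs_of_nonneg)
  qed
qed

lemma orlicz_cong_AE:
  assumes u: "u \<in> orlicz_space I G" and ae: "AE t in lebesgue_on I. u t = w t"
  shows "w \<in> orlicz_space I G"
  unfolding orlicz_iff
proof
  have mu: "u \<in> borel_measurable (lebesgue_on I)" using u by (simp add: orlicz_iff)
  show m: "w \<in> borel_measurable (lebesgue_on I)"
    by (rule borel_measurable_lebesgue_on_AE[OF mu ae I_sets])
  have "AE t in lebesgue_on I. G (w t) = G (u t)" using ae by eventually_elim simp
  then show "integrable (lebesgue_on I) (\<lambda>t. G (w t))"
    using u integrable_cong_AE[OF measurable_compose[OF m G_measurable] measurable_compose[OF mu G_measurable]]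
    by (simp add: orlicz_iff)
qed

lemma luxemburg_cong_AE:
  assumes ae: "AE t in lebesgue_on I. u t = w t"
  shows "luxemburg_norm I G u = luxemburg_norm I G w"
proof -
  have "(\<integral>\<^sup>+t. ennreal (G (u t /\<^sub>R \<alpha>)) \<partial>lebesgue_on I) = (\<integral>\<^sup>+t. ennreal (G (w t /\<^sub>R \<alpha>)) \<partial>lebesgue_on I)" for \<alpha>
    by (rule nn_integral_cong_AE) (use ae in eventually_elim, simp)
  then show ?thesis by (simp add: luxemburg_norm_def)
qed

text \<open>The set whose infimum is the Luxemburg norm, with a Bochner integral in place of the extended one;
  on the Orlicz space the two agree.\<close>
definition luxemburg_set :: "(real \<Rightarrow> 'a) \<Rightarrow> real set" where
  "luxemburg_set u = {\<alpha>. 0 < \<alpha> \<and> (\<integral>t. G (u t /\<^sub>R \<alpha>) \<partial>lebesgue_on I) \<le> 1}"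

lemma luxemburg_norm_eq:
  assumes u: "u \<in> orlicz_space I G"
  shows "luxemburg_norm I G u = Inf (luxemburg_set u)"
proof -
  have "(\<integral>\<^sup>+t. ennreal (G (u t /\<^sub>R \<alpha>)) \<partial>lebesgue_on I) = ennreal (\<integral>t. G (u t /\<^sub>R \<alpha>) \<partial>lebesgue_on I)" for \<alpha>
    by (rule nn_integral_eq_integral[OF orlicz_integrable_scaleR[OF u]]) (simp add: nonneg)
  then show ?thesis by (simp add: luxemburg_norm_def luxemburg_set_def)
qed

lemma luxemburg_set_bdd: "bdd_below (luxemburg_set u)"
  by (rule bdd_belowI[of _ 0]) (simp add: luxemburg_set_def)

lemma luxemburg_set_nonempty:
  assumes u: "u \<in> orlicz_space I G" shows "luxemburg_set u \<noteq> {}"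
proof -
  define \<alpha> where "\<alpha> = max 1 (\<integral>t. G (u t) \<partial>lebesgue_on I)"
  have a: "1 \<le> \<alpha>" "(\<integral>t. G (u t) \<partial>lebesgue_on I) \<le> \<alpha>" by (simp_all add: \<alpha>_def)
  have "(\<integral>t. G (u t /\<^sub>R \<alpha>) \<partial>lebesgue_on I) \<le> (\<integral>t. inverse \<alpha> * G (u t) \<partial>lebesgue_on I)"
  proof (rule integral_mono)
    show "G (u t /\<^sub>R \<alpha>) \<le> inverse \<alpha> * G (u t)" for t
      using a by (intro G_scaleR_le) (auto simp: inverse_le_1_iff)
  qed (use u in \<open>auto simp: orlicz_iff intro: orlicz_integrable_scaleR[OF u]\<close>)
  also have "\<dots> = inverse \<alpha> * (\<integral>t. G (u t) \<partial>lebesgue_on I)" by simp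
  also have "\<dots> \<le> inverse \<alpha> * \<alpha>" using a by (intro mult_left_mono) auto
  also have "\<dots> = 1" using a by simp
  finally have "\<alpha> \<in> luxemburg_set u" using a by (simp add: luxemburg_set_def)
  then show ?thesis by blast
qed

lemma luxemburg_nonneg:
  assumes u: "u \<in> orlicz_space I G" shows "0 \<le> luxemburg_norm I G u"
  unfolding luxemburg_norm_eq[OF u]
  by (rule cInf_greatest[OF luxemburg_set_nonempty[OF u]]) (simp add: luxemburg_set_def)

lemma le_mult_luxemburg:
  assumes u: "u \<in> orlicz_space I G" and T: "0 \<le> T"
    and le: "\<And>\<alpha>. \<alpha> \<in> luxemburg_set u \<Longrightarrow> X \<le> T * \<alpha>"
  shows "X \<le> T * luxemburg_norm I G u"
proof (cases "T = 0")
  case True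
  then show ?thesis using le luxemburg_set_nonempty[OF u] by fastforce
next
  case False
  then have T: "0 < T" using T by simp
  have "X / T \<le> luxemburg_norm I G u"
    unfolding luxemburg_norm_eq[OF u]
    by (rule cInf_greatest[OF luxemburg_set_nonempty[OF u]])
       (use le T in \<open>simp add: pos_divide_le_eq mult.commute\<close>)
  then show ?thesis using T by (simp add: pos_divide_le_eq mult.commute)
qed

text \<open>Norm smallness implies smallness of the modular of every multiple, because \<open>G(r u) \<le> r \<alpha> G(u/\<alpha>)\<close> when
  \<open>r \<alpha> \<le> 1\<close>.\<close>
lemma luxemburg_less_imp_modular_le:
  assumes u: "u \<in> orlicz_space I G" and less: "luxemburg_norm I G u < \<delta>"
    and r: "0 \<le> r" "r * \<delta> \<le> 1"
  shows "(\<integral>t. G (r *\<^sub>R u t) \<partial>lebesgue_on I) \<le> r * \<delta>"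
proof -
  obtain \<alpha> where \<alpha>: "\<alpha> \<in> luxemburg_set u" "\<alpha> < \<delta>"
    using less cInf_less_iff[OF luxemburg_set_nonempty[OF u] luxemburg_set_bdd]
    by (auto simp: luxemburg_norm_eq[OF u])
  then have a: "0 < \<alpha>" "(\<integral>t. G (u t /\<^sub>R \<alpha>) \<partial>lebesgue_on I) \<le> 1" by (simp_all add: luxemburg_set_def)
  have ra: "r * \<alpha> \<le> r * \<delta>" using r \<alpha> by (intro mult_left_mono) auto
  have "(\<integral>t. G (r *\<^sub>R u t) \<partial>lebesgue_on I) \<le> (\<integral>t. (r * \<alpha>) * G (u t /\<^sub>R \<alpha>) \<partial>lebesgue_on I)"
  proof (rule integral_mono)
    have e: "(r * \<alpha>) *\<^sub>R (x /\<^sub>R \<alpha>) = r *\<^sub>R x" for x :: 'a using a(1) by simp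
    show "G (r *\<^sub>R u t) \<le> (r * \<alpha>) * G (u t /\<^sub>R \<alpha>)" for t
      using G_scaleR_le[of "r * \<alpha>" "u t /\<^sub>R \<alpha>"] a r ra unfolding e by simp
  qed (auto intro!: orlicz_integrable_scaleR u)
  also have "\<dots> = (r * \<alpha>) * (\<integral>t. G (u t /\<^sub>R \<alpha>) \<partial>lebesgue_on I)" by simp
  also have "\<dots> \<le> (r * \<alpha>) * 1" using a r by (intro mult_left_mono) auto
  finally show ?thesis using ra by simp
qed

lemma luxemburg_scaleR_le:
  assumes u: "u \<in> orlicz_space I G" and s: "\<bar>s\<bar> \<le> 1"
  shows "luxemburg_norm I G (\<lambda>t. s *\<^sub>R u t) \<le> luxemburg_norm I G u"
  unfolding luxemburg_norm_eq[OF u] luxemburg_norm_eq[OF orlicz_scaleR[OF u]]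
proof (rule cInf_superset_mono[OF luxemburg_set_nonempty[OF u] luxemburg_set_bdd])
  show "luxemburg_set u \<subseteq> luxemburg_set (\<lambda>t. s *\<^sub>R u t)"
  proof
    fix \<alpha> assume \<alpha>: "\<alpha> \<in> luxemburg_set u"
    have "(\<integral>t. G (s *\<^sub>R u t /\<^sub>R \<alpha>) \<partial>lebesgue_on I) \<le> (\<integral>t. G (u t /\<^sub>R \<alpha>) \<partial>lebesgue_on I)"
    proof (rule integral_mono)
      show "G (s *\<^sub>R u t /\<^sub>R \<alpha>) \<le> G (u t /\<^sub>R \<alpha>)" for t
        using G_scaleR_mono[of s 1 "u t /\<^sub>R \<alpha>"] s by (simp add: mult.commute)
    qed (intro orlicz_integrable_scaleR orlicz_scaleR u)+
    then show "\<alpha> \<in> luxemburg_set (\<lambda>t. s *\<^sub>R u t)" using \<alpha> by (simp add: luxemburg_set_def)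
  qed
qed

lemma orlicz_integrable:
  assumes u: "u \<in> orlicz_space I G" shows "integrable (lebesgue_on I) u"
proof -
  obtain C where C: "\<And>x. 1 * norm x \<le> G x + C" using G_superlinear_bound by blast
  show ?thesis
  proof (rule Bochner_Integration.integrable_bound)
    show "integrable (lebesgue_on I) (\<lambda>t. G (u t) + C)"
      using u by (intro Bochner_Integration.integrable_add integrable_const_I) (simp add: orlicz_iff)
    show "u \<in> borel_measurable (lebesgue_on I)" using u by (simp add: orlicz_iff)
    show "AE t in lebesgue_on I. norm (u t) \<le> norm (G (u t) + C)"
    proof (rule AE_I2)
      show "norm (u t) \<le> norm (G (u t) + C)" for t using C[of "u t"] by simp
    qed
  qed
qed

lemma integral_norm_le_luxemburg:
  "\<exists>C\<ge>0. \<forall>u\<in>orlicz_space I G. (\<integral>t. norm (u t) \<partial>lebesgue_on I) \<le> C * luxemburg_norm I G u"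
proof -
  obtain C where C: "0 \<le> C" "\<And>x. 1 * norm x \<le> G x + C" using G_superlinear_bound by blast
  define T where "T = 1 + (\<integral>t. C \<partial>lebesgue_on I)"
  have T: "0 \<le> T" using C(1) by (simp add: T_def)
  have "(\<integral>t. norm (u t) \<partial>lebesgue_on I) \<le> T * luxemburg_norm I G u" if u: "u \<in> orlicz_space I G" for u
  proof (rule le_mult_luxemburg[OF u T])
    fix \<alpha> assume "\<alpha> \<in> luxemburg_set u"
    then have a: "0 < \<alpha>" "(\<integral>t. G (u t /\<^sub>R \<alpha>) \<partial>lebesgue_on I) \<le> 1" by (simp_all add: luxemburg_set_def)
    have "(\<integral>t. norm (u t /\<^sub>R \<alpha>) \<partial>lebesgue_on I) \<le> (\<integral>t. G (u t /\<^sub>R \<alpha>) + C \<partial>lebesgue_on I)"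
    proof (rule integral_mono)
      show "integrable (lebesgue_on I) (\<lambda>t. norm (u t /\<^sub>R \<alpha>))"
        by (intro integrable_norm integrable_scaleR_right orlicz_integrable u)
      show "integrable (lebesgue_on I) (\<lambda>t. G (u t /\<^sub>R \<alpha>) + C)"
        by (intro Bochner_Integration.integrable_add integrable_const_I orlicz_integrable_scaleR u)
      show "norm (u t /\<^sub>R \<alpha>) \<le> G (u t /\<^sub>R \<alpha>) + C" for t using C(2)[of "u t /\<^sub>R \<alpha>"] by simp
    qed
    also have "\<dots> = (\<integral>t. G (u t /\<^sub>R \<alpha>) \<partial>lebesgue_on I) + (\<integral>t. C \<partial>lebesgue_on I)"
      by (intro Bochner_Integration.integral_add integrable_const_I orlicz_integrable_scaleR u)
    also have "\<dots> \<le> T" using a by (simp add: T_def)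
    also have "(\<integral>t. norm (u t /\<^sub>R \<alpha>) \<partial>lebesgue_on I) = (\<integral>t. norm (u t) \<partial>lebesgue_on I) / \<alpha>"
      using a by (simp add: divide_inverse mult.commute)
    finally show "(\<integral>t. norm (u t) \<partial>lebesgue_on I) \<le> T * \<alpha>"
      using a by (simp add: pos_divide_le_eq)
  qed
  then show ?thesis using T by blast
qed

text \<open>A form of the Hoelder inequality that involves the modular of \<open>f\<close> instead of its dual norm; it is
  Young's inequality for \<open>w/\<alpha>\<close>.\<close>
lemma
  assumes f: "f \<in> borel_measurable (lebesgue_on I)" "integrable (lebesgue_on I) (\<lambda>t. fenchel_conj G (f t))"
    and w: "w \<in> orlicz_space I G"
  shows Hoelder_integrable: "integrable (lebesgue_on I) (\<lambda>t. f t \<bullet> w t)"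
    and Hoelder_le: "\<bar>\<integral>t. f t \<bullet> w t \<partial>lebesgue_on I\<bar>
      \<le> ((\<integral>t. fenchel_conj G (f t) \<partial>lebesgue_on I) + 1) * luxemburg_norm I G w"
proof -
  have wm: "w \<in> borel_measurable (lebesgue_on I)" using w by (simp add: orlicz_iff)
  have i: "integrable (lebesgue_on I) (\<lambda>t. f t \<bullet> v t)" if v: "v \<in> orlicz_space I G" for v
  proof (rule Bochner_Integration.integrable_bound)
    show "integrable (lebesgue_on I) (\<lambda>t. G (v t) + fenchel_conj G (f t))"
      using v f(2) by (intro Bochner_Integration.integrable_add) (simp_all add: orlicz_iff)
    show "(\<lambda>t. f t \<bullet> v t) \<in> borel_measurable (lebesgue_on I)"
      using f(1) v by (intro borel_measurable_inner) (simp_all add: orlicz_iff)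
    show "AE t in lebesgue_on I. norm (f t \<bullet> v t) \<le> norm (G (v t) + fenchel_conj G (f t))"
    proof (rule AE_I2)
      show "norm (f t \<bullet> v t) \<le> norm (G (v t) + fenchel_conj G (f t))" for t
        using Young_ineq_abs[of "v t" "f t"] by (simp add: inner_commute)
    qed
  qed
  show "integrable (lebesgue_on I) (\<lambda>t. f t \<bullet> w t)" by (rule i[OF w])
  have nn: "0 \<le> (\<integral>t. fenchel_conj G (f t) \<partial>lebesgue_on I)"
    by (rule Bochner_Integration.integral_nonneg) (rule conj_nonneg)
  show "\<bar>\<integral>t. f t \<bullet> w t \<partial>lebesgue_on I\<bar>
      \<le> ((\<integral>t. fenchel_conj G (f t) \<partial>lebesgue_on I) + 1) * luxemburg_norm I G w"
  proof (rule le_mult_luxemburg[OF w])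
    fix \<alpha> assume "\<alpha> \<in> luxemburg_set w"
    then have a: "0 < \<alpha>" "(\<integral>t. G (w t /\<^sub>R \<alpha>) \<partial>lebesgue_on I) \<le> 1" by (simp_all add: luxemburg_set_def)
    have "\<bar>\<integral>t. f t \<bullet> (w t /\<^sub>R \<alpha>) \<partial>lebesgue_on I\<bar> \<le> (\<integral>t. \<bar>f t \<bullet> (w t /\<^sub>R \<alpha>)\<bar> \<partial>lebesgue_on I)"
      by (rule integral_abs_bound)
    also have "\<dots> \<le> (\<integral>t. G (w t /\<^sub>R \<alpha>) + fenchel_conj G (f t) \<partial>lebesgue_on I)"
    proof (rule integral_mono)
      show "integrable (lebesgue_on I) (\<lambda>t. \<bar>f t \<bullet> (w t /\<^sub>R \<alpha>)\<bar>)"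
        by (intro integrable_abs i orlicz_scaleR w)
      show "integrable (lebesgue_on I) (\<lambda>t. G (w t /\<^sub>R \<alpha>) + fenchel_conj G (f t))"
        by (intro Bochner_Integration.integrable_add f orlicz_integrable_scaleR w)
      show "\<bar>f t \<bullet> (w t /\<^sub>R \<alpha>)\<bar> \<le> G (w t /\<^sub>R \<alpha>) + fenchel_conj G (f t)" for t
        using Young_ineq_abs[of "w t /\<^sub>R \<alpha>" "f t"] by (simp only: inner_commute)
    qed
    also have "\<dots> = (\<integral>t. G (w t /\<^sub>R \<alpha>) \<partial>lebesgue_on I) + (\<integral>t. fenchel_conj G (f t) \<partial>lebesgue_on I)"
      by (intro Bochner_Integration.integral_add f orlicz_integrable_scaleR w)
    also have "\<dots> \<le> (\<integral>t. fenchel_conj G (f t) \<partial>lebesgue_on I) + 1" using a by simp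
    also have "(\<integral>t. f t \<bullet> (w t /\<^sub>R \<alpha>) \<partial>lebesgue_on I) = (\<integral>t. f t \<bullet> w t \<partial>lebesgue_on I) / \<alpha>"
      by (simp add: divide_inverse mult.commute)
    finally have "\<bar>\<integral>t. f t \<bullet> w t \<partial>lebesgue_on I\<bar> / \<alpha> \<le> (\<integral>t. fenchel_conj G (f t) \<partial>lebesgue_on I) + 1"
      using a by (simp add: abs_divide)
    then show "\<bar>\<integral>t. f t \<bullet> w t \<partial>lebesgue_on I\<bar> \<le> ((\<integral>t. fenchel_conj G (f t) \<partial>lebesgue_on I) + 1) * \<alpha>"
      using a by (simp add: pos_divide_le_eq)
  qed (use nn in simp)
qed

section \<open>The Orlicz-Sobolev space\<close>

abbreviation W where "W \<equiv> orlicz_sobolev_space I G"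
abbreviation nrm where "nrm \<equiv> orlicz_sobolev_norm I G"

lemma W_has_weak_deriv: "u \<in> W \<Longrightarrow> has_weak_deriv I u (weak_deriv I u)"
  by (auto simp: orlicz_sobolev_space_def intro: has_weak_deriv_weak_deriv)

lemma W_orlicz: "u \<in> W \<Longrightarrow> u \<in> orlicz_space I G" "u \<in> W \<Longrightarrow> weak_deriv I u \<in> orlicz_space I G"
  by (auto simp: orlicz_sobolev_space_def)

lemma W_memI:
  assumes u: "u \<in> orlicz_space I G" and uv: "has_weak_deriv I u v" and v: "v \<in> orlicz_space I G"
  shows "u \<in> W"
proof -
  have "AE t in lebesgue_on I. v t = weak_deriv I u t"
    using weak_deriv_AE_eq[OF interval bounded uv] by eventually_elim simp
  from orlicz_cong_AE[OF v this] show ?thesis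
    using u uv by (auto simp: orlicz_sobolev_space_def)
qed

lemma W_add:
  assumes u: "u \<in> W" and w: "w \<in> W"
  shows "(\<lambda>t. u t + w t) \<in> W"
    and "AE t in lebesgue_on I. weak_deriv I (\<lambda>t. u t + w t) t = weak_deriv I u t + weak_deriv I w t"
proof -
  have d: "has_weak_deriv I (\<lambda>t. u t + w t) (\<lambda>t. weak_deriv I u t + weak_deriv I w t)"
    by (rule has_weak_deriv_add[OF W_has_weak_deriv[OF u] W_has_weak_deriv[OF w] I_sets])
  show "(\<lambda>t. u t + w t) \<in> W"
    by (rule W_memI[OF orlicz_add d orlicz_add]) (rule W_orlicz u w)+
  show "AE t in lebesgue_on I. weak_deriv I (\<lambda>t. u t + w t) t = weak_deriv I u t + weak_deriv I w t"
    by (rule weak_deriv_AE_eq[OF interval bounded d])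
qed

lemma W_scaleR:
  assumes u: "u \<in> W"
  shows "(\<lambda>t. r *\<^sub>R u t) \<in> W"
    and "AE t in lebesgue_on I. weak_deriv I (\<lambda>t. r *\<^sub>R u t) t = r *\<^sub>R weak_deriv I u t"
proof -
  have d: "has_weak_deriv I (\<lambda>t. r *\<^sub>R u t) (\<lambda>t. r *\<^sub>R weak_deriv I u t)"
    by (rule has_weak_deriv_scaleR[OF W_has_weak_deriv[OF u]])
  show "(\<lambda>t. r *\<^sub>R u t) \<in> W"
    by (rule W_memI[OF orlicz_scaleR d orlicz_scaleR]) (rule W_orlicz u)+
  show "AE t in lebesgue_on I. weak_deriv I (\<lambda>t. r *\<^sub>R u t) t = r *\<^sub>R weak_deriv I u t"
    by (rule weak_deriv_AE_eq[OF interval bounded d])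
qed

lemma W_diff:
  assumes u: "u \<in> W" and w: "w \<in> W"
  shows "(\<lambda>t. u t - w t) \<in> W"
    and "AE t in lebesgue_on I. weak_deriv I (\<lambda>t. u t - w t) t = weak_deriv I u t - weak_deriv I w t"
proof -
  have e: "(\<lambda>t. u t - w t) = (\<lambda>t. u t + (- 1) *\<^sub>R w t)" by simp
  show "(\<lambda>t. u t - w t) \<in> W" unfolding e by (intro W_add W_scaleR u w)
  show "AE t in lebesgue_on I. weak_deriv I (\<lambda>t. u t - w t) t = weak_deriv I u t - weak_deriv I w t"
    unfolding e using W_add(2)[OF u W_scaleR(1)[OF w, of "- 1"]] W_scaleR(2)[OF w, of "- 1"]
    by eventually_elim simp
qed

lemma weak_deriv_cong_AE:
  assumes u: "u \<in> W" and w: "w \<in> W" and ae: "AE t in lebesgue_on I. u t = w t"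
  shows "AE t in lebesgue_on I. weak_deriv I u t = weak_deriv I w t"
proof -
  have "locally_integrable I w" using W_has_weak_deriv[OF w] by (simp add: has_weak_deriv_def)
  from has_weak_deriv_cong_AE[OF W_has_weak_deriv[OF u] ae this I_sets]
  have "has_weak_deriv I w (weak_deriv I u)" .
  from weak_deriv_AE_eq[OF interval bounded this] show ?thesis by eventually_elim simp
qed

lemma luxemburg_le_nrm:
  assumes "u \<in> W"
  shows "luxemburg_norm I G u \<le> nrm u" "luxemburg_norm I G (weak_deriv I u) \<le> nrm u" "0 \<le> nrm u"
  using luxemburg_nonneg[OF W_orlicz(1)[OF assms]] luxemburg_nonneg[OF W_orlicz(2)[OF assms]]
  by (simp_all add: orlicz_sobolev_norm_def)

lemma nrm_scaleR_le:
  assumes u: "u \<in> W" and s: "\<bar>s\<bar> \<le> 1"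
  shows "nrm (\<lambda>t. s *\<^sub>R u t) \<le> nrm u"
proof -
  have "luxemburg_norm I G (weak_deriv I (\<lambda>t. s *\<^sub>R u t)) = luxemburg_norm I G (\<lambda>t. s *\<^sub>R weak_deriv I u t)"
    by (rule luxemburg_cong_AE[OF W_scaleR(2)[OF u]])
  then show ?thesis
    using luxemburg_scaleR_le[OF W_orlicz(1)[OF u] s] luxemburg_scaleR_le[OF W_orlicz(2)[OF u] s]
    by (simp add: orlicz_sobolev_norm_def)
qed

text \<open>The embedding of the Orlicz-Sobolev space into \<open>L\<^sup>\<infinity>\<close>.\<close>
lemma W_sup_bound: "\<exists>C\<ge>0. \<forall>u\<in>W. AE t in lebesgue_on I. norm (u t) \<le> C * nrm u"
proof -
  obtain C where C: "0 \<le> C" "\<And>u v :: real \<Rightarrow> 'a. has_weak_deriv I u v \<Longrightarrow> integrable (lebesgue_on I) u \<Longrightarrow>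
     integrable (lebesgue_on I) v \<Longrightarrow> (AE t in lebesgue_on I. norm (u t) \<le>
       C * ((\<integral>t. norm (u t) \<partial>lebesgue_on I) + (\<integral>t. norm (v t) \<partial>lebesgue_on I)))"
    using weak_deriv_sup_bound[OF interval bounded, where 'a='a] by blast
  obtain D where D: "0 \<le> D" "\<And>u. u \<in> orlicz_space I G \<Longrightarrow>
      (\<integral>t. norm (u t) \<partial>lebesgue_on I) \<le> D * luxemburg_norm I G u"
    using integral_norm_le_luxemburg by blast
  have "AE t in lebesgue_on I. norm (u t) \<le> (C * D) * nrm u" if u: "u \<in> W" for u
  proof -
    have "(\<integral>t. norm (u t) \<partial>lebesgue_on I) + (\<integral>t. norm (weak_deriv I u t) \<partial>lebesgue_on I)
        \<le> D * luxemburg_norm I G u + D * luxemburg_norm I G (weak_deriv I u)"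
      by (intro add_mono D W_orlicz u)
    then have "C * ((\<integral>t. norm (u t) \<partial>lebesgue_on I) + (\<integral>t. norm (weak_deriv I u t) \<partial>lebesgue_on I))
        \<le> C * (D * nrm u)"
      using C(1) by (intro mult_left_mono) (simp_all add: orlicz_sobolev_norm_def distrib_left)
    then have le: "C * ((\<integral>t. norm (u t) \<partial>lebesgue_on I) + (\<integral>t. norm (weak_deriv I u t) \<partial>lebesgue_on I))
        \<le> (C * D) * nrm u" by (simp add: mult.assoc)
    have "AE t in lebesgue_on I. norm (u t) \<le>
       C * ((\<integral>t. norm (u t) \<partial>lebesgue_on I) + (\<integral>t. norm (weak_deriv I u t) \<partial>lebesgue_on I))"
      by (rule C(2)) (intro W_has_weak_deriv orlicz_integrable W_orlicz u)+
    then show ?thesis by eventually_elim (use le in linarith)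
  qed
  then show ?thesis using C(1) D(1) by (intro exI[of _ "C * D"] conjI ballI) auto
qed

end

section \<open>Superposition operators\<close>

text \<open>The majorant is the sum of the series.\<close>
lemma AE_bounded_of_geometric_integrals:
  fixes f :: "nat \<Rightarrow> 'b \<Rightarrow> real"
  assumes f: "\<And>n. integrable M (f n)" "\<And>n t. 0 \<le> f n t" and le: "\<And>n. (\<integral>t. f n t \<partial>M) \<le> (1 / 2) ^ n"
  shows "\<exists>h. integrable M h \<and> (AE t in M. \<forall>n. f n t \<le> h t)"
proof -
  have m: "\<And>n. f n \<in> borel_measurable M" using f(1) by (rule borel_measurable_integrable)
  have "(\<integral>\<^sup>+t. (\<Sum>n. ennreal (f n t)) \<partial>M) = (\<Sum>n. \<integral>\<^sup>+t. ennreal (f n t) \<partial>M)"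
    by (rule nn_integral_suminf) (use m in measurable)
  also have "\<dots> \<le> (\<Sum>n. ennreal ((1 / 2) ^ n))"
  proof (intro suminf_le)
    show "(\<integral>\<^sup>+t. ennreal (f n t) \<partial>M) \<le> ennreal ((1 / 2) ^ n)" for n
      using nn_integral_eq_integral[OF f(1), of n] f(2) le[of n] by (simp add: ennreal_leI)
  qed auto
  also have "\<dots> = ennreal (\<Sum>n. (1 / 2) ^ n)"
    by (rule suminf_ennreal2) (auto intro: summable_geometric)
  also have "\<dots> < \<infinity>" by simp
  finally have fin: "(\<integral>\<^sup>+t. (\<Sum>n. ennreal (f n t)) \<partial>M) < \<infinity>" .
  have "AE t in M. (\<Sum>n. ennreal (f n t)) \<noteq> \<infinity>"
    by (rule nn_integral_PInf_AE) (use m fin in \<open>auto intro: borel_measurable_suminf\<close>)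
  then have ae: "AE t in M. summable (\<lambda>n. f n t)"
    by eventually_elim (auto intro: summable_suminf_not_top f(2))
  have mh: "(\<lambda>t. \<Sum>n. f n t) \<in> borel_measurable M"
    using m by (rule borel_measurable_suminf)
  have "integrable M (\<lambda>t. \<Sum>n. f n t)"
  proof (rule integrableI_nonneg[OF mh])
    show "AE t in M. 0 \<le> (\<Sum>n. f n t)"
      using ae by eventually_elim (auto intro: suminf_nonneg f(2))
    have "(\<integral>\<^sup>+t. ennreal (\<Sum>n. f n t) \<partial>M) = (\<integral>\<^sup>+t. (\<Sum>n. ennreal (f n t)) \<partial>M)"
      by (rule nn_integral_cong_AE) (use ae in eventually_elim, simp add: suminf_ennreal2 f(2))
    then show "(\<integral>\<^sup>+t. ennreal (\<Sum>n. f n t) \<partial>M) < \<infinity>" using fin by simp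
  qed
  moreover have "AE t in M. \<forall>n. f n t \<le> (\<Sum>n. f n t)"
    using ae
  proof eventually_elim
    case (elim t)
    show ?case
    proof
      show "f n t \<le> (\<Sum>n. f n t)" for n
        using sum_le_suminf[OF elim, of "{n}"] f(2) by simp
    qed
  qed
  ultimately show ?thesis by blast
qed

text \<open>The integrand \<open>F\<close> with its growth conditions.\<close>
locale action_functional = orlicz_interval G I
  for G :: "'a::euclidean_space \<Rightarrow> real" and I :: "real set" +
  fixes F :: "real \<Rightarrow> 'a \<Rightarrow> 'a \<Rightarrow> real" and a b c :: "real \<Rightarrow> real"
  assumes F_C1: "C1_on (I \<times> UNIV \<times> UNIV) (\<lambda>(t, x, v). F t x v)"
    and a_continuous: "continuous_on {0..} a"
    and a_nonneg: "\<And>r. 0 \<le> r \<Longrightarrow> 0 \<le> a r"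
    and b_integrable: "integrable (lebesgue_on I) b" and b_nonneg: "\<And>t. t \<in> I \<Longrightarrow> 0 \<le> b t"
    and c_integrable: "integrable (lebesgue_on I) c" and c_nonneg: "\<And>t. t \<in> I \<Longrightarrow> 0 \<le> c t"
    and F_bound: "\<And>t x v. t \<in> I \<Longrightarrow> \<bar>F t x v\<bar> \<le> a (norm x) * (b t + G v)"
    and Fx_bound: "\<And>t x v. t \<in> I \<Longrightarrow> norm (grad_x F t x v) \<le> a (norm x) * (b t + G v)"
    and Fv_bound: "\<And>t x v. t \<in> I \<Longrightarrow> fenchel_conj G (grad_v F t x v)
                     \<le> a (norm x) * (c t + fenchel_conj G (grad G v))"
begin

abbreviation Fx where "Fx \<equiv> grad_x F"
abbreviation Fv where "Fv \<equiv> grad_v F"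

text \<open>A continuous total derivative of \<open>F\<close>, one-sided in \<open>t\<close> at endpoints of \<open>I\<close>. Only its values on directions
  \<open>(0,h,k)\<close> matter, and these are determined by the gradients.\<close>
definition F' :: "real \<times> 'a \<times> 'a \<Rightarrow> (real \<times> 'a \<times> 'a) \<Rightarrow>\<^sub>L real" where
  "F' = (SOME f'. (\<forall>z\<in>I \<times> UNIV \<times> UNIV. ((\<lambda>(t, x, v). F t x v) has_derivative blinfun_apply (f' z))
       (at z within I \<times> UNIV \<times> UNIV)) \<and> continuous_on (I \<times> UNIV \<times> UNIV) f')"

lemma F'_has_derivative:
    "t \<in> I \<Longrightarrow> ((\<lambda>(t, x, v). F t x v) has_derivative F' (t, x, v)) (at (t, x, v) within I \<times> UNIV \<times> UNIV)"
  and F'_continuous: "continuous_on (I \<times> UNIV \<times> UNIV) F'"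
proof -
  have *: "(\<forall>z\<in>I \<times> UNIV \<times> UNIV. ((\<lambda>(t, x, v). F t x v) has_derivative blinfun_apply (F' z))
       (at z within I \<times> UNIV \<times> UNIV)) \<and> continuous_on (I \<times> UNIV \<times> UNIV) F'"
    unfolding F'_def by (rule someI_ex[OF F_C1[unfolded C1_on_def]])
  show "t \<in> I \<Longrightarrow> ((\<lambda>(t, x, v). F t x v) has_derivative F' (t, x, v)) (at (t, x, v) within I \<times> UNIV \<times> UNIV)"
    using * by simp
  show "continuous_on (I \<times> UNIV \<times> UNIV) F'" using * by simp
qed

lemma F_derivative_x:
  assumes t: "t \<in> I" shows "((\<lambda>y. F t y v) has_derivative (\<lambda>h. F' (t, x, v) (0, h, 0))) (at x)"
proof -
  have "((\<lambda>y. (t, y, v)) has_derivative (\<lambda>h. (0, h, 0))) (at x)"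
    by (auto intro!: derivative_eq_intros)
  moreover have "((\<lambda>(t, x, v). F t x v) has_derivative F' (t, x, v)) (at (t, x, v) within range (\<lambda>y. (t, y, v)))"
    by (rule has_derivative_subset[OF F'_has_derivative]) (use t in auto)
  ultimately show ?thesis
    using has_derivative_in_compose[of "\<lambda>y. (t, y, v)" _ x UNIV "\<lambda>(t, x, v). F t x v"] by simp
qed

lemma F_derivative_v:
  assumes t: "t \<in> I" shows "((\<lambda>y. F t x y) has_derivative (\<lambda>h. F' (t, x, v) (0, 0, h))) (at v)"
proof -
  have "((\<lambda>y. (t, x, y)) has_derivative (\<lambda>h. (0, 0, h))) (at v)"
    by (auto intro!: derivative_eq_intros)
  moreover have "((\<lambda>(t, x, v). F t x v) has_derivative F' (t, x, v)) (at (t, x, v) within range (\<lambda>y. (t, x, y)))"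
    by (rule has_derivative_subset[OF F'_has_derivative]) (use t in auto)
  ultimately show ?thesis
    using has_derivative_in_compose[of "\<lambda>y. (t, x, y)" _ v UNIV "\<lambda>(t, x, v). F t x v"] by simp
qed

lemma F'_eq_gradients:
  assumes t: "t \<in> I" shows "F' (t, x, v) (0, h, k) = Fx t x v \<bullet> h + Fv t x v \<bullet> k"
proof -
  have "F' (t, x, v) (0, h, k) = F' (t, x, v) ((0, h, 0) + (0, 0, k))" by simp
  also have "\<dots> = F' (t, x, v) (0, h, 0) + F' (t, x, v) (0, 0, k)" by (rule blinfun.add_right)
  finally show ?thesis
    using grad_eqI(2)[OF F_derivative_x[OF t, of v x], of h] grad_eqI(2)[OF F_derivative_v[OF t, of x v], of k]
    by (simp add: grad_x_def grad_v_def)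
qed

lemma F_line_derivative:
  assumes t: "t \<in> I"
  shows "((\<lambda>s. F t (x + s *\<^sub>R h) (v + s *\<^sub>R k)) has_real_derivative
     Fx t (x + s *\<^sub>R h) (v + s *\<^sub>R k) \<bullet> h + Fv t (x + s *\<^sub>R h) (v + s *\<^sub>R k) \<bullet> k) (at s)"
proof -
  let ?p = "\<lambda>s. (t, x + s *\<^sub>R h, v + s *\<^sub>R k)"
  have "(?p has_derivative (\<lambda>r. (0, r *\<^sub>R h, r *\<^sub>R k))) (at s)"
    by (auto intro!: derivative_eq_intros)
  moreover have "((\<lambda>(t, x, v). F t x v) has_derivative F' (?p s)) (at (?p s) within range ?p)"
    by (rule has_derivative_subset[OF F'_has_derivative[OF t]]) (use t in auto)
  ultimately have "((\<lambda>s. F t (x + s *\<^sub>R h) (v + s *\<^sub>R k)) has_derivative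
      (\<lambda>r. F' (?p s) (0, r *\<^sub>R h, r *\<^sub>R k))) (at s)"
    using has_derivative_in_compose[of ?p _ s UNIV "\<lambda>(t, x, v). F t x v"] by simp
  then show ?thesis
    unfolding has_field_derivative_def
    by (rule has_derivative_eq_rhs) (simp add: F'_eq_gradients[OF t] fun_eq_iff algebra_simps)
qed

lemma F_continuous: "continuous_on (I \<times> UNIV \<times> UNIV) (\<lambda>(t, x, v). F t x v)"
proof (rule has_derivative_continuous_on[of _ _ "\<lambda>z. F' z"])
  fix z :: "real \<times> 'a \<times> 'a" assume "z \<in> I \<times> UNIV \<times> UNIV"
  then show "((\<lambda>(t, x, v). F t x v) has_derivative F' z) (at z within I \<times> UNIV \<times> UNIV)"
    using F'_has_derivative[of "fst z" "fst (snd z)" "snd (snd z)"] by auto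
qed

lemma Fx_continuous: "continuous_on (I \<times> UNIV \<times> UNIV) (\<lambda>(t, x, v). Fx t x v)"
  and Fv_continuous: "continuous_on (I \<times> UNIV \<times> UNIV) (\<lambda>(t, x, v). Fv t x v)"
proof -
  have "continuous_on (I \<times> UNIV \<times> UNIV) (\<lambda>z. \<Sum>e\<in>Basis. F' z (0, e, 0) *\<^sub>R e)"
    by (intro continuous_on_sum continuous_on_scaleR continuous_on_const blinfun.continuous_on F'_continuous)
  then show "continuous_on (I \<times> UNIV \<times> UNIV) (\<lambda>(t, x, v). Fx t x v)"
    by (rule continuous_on_eq) (auto simp: grad_x_def grad_eqI(1)[OF F_derivative_x])
  have "continuous_on (I \<times> UNIV \<times> UNIV) (\<lambda>z. \<Sum>e\<in>Basis. F' z (0, 0, e) *\<^sub>R e)"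
    by (intro continuous_on_sum continuous_on_scaleR continuous_on_const blinfun.continuous_on F'_continuous)
  then show "continuous_on (I \<times> UNIV \<times> UNIV) (\<lambda>(t, x, v). Fv t x v)"
    by (rule continuous_on_eq) (auto simp: grad_v_def grad_eqI(1)[OF F_derivative_v])
qed

lemma superposition_measurable:
  fixes \<Phi> :: "real \<Rightarrow> 'a \<Rightarrow> 'a \<Rightarrow> 'b::topological_space"
  assumes \<Phi>: "continuous_on (I \<times> UNIV \<times> UNIV) (\<lambda>(t, x, v). \<Phi> t x v)"
    and u: "u \<in> borel_measurable (lebesgue_on I)" and v: "v \<in> borel_measurable (lebesgue_on I)"
  shows "(\<lambda>t. \<Phi> t (u t) (v t)) \<in> borel_measurable (lebesgue_on I)"
proof -
  have id: "(\<lambda>t. t) \<in> borel_measurable (lebesgue_on I)"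
    using id_borel_measurable_lebesgue_on by (simp add: id_def)
  have "(\<lambda>t. (t, u t, v t)) \<in> borel_measurable (lebesgue_on I)"
    by (intro borel_measurable_Pair id u v)
  then have "(\<lambda>t. (t, u t, v t)) \<in> lebesgue_on I \<rightarrow>\<^sub>M restrict_space borel (I \<times> UNIV \<times> UNIV)"
    by (intro measurable_restrict_space2) auto
  from measurable_compose[OF this borel_measurable_continuous_on_restrict[OF \<Phi>]]
  show ?thesis by simp
qed

lemma superposition_tendsto:
  fixes \<Phi> :: "real \<Rightarrow> 'a \<Rightarrow> 'a \<Rightarrow> 'b::topological_space"
  assumes \<Phi>: "continuous_on (I \<times> UNIV \<times> UNIV) (\<lambda>(t, x, v). \<Phi> t x v)" and t: "t \<in> I"
    and x: "X \<longlonglongrightarrow> x" and v: "V \<longlonglongrightarrow> v"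
  shows "(\<lambda>n. \<Phi> t (X n) (V n)) \<longlonglongrightarrow> \<Phi> t x v"
proof -
  have "(\<lambda>n. (t, X n, V n)) \<longlonglongrightarrow> (t, x, v)"
    by (intro tendsto_Pair tendsto_const x v)
  from continuous_on_tendsto_compose[OF \<Phi> this] show ?thesis using t by simp
qed

text \<open>For bounded \<open>x\<close> the factor \<open>a(|x|)\<close> becomes a constant.\<close>
lemma local_bounds:
  obtains A where "0 \<le> A"
    and "\<And>t x v. t \<in> I \<Longrightarrow> norm x \<le> R \<Longrightarrow> \<bar>F t x v\<bar> \<le> A * (b t + G v)"
    and "\<And>t x v. t \<in> I \<Longrightarrow> norm x \<le> R \<Longrightarrow> norm (Fx t x v) \<le> A * (b t + G v)"
    and "\<And>t x v. t \<in> I \<Longrightarrow> norm x \<le> R \<Longrightarrow> fenchel_conj G (Fv t x v) \<le> A * (c t + G (2 *\<^sub>R v))"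
proof -
  have "bounded (a ` {0..R})"
    by (intro compact_imp_bounded compact_continuous_image continuous_on_subset[OF a_continuous]) auto
  then obtain A where A: "\<forall>y\<in>a ` {0..R}. norm y \<le> A" unfolding bounded_iff by blast
  define B where "B = max A 0"
  have aB: "a (norm x) \<le> B" if "norm x \<le> R" for x :: 'a
    using bspec[OF A, of "a (norm x)"] that by (auto simp: B_def)
  show ?thesis
  proof (rule that[of B])
    show "0 \<le> B" by (simp add: B_def)
    fix t x v assume t: "t \<in> I" and x: "norm (x::'a) \<le> R"
    have bG: "a (norm x) * (b t + G v) \<le> B * (b t + G v)"
      using b_nonneg[OF t] nonneg[of v] by (intro mult_right_mono aB x) simp
    show "\<bar>F t x v\<bar> \<le> B * (b t + G v)" using F_bound[OF t, of x v] bG by simp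
    show "norm (Fx t x v) \<le> B * (b t + G v)" using Fx_bound[OF t, of x v] bG by simp
    have "fenchel_conj G (Fv t x v) \<le> a (norm x) * (c t + fenchel_conj G (grad G v))"
      by (rule Fv_bound[OF t])
    also have "\<dots> \<le> B * (c t + G (2 *\<^sub>R v))"
      using c_nonneg[OF t] conj_nonneg[of "grad G v"] a_nonneg[of "norm x"] conj_grad_le[of v]
      by (intro mult_mono aB x) (auto simp: B_def)
    finally show "fenchel_conj G (Fv t x v) \<le> B * (c t + G (2 *\<^sub>R v))" .
  qed
qed

lemma AE_mem_I: "AE t in lebesgue_on I. t \<in> I"
  by (rule AE_I2) simp

text \<open>Pairs of an essentially bounded function and an Orlicz function. A Sobolev function together with its
  weak derivative is such a pair; treating the two components as independent keeps weak derivatives out of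
  the convergence arguments.\<close>
definition admissible :: "(real \<Rightarrow> 'a) \<Rightarrow> (real \<Rightarrow> 'a) \<Rightarrow> bool" where
  "admissible u v \<longleftrightarrow> u \<in> borel_measurable (lebesgue_on I) \<and>
     (\<exists>R. AE t in lebesgue_on I. norm (u t) \<le> R) \<and> v \<in> orlicz_space I G"

lemma admissible_measurable:
  assumes "admissible u v"
  shows "(\<lambda>t. F t (u t) (v t)) \<in> borel_measurable (lebesgue_on I)"
    and "(\<lambda>t. Fx t (u t) (v t)) \<in> borel_measurable (lebesgue_on I)"
    and "(\<lambda>t. Fv t (u t) (v t)) \<in> borel_measurable (lebesgue_on I)"
  using assms unfolding admissible_def orlicz_iff
  by (blast intro: superposition_measurable F_continuous Fx_continuous Fv_continuous)+

lemma admissible_integrable: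
  assumes uv: "admissible u v"
  shows "integrable (lebesgue_on I) (\<lambda>t. F t (u t) (v t))"
    and "integrable (lebesgue_on I) (\<lambda>t. Fx t (u t) (v t))"
    and "integrable (lebesgue_on I) (\<lambda>t. fenchel_conj G (Fv t (u t) (v t)))"
proof -
  obtain R where R: "AE t in lebesgue_on I. norm (u t) \<le> R" and v: "v \<in> orlicz_space I G"
    using uv by (auto simp: admissible_def)
  obtain A where A: "0 \<le> A"
    "\<And>t x v. t \<in> I \<Longrightarrow> norm x \<le> R \<Longrightarrow> \<bar>F t x v\<bar> \<le> A * (b t + G v)"
    "\<And>t x v. t \<in> I \<Longrightarrow> norm x \<le> R \<Longrightarrow> norm (Fx t x v) \<le> A * (b t + G v)"
    "\<And>t x v. t \<in> I \<Longrightarrow> norm x \<le> R \<Longrightarrow> fenchel_conj G (Fv t x v) \<le> A * (c t + G (2 *\<^sub>R v))"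
    using local_bounds[of R] by metis
  have i1: "integrable (lebesgue_on I) (\<lambda>t. A * (b t + G (v t)))"
    using v by (intro integrable_mult_right Bochner_Integration.integrable_add b_integrable) (simp add: orlicz_iff)
  have i2: "integrable (lebesgue_on I) (\<lambda>t. A * (c t + G (2 *\<^sub>R v t)))"
    by (intro integrable_mult_right Bochner_Integration.integrable_add c_integrable orlicz_integrable_scaleR v)
  note m = admissible_measurable[OF uv]
  show "integrable (lebesgue_on I) (\<lambda>t. F t (u t) (v t))"
  proof (rule Bochner_Integration.integrable_bound[OF i1 m(1)])
    show "AE t in lebesgue_on I. norm (F t (u t) (v t)) \<le> norm (A * (b t + G (v t)))"
      using R AE_mem_I
    proof eventually_elim
      case (elim t)
      show ?case using A(2)[OF elim(2,1), of "v t"] by simp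
    qed
  qed
  show "integrable (lebesgue_on I) (\<lambda>t. Fx t (u t) (v t))"
  proof (rule Bochner_Integration.integrable_bound[OF i1 m(2)])
    show "AE t in lebesgue_on I. norm (Fx t (u t) (v t)) \<le> norm (A * (b t + G (v t)))"
      using R AE_mem_I
    proof eventually_elim
      case (elim t)
      show ?case using A(3)[OF elim(2,1), of "v t"] by simp
    qed
  qed
  show "integrable (lebesgue_on I) (\<lambda>t. fenchel_conj G (Fv t (u t) (v t)))"
  proof (rule Bochner_Integration.integrable_bound[OF i2 measurable_compose[OF m(3) conj_measurable]])
    show "AE t in lebesgue_on I. norm (fenchel_conj G (Fv t (u t) (v t))) \<le> norm (A * (c t + G (2 *\<^sub>R v t)))"
      using R AE_mem_I
    proof eventually_elim
      case (elim t)
      show ?case using A(4)[OF elim(2,1), of "v t"] conj_nonneg[of "Fv t (u t) (v t)"] by simp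
    qed
  qed
qed

text \<open>Continuity of the superposition operators along sequences that converge almost everywhere and have an
  integrable majorant. The second convergence needs the \<open>\<Delta>\<^sub>2\<close> property of the conjugate.\<close>
lemma superposition_continuous:
  assumes un: "\<And>n. admissible (un n) (vn n)" and uv: "admissible u v"
    and R: "AE t in lebesgue_on I. (\<forall>n. norm (un n t) \<le> R) \<and> norm (u t) \<le> R"
    and lim: "AE t in lebesgue_on I. (\<lambda>n. un n t) \<longlonglongrightarrow> u t \<and> (\<lambda>n. vn n t) \<longlonglongrightarrow> v t"
    and H: "integrable (lebesgue_on I) H" "AE t in lebesgue_on I. \<forall>n. G (2 *\<^sub>R vn n t) \<le> H t"
  shows "(\<lambda>n. \<integral>t. norm (Fx t (un n t) (vn n t) - Fx t (u t) (v t)) \<partial>lebesgue_on I) \<longlonglongrightarrow> 0"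
    and "(\<lambda>n. \<integral>t. fenchel_conj G (r *\<^sub>R (Fv t (un n t) (vn n t) - Fv t (u t) (v t))) \<partial>lebesgue_on I) \<longlonglongrightarrow> 0"
proof -
  obtain A where A: "0 \<le> A"
    "\<And>t x v. t \<in> I \<Longrightarrow> norm x \<le> R \<Longrightarrow> norm (Fx t x v) \<le> A * (b t + G v)"
    "\<And>t x v. t \<in> I \<Longrightarrow> norm x \<le> R \<Longrightarrow> fenchel_conj G (Fv t x v) \<le> A * (c t + G (2 *\<^sub>R v))"
    using local_bounds[of R] by metis
  have G2: "G x \<le> G (2 *\<^sub>R x)" for x using G_scaleR_mono[of 1 2 x] by simp
  have Hv: "AE t in lebesgue_on I. G (2 *\<^sub>R v t) \<le> H t"
    using lim H(2)
  proof eventually_elim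
    case (elim t)
    have "(\<lambda>n. G (2 *\<^sub>R vn n t)) \<longlonglongrightarrow> G (2 *\<^sub>R v t)"
      by (rule continuous_on_tendsto_compose[OF G_continuous]) (use elim in \<open>auto intro: tendsto_scaleR\<close>)
    then show ?case by (rule LIMSEQ_le_const2) (use elim in blast)
  qed
  note m = admissible_measurable[OF un] and m0 = admissible_measurable[OF uv]
  have "(\<lambda>n. \<integral>t. norm (Fx t (un n t) (vn n t) - Fx t (u t) (v t)) \<partial>lebesgue_on I) \<longlonglongrightarrow> (\<integral>t. 0 \<partial>lebesgue_on I)"
  proof (rule integral_dominated_convergence[where w = "\<lambda>t. 2 * (A * (b t + H t))"])
    show "(\<lambda>t. norm (Fx t (un n t) (vn n t) - Fx t (u t) (v t))) \<in> borel_measurable (lebesgue_on I)" for n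
      by (rule measurable_compose[OF borel_measurable_diff[OF m(2) m0(2)] borel_measurable_norm])
    show "integrable (lebesgue_on I) (\<lambda>t. 2 * (A * (b t + H t)))"
      by (intro integrable_mult_right Bochner_Integration.integrable_add b_integrable H)
    show "AE t in lebesgue_on I. (\<lambda>n. norm (Fx t (un n t) (vn n t) - Fx t (u t) (v t))) \<longlonglongrightarrow> 0"
      using lim AE_mem_I
    proof eventually_elim
      case (elim t)
      have "(\<lambda>n. Fx t (un n t) (vn n t)) \<longlonglongrightarrow> Fx t (u t) (v t)"
        by (rule superposition_tendsto[OF Fx_continuous]) (simp_all add: elim)
      then show ?case by (simp add: tendsto_norm_zero_iff LIM_zero_iff)
    qed
    show "AE t in lebesgue_on I. norm (norm (Fx t (un n t) (vn n t) - Fx t (u t) (v t))) \<le> 2 * (A * (b t + H t))" for n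
      using R AE_mem_I Hv H(2)
    proof eventually_elim
      case (elim t)
      have "norm (Fx t (un n t) (vn n t)) \<le> A * (b t + H t)"
      proof (rule order_trans[OF A(2)])
        show "A * (b t + G (vn n t)) \<le> A * (b t + H t)"
          using A(1) elim(4)[rule_format, of n] G2[of "vn n t"] by (intro mult_left_mono) auto
      qed (simp_all add: elim)
      moreover have "norm (Fx t (u t) (v t)) \<le> A * (b t + H t)"
      proof (rule order_trans[OF A(2)])
        show "A * (b t + G (v t)) \<le> A * (b t + H t)"
          using A(1) elim(3) G2[of "v t"] by (intro mult_left_mono) auto
      qed (simp_all add: elim)
      ultimately show ?case
        using norm_triangle_ineq4[of "Fx t (un n t) (vn n t)" "Fx t (u t) (v t)"] by simp
    qed
  qed simp
  then show "(\<lambda>n. \<integral>t. norm (Fx t (un n t) (vn n t) - Fx t (u t) (v t)) \<partial>lebesgue_on I) \<longlonglongrightarrow> 0" by simp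
  obtain K C where K: "0 \<le> K" "\<And>y. fenchel_conj G ((2 * r) *\<^sub>R y) \<le> K * fenchel_conj G y + C"
    using conj_scaleR_le by blast
  have "(\<lambda>n. \<integral>t. fenchel_conj G (r *\<^sub>R (Fv t (un n t) (vn n t) - Fv t (u t) (v t))) \<partial>lebesgue_on I)
      \<longlonglongrightarrow> (\<integral>t. 0 \<partial>lebesgue_on I)"
  proof (rule integral_dominated_convergence[where w = "\<lambda>t. 2 * (K * (A * (c t + H t)) + C)"])
    show "(\<lambda>t. fenchel_conj G (r *\<^sub>R (Fv t (un n t) (vn n t) - Fv t (u t) (v t)))) \<in> borel_measurable (lebesgue_on I)" for n
      by (rule measurable_compose[OF _ conj_measurable])
         (intro borel_measurable_scaleR borel_measurable_const borel_measurable_diff m m0)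
    show "integrable (lebesgue_on I) (\<lambda>t. 2 * (K * (A * (c t + H t)) + C))"
      by (intro integrable_mult_right Bochner_Integration.integrable_add c_integrable H integrable_const_I)
    show "AE t in lebesgue_on I. (\<lambda>n. fenchel_conj G (r *\<^sub>R (Fv t (un n t) (vn n t) - Fv t (u t) (v t)))) \<longlonglongrightarrow> 0"
      using lim AE_mem_I
    proof eventually_elim
      case (elim t)
      have "(\<lambda>n. Fv t (un n t) (vn n t)) \<longlonglongrightarrow> Fv t (u t) (v t)"
        by (rule superposition_tendsto[OF Fv_continuous]) (simp_all add: elim)
      then have "(\<lambda>n. r *\<^sub>R (Fv t (un n t) (vn n t) - Fv t (u t) (v t))) \<longlonglongrightarrow> r *\<^sub>R (Fv t (u t) (v t) - Fv t (u t) (v t))"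
        by (intro tendsto_intros)
      from continuous_on_tendsto_compose[OF conj_continuous this] show ?case by (simp add: conj_0)
    qed
    show "AE t in lebesgue_on I. norm (fenchel_conj G (r *\<^sub>R (Fv t (un n t) (vn n t) - Fv t (u t) (v t))))
        \<le> 2 * (K * (A * (c t + H t)) + C)" for n
      using R AE_mem_I Hv H(2)
    proof eventually_elim
      case (elim t)
      let ?p = "Fv t (un n t) (vn n t)" and ?q = "Fv t (u t) (v t)"
      have "fenchel_conj G ?p \<le> A * (c t + H t)"
      proof (rule order_trans[OF A(3)])
        show "A * (c t + G (2 *\<^sub>R vn n t)) \<le> A * (c t + H t)"
          using A(1) elim(4)[rule_format, of n] by (intro mult_left_mono) auto
      qed (simp_all add: elim)
      then have p: "K * fenchel_conj G ?p \<le> K * (A * (c t + H t))" using K(1) by (rule mult_left_mono)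
      have "fenchel_conj G ?q \<le> A * (c t + H t)"
      proof (rule order_trans[OF A(3)])
        show "A * (c t + G (2 *\<^sub>R v t)) \<le> A * (c t + H t)"
          using A(1) elim(3) by (intro mult_left_mono) auto
      qed (simp_all add: elim)
      then have q: "K * fenchel_conj G ?q \<le> K * (A * (c t + H t))" using K(1) by (rule mult_left_mono)
      have "fenchel_conj G (r *\<^sub>R ?p + - (r *\<^sub>R ?q)) \<le> fenchel_conj G (2 *\<^sub>R (r *\<^sub>R ?p)) + fenchel_conj G (2 *\<^sub>R - (r *\<^sub>R ?q))"
        by (rule conj_add_le)
      then have "fenchel_conj G (r *\<^sub>R (?p - ?q)) \<le> fenchel_conj G ((2 * r) *\<^sub>R ?p) + fenchel_conj G ((2 * r) *\<^sub>R ?q)"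
        using conj_even[of "(2 * r) *\<^sub>R ?q"] by (simp add: scaleR_diff_right)
      then show ?case
        using K(2)[of ?p] K(2)[of ?q] p q conj_nonneg[of "r *\<^sub>R (?p - ?q)"] by simp
    qed
  qed simp
  then show "(\<lambda>n. \<integral>t. fenchel_conj G (r *\<^sub>R (Fv t (un n t) (vn n t) - Fv t (u t) (v t))) \<partial>lebesgue_on I) \<longlonglongrightarrow> 0"
    by simp
qed

end

context action_functional
begin

lemma admissible_W: "u \<in> W \<Longrightarrow> admissible u (weak_deriv I u)"
proof -
  assume u: "u \<in> W"
  obtain C where C: "\<forall>u\<in>W. AE t in lebesgue_on I. norm (u t) \<le> C * nrm u" using W_sup_bound by blast
  have "AE t in lebesgue_on I. norm (u t) \<le> C * nrm u" by (rule bspec[OF C u])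
  then show ?thesis
    using W_orlicz[OF u] by (auto simp: admissible_def orlicz_iff)
qed

lemma admissible_line:
  assumes uv: "admissible u v" and hk: "admissible h k"
  shows "admissible (\<lambda>t. u t + s *\<^sub>R h t) (\<lambda>t. v t + s *\<^sub>R k t)"
proof -
  obtain R where R: "AE t in lebesgue_on I. norm (u t) \<le> R" using uv by (auto simp: admissible_def)
  obtain S where S: "AE t in lebesgue_on I. norm (h t) \<le> S" using hk by (auto simp: admissible_def)
  have "AE t in lebesgue_on I. norm (u t + s *\<^sub>R h t) \<le> R + \<bar>s\<bar> * S"
    using R S
  proof eventually_elim
    case (elim t)
    have "norm (u t + s *\<^sub>R h t) \<le> norm (u t) + \<bar>s\<bar> * norm (h t)"
      using norm_triangle_ineq[of "u t" "s *\<^sub>R h t"] by simp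
    also have "\<dots> \<le> R + \<bar>s\<bar> * S" using elim by (intro add_mono mult_left_mono) auto
    finally show ?case .
  qed
  moreover have "(\<lambda>t. u t + s *\<^sub>R h t) \<in> borel_measurable (lebesgue_on I)"
    using uv hk unfolding admissible_def
    by (intro borel_measurable_add borel_measurable_scaleR borel_measurable_const) blast+
  moreover have "(\<lambda>t. v t + s *\<^sub>R k t) \<in> orlicz_space I G"
    using uv hk unfolding admissible_def by (intro orlicz_add orlicz_scaleR) blast+
  ultimately show ?thesis unfolding admissible_def by blast
qed

lemma integrable_inner_bounded:
  assumes f: "integrable (lebesgue_on I) f" and h: "h \<in> borel_measurable (lebesgue_on I)"
    and R: "AE t in lebesgue_on I. norm (h t :: 'a) \<le> R"
  shows "integrable (lebesgue_on I) (\<lambda>t. f t \<bullet> h t)"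
    and "\<bar>\<integral>t. f t \<bullet> h t \<partial>lebesgue_on I\<bar> \<le> R * (\<integral>t. norm (f t) \<partial>lebesgue_on I)"
proof -
  have i: "integrable (lebesgue_on I) (\<lambda>t. R * norm (f t))"
    using f by (intro integrable_mult_right integrable_norm)
  have le: "AE t in lebesgue_on I. \<bar>f t \<bullet> h t\<bar> \<le> R * norm (f t)"
    using R
  proof eventually_elim
    case (elim t)
    have "\<bar>f t \<bullet> h t\<bar> \<le> norm (f t) * norm (h t)" by (rule Cauchy_Schwarz_ineq2)
    also have "\<dots> \<le> norm (f t) * R" using elim by (intro mult_left_mono) auto
    finally show ?case by (simp add: mult.commute)
  qed
  show fi: "integrable (lebesgue_on I) (\<lambda>t. f t \<bullet> h t)"
  proof (rule Bochner_Integration.integrable_bound[OF i])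
    show "(\<lambda>t. f t \<bullet> h t) \<in> borel_measurable (lebesgue_on I)"
      by (intro borel_measurable_inner borel_measurable_integrable[OF f] h)
    show "AE t in lebesgue_on I. norm (f t \<bullet> h t) \<le> norm (R * norm (f t))"
      using le by eventually_elim auto
  qed
  have "\<bar>\<integral>t. f t \<bullet> h t \<partial>lebesgue_on I\<bar> \<le> (\<integral>t. \<bar>f t \<bullet> h t\<bar> \<partial>lebesgue_on I)"
    by (rule integral_abs_bound)
  also have "\<dots> \<le> (\<integral>t. R * norm (f t) \<partial>lebesgue_on I)"
    by (rule integral_mono_AE[OF integrable_abs[OF fi] i le])
  finally show "\<bar>\<integral>t. f t \<bullet> h t \<partial>lebesgue_on I\<bar> \<le> R * (\<integral>t. norm (f t) \<partial>lebesgue_on I)" by simp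
qed

lemma admissible_integrable_derivative:
  assumes uv: "admissible u v" and hk: "admissible h k"
  shows "integrable (lebesgue_on I) (\<lambda>t. Fx t (u t) (v t) \<bullet> h t)"
    and "integrable (lebesgue_on I) (\<lambda>t. Fv t (u t) (v t) \<bullet> k t)"
proof -
  obtain S where S: "AE t in lebesgue_on I. norm (h t) \<le> S" and h: "h \<in> borel_measurable (lebesgue_on I)"
    and k: "k \<in> orlicz_space I G"
    using hk by (auto simp: admissible_def)
  show "integrable (lebesgue_on I) (\<lambda>t. Fx t (u t) (v t) \<bullet> h t)"
    by (rule integrable_inner_bounded(1)[OF admissible_integrable(2)[OF uv] h S])
  show "integrable (lebesgue_on I) (\<lambda>t. Fv t (u t) (v t) \<bullet> k t)"
    by (rule Hoelder_integrable[OF admissible_measurable(3)[OF uv] admissible_integrable(3)[OF uv] k])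
qed

text \<open>Differentiation under the integral sign: on \<open>|r| \<le> |s| + 1\<close> the derivative of the integrand is bounded by
  the integrable function \<open>w\<close>, which by the mean value theorem also bounds the difference quotients.\<close>
lemma action_line_derivative:
  assumes uv: "admissible u v" and hk: "admissible h k"
  shows "((\<lambda>s. \<integral>t. F t (u t + s *\<^sub>R h t) (v t + s *\<^sub>R k t) \<partial>lebesgue_on I) has_real_derivative
     (\<integral>t. Fx t (u t + s *\<^sub>R h t) (v t + s *\<^sub>R k t) \<bullet> h t \<partial>lebesgue_on I)
     + (\<integral>t. Fv t (u t + s *\<^sub>R h t) (v t + s *\<^sub>R k t) \<bullet> k t \<partial>lebesgue_on I)) (at s)"
proof -
  note adm = admissible_line[OF uv hk]
  define f where "f = (\<lambda>s t. F t (u t + s *\<^sub>R h t) (v t + s *\<^sub>R k t))"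
  define d where "d = (\<lambda>s t. Fx t (u t + s *\<^sub>R h t) (v t + s *\<^sub>R k t) \<bullet> h t
      + Fv t (u t + s *\<^sub>R h t) (v t + s *\<^sub>R k t) \<bullet> k t)"
  obtain R where R: "AE t in lebesgue_on I. norm (u t) \<le> R" and v: "v \<in> orlicz_space I G"
    using uv by (auto simp: admissible_def)
  obtain R' where R': "AE t in lebesgue_on I. norm (h t) \<le> R'" and k: "k \<in> orlicz_space I G"
    using hk by (auto simp: admissible_def)
  define S where "S = \<bar>s\<bar> + 1"
  obtain A where A: "0 \<le> A"
    "\<And>t x v. t \<in> I \<Longrightarrow> norm x \<le> R + S * R' \<Longrightarrow> norm (Fx t x v) \<le> A * (b t + G v)"
    "\<And>t x v. t \<in> I \<Longrightarrow> norm x \<le> R + S * R' \<Longrightarrow> fenchel_conj G (Fv t x v) \<le> A * (c t + G (2 *\<^sub>R v))"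
    using local_bounds[of "R + S * R'"] by metis
  define D where "D = (\<lambda>t. G (4 *\<^sub>R v t) + G ((4 * S) *\<^sub>R k t))"
  define w where "w = (\<lambda>t. (A * (b t + D t)) * R' + (G (k t) + A * (c t + D t)))"
  have Di: "integrable (lebesgue_on I) D"
    unfolding D_def by (intro Bochner_Integration.integrable_add orlicz_integrable_scaleR v k)
  have wi: "integrable (lebesgue_on I) w"
    unfolding w_def using k
    by (intro Bochner_Integration.integrable_add integrable_mult_left integrable_mult_right b_integrable c_integrable Di)
       (simp add: orlicz_iff)
  have fi: "integrable (lebesgue_on I) (f r)" for r
    unfolding f_def by (rule admissible_integrable(1)[OF adm])
  note di = admissible_integrable_derivative[OF adm hk]
  have dm: "d s \<in> borel_measurable (lebesgue_on I)"
    unfolding d_def by (intro borel_measurable_integrable Bochner_Integration.integrable_add di)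
  have f': "((\<lambda>s. f s t) has_real_derivative d r t) (at r)" if "t \<in> I" for r t
    unfolding f_def d_def by (rule F_line_derivative[OF that])
  have bound: "AE t in lebesgue_on I. \<forall>r. \<bar>r\<bar> \<le> S \<longrightarrow> \<bar>d r t\<bar> \<le> w t"
    using R R' AE_mem_I
  proof eventually_elim
    case (elim t)
    show ?case
    proof (intro allI impI)
      fix r assume r: "\<bar>r\<bar> \<le> S"
      let ?x = "u t + r *\<^sub>R h t" and ?v = "v t + r *\<^sub>R k t"
      have "norm ?x \<le> norm (u t) + \<bar>r\<bar> * norm (h t)"
        using norm_triangle_ineq[of "u t" "r *\<^sub>R h t"] by simp
      also have "\<dots> \<le> R + S * R'" using elim r by (intro add_mono mult_mono) auto
      finally have x: "norm ?x \<le> R + S * R'" .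
      have "G (2 *\<^sub>R ?v) = G (2 *\<^sub>R v t + (2 * r) *\<^sub>R k t)" by (simp add: scaleR_add_right)
      also have "\<dots> \<le> G (2 *\<^sub>R (2 *\<^sub>R v t)) + G (2 *\<^sub>R ((2 * r) *\<^sub>R k t))" by (rule G_add_le)
      also have "\<dots> \<le> D t"
        using G_scaleR_mono[of "4 * r" "4 * S" "k t"] r by (simp add: D_def S_def)
      finally have D2: "G (2 *\<^sub>R ?v) \<le> D t" .
      then have D1: "G ?v \<le> D t" using G_scaleR_mono[of 1 2 ?v] by simp
      have "\<bar>Fx t ?x ?v \<bullet> h t\<bar> \<le> norm (Fx t ?x ?v) * norm (h t)" by (rule Cauchy_Schwarz_ineq2)
      also have "\<dots> \<le> (A * (b t + D t)) * R'"
      proof (rule mult_mono)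
        have "norm (Fx t ?x ?v) \<le> A * (b t + G ?v)" by (rule A(2)[OF elim(3) x])
        also have "\<dots> \<le> A * (b t + D t)" using A(1) D1 by (intro mult_left_mono) auto
        finally show *: "norm (Fx t ?x ?v) \<le> A * (b t + D t)" .
        show "0 \<le> A * (b t + D t)" using * norm_ge_zero order_trans by blast
      qed (use elim in auto)
      finally have 1: "\<bar>Fx t ?x ?v \<bullet> h t\<bar> \<le> (A * (b t + D t)) * R'" .
      have "\<bar>Fv t ?x ?v \<bullet> k t\<bar> \<le> G (k t) + fenchel_conj G (Fv t ?x ?v)"
        using Young_ineq_abs[of "k t" "Fv t ?x ?v"] by (simp only: inner_commute)
      also have "fenchel_conj G (Fv t ?x ?v) \<le> A * (c t + G (2 *\<^sub>R ?v))" by (rule A(3)[OF elim(3) x])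
      also have "\<dots> \<le> A * (c t + D t)" using A(1) D2 by (intro mult_left_mono) auto
      finally have "\<bar>Fv t ?x ?v \<bullet> k t\<bar> \<le> G (k t) + A * (c t + D t)" by simp
      with 1 show "\<bar>d r t\<bar> \<le> w t" unfolding d_def w_def by linarith
    qed
  qed
  have quot: "(\<lambda>n. \<integral>t. (f (s + X n) t - f s t) / X n \<partial>lebesgue_on I) \<longlonglongrightarrow> (\<integral>t. d s t \<partial>lebesgue_on I)"
    if X: "\<And>n. X n \<noteq> 0" "X \<longlonglongrightarrow> 0" "\<And>n. \<bar>X n\<bar> \<le> 1" for X :: "nat \<Rightarrow> real"
  proof (rule integral_dominated_convergence[where w = w, OF dm _ wi])
    show "(\<lambda>t. (f (s + X n) t - f s t) / X n) \<in> borel_measurable (lebesgue_on I)" for n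
      by (intro borel_measurable_integrable integrable_divide Bochner_Integration.integrable_diff fi)
    show "AE t in lebesgue_on I. (\<lambda>n. (f (s + X n) t - f s t) / X n) \<longlonglongrightarrow> d s t"
      using AE_mem_I
    proof eventually_elim
      case (elim t)
      have "((\<lambda>r. (f (s + r) t - f s t) / r) \<longlongrightarrow> d s t) (at 0)"
        using f'[OF elim, of s] by (simp add: DERIV_def)
      moreover have "filterlim X (at 0) sequentially"
        using X by (auto simp: filterlim_at)
      ultimately show ?case by (rule filterlim_compose)
    qed
    show "AE t in lebesgue_on I. norm ((f (s + X n) t - f s t) / X n) \<le> w t" for n
      using bound AE_mem_I
    proof eventually_elim
      case (elim t)
      have "norm (f (s + X n) t - f s t) \<le> w t * norm (s + X n - s)"
      proof (rule field_differentiable_bound[where S = "{s - 1..s + 1}" and f' = "\<lambda>r. d r t"])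
        show "((\<lambda>r. f r t) has_field_derivative d z t) (at z within {s - 1..s + 1})" for z
          by (rule has_field_derivative_at_within[OF f'[OF elim(2)]])
        show "norm (d z t) \<le> w t" if "z \<in> {s - 1..s + 1}" for z
        proof -
          have "\<bar>z\<bar> \<le> S" using that by (auto simp: S_def)
          then show ?thesis using elim(1) by simp
        qed
        show "s + X n \<in> {s - 1..s + 1}" using X(3)[of n] by (auto simp: abs_le_iff)
      qed auto
      then show ?case using X(1)[of n] by (simp add: norm_divide pos_divide_le_eq)
    qed
  qed
  have fdiff: "(\<integral>t. (f (s + r) t - f s t) / r \<partial>lebesgue_on I)
      = ((\<integral>t. f (s + r) t \<partial>lebesgue_on I) - (\<integral>t. f s t \<partial>lebesgue_on I)) / r" for r
    by (simp add: Bochner_Integration.integral_diff[OF fi fi])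
  have "((\<lambda>r. ((\<integral>t. f (s + r) t \<partial>lebesgue_on I) - (\<integral>t. f s t \<partial>lebesgue_on I)) / r)
      \<longlongrightarrow> (\<integral>t. d s t \<partial>lebesgue_on I)) (at 0)"
    unfolding tendsto_at_iff_sequentially
  proof (intro allI impI)
    fix X :: "nat \<Rightarrow> real" assume X0: "\<forall>i. X i \<in> UNIV - {0}" and X: "X \<longlonglongrightarrow> 0"
    have "\<forall>\<^sub>F n in sequentially. \<bar>X n\<bar> < 1"
      using tendstoD[OF X, of 1] by simp
    then obtain N where N: "\<And>n. N \<le> n \<Longrightarrow> \<bar>X n\<bar> < 1" by (auto simp: eventually_sequentially)
    have "(\<lambda>n. \<integral>t. (f (s + X (n + N)) t - f s t) / X (n + N) \<partial>lebesgue_on I) \<longlonglongrightarrow> (\<integral>t. d s t \<partial>lebesgue_on I)"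
    proof (rule quot)
      show "(\<lambda>n. X (n + N)) \<longlonglongrightarrow> 0" by (rule LIMSEQ_ignore_initial_segment[OF X])
      show "\<bar>X (n + N)\<bar> \<le> 1" for n using N[of "n + N"] by simp
    qed (use X0 in simp)
    then have "(\<lambda>n. ((\<integral>t. f (s + X (n + N)) t \<partial>lebesgue_on I) - (\<integral>t. f s t \<partial>lebesgue_on I)) / X (n + N))
        \<longlonglongrightarrow> (\<integral>t. d s t \<partial>lebesgue_on I)" by (simp only: fdiff)
    then show "((\<lambda>r. ((\<integral>t. f (s + r) t \<partial>lebesgue_on I) - (\<integral>t. f s t \<partial>lebesgue_on I)) / r) \<circ> X)
        \<longlonglongrightarrow> (\<integral>t. d s t \<partial>lebesgue_on I)"
      unfolding comp_def by (rule LIMSEQ_offset)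
  qed
  then have "((\<lambda>s. \<integral>t. f s t \<partial>lebesgue_on I) has_real_derivative (\<integral>t. d s t \<partial>lebesgue_on I)) (at s)"
    by (simp add: DERIV_def)
  also have "(\<integral>t. d s t \<partial>lebesgue_on I) = (\<integral>t. Fx t (u t + s *\<^sub>R h t) (v t + s *\<^sub>R k t) \<bullet> h t \<partial>lebesgue_on I)
     + (\<integral>t. Fv t (u t + s *\<^sub>R h t) (v t + s *\<^sub>R k t) \<bullet> k t \<partial>lebesgue_on I)"
    unfolding d_def by (rule Bochner_Integration.integral_add[OF di])
  finally show ?thesis unfolding f_def .
qed

section \<open>The Frechet derivative of the action functional\<close>

text \<open>The derivative of the action functional at \<open>u\<close> in the direction \<open>\<phi>\<close>.\<close>
definition J' :: "(real \<Rightarrow> 'a) \<Rightarrow> (real \<Rightarrow> 'a) \<Rightarrow> real" where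
  "J' u \<phi> = (\<integral>t. Fx t (u t) (weak_deriv I u t) \<bullet> \<phi> t \<partial>lebesgue_on I)
     + (\<integral>t. Fv t (u t) (weak_deriv I u t) \<bullet> weak_deriv I \<phi> t \<partial>lebesgue_on I)"

lemma J'_integrable:
  assumes u: "u \<in> W" and p: "\<phi> \<in> W"
  shows "integrable (lebesgue_on I) (\<lambda>t. Fx t (u t) (weak_deriv I u t) \<bullet> \<phi> t)"
    and "integrable (lebesgue_on I) (\<lambda>t. Fv t (u t) (weak_deriv I u t) \<bullet> weak_deriv I \<phi> t)"
  using admissible_integrable_derivative[OF admissible_W[OF u] admissible_W[OF p]] .

text \<open>Weak derivatives may be replaced by measurable functions that agree with them almost everywhere.\<close>
lemma J'_eq:
  assumes u: "u \<in> W" and p: "\<phi> \<in> W" and v: "v \<in> borel_measurable (lebesgue_on I)"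
    and k: "k \<in> borel_measurable (lebesgue_on I)"
    and uv: "AE t in lebesgue_on I. weak_deriv I u t = v t"
    and pk: "AE t in lebesgue_on I. weak_deriv I \<phi> t = k t"
  shows "J' u \<phi> = (\<integral>t. Fx t (u t) (v t) \<bullet> \<phi> t \<partial>lebesgue_on I) + (\<integral>t. Fv t (u t) (v t) \<bullet> k t \<partial>lebesgue_on I)"
proof -
  have m: "u \<in> borel_measurable (lebesgue_on I)" "\<phi> \<in> borel_measurable (lebesgue_on I)"
    using W_orlicz(1)[OF u] W_orlicz(1)[OF p] by (simp_all add: orlicz_iff)
  have "(\<integral>t. Fx t (u t) (weak_deriv I u t) \<bullet> \<phi> t \<partial>lebesgue_on I) = (\<integral>t. Fx t (u t) (v t) \<bullet> \<phi> t \<partial>lebesgue_on I)"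
  proof (rule integral_cong_AE)
    show "(\<lambda>t. Fx t (u t) (v t) \<bullet> \<phi> t) \<in> borel_measurable (lebesgue_on I)"
      by (rule borel_measurable_inner[OF superposition_measurable[OF Fx_continuous m(1) v] m(2)])
    show "AE t in lebesgue_on I. Fx t (u t) (weak_deriv I u t) \<bullet> \<phi> t = Fx t (u t) (v t) \<bullet> \<phi> t"
      using uv by eventually_elim simp
  qed (rule borel_measurable_integrable[OF J'_integrable(1)[OF u p]])
  moreover have "(\<integral>t. Fv t (u t) (weak_deriv I u t) \<bullet> weak_deriv I \<phi> t \<partial>lebesgue_on I) = (\<integral>t. Fv t (u t) (v t) \<bullet> k t \<partial>lebesgue_on I)"
  proof (rule integral_cong_AE)
    show "(\<lambda>t. Fv t (u t) (v t) \<bullet> k t) \<in> borel_measurable (lebesgue_on I)"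
      by (rule borel_measurable_inner[OF superposition_measurable[OF Fv_continuous m(1) v] k])
    show "AE t in lebesgue_on I. Fv t (u t) (weak_deriv I u t) \<bullet> weak_deriv I \<phi> t = Fv t (u t) (v t) \<bullet> k t"
      using uv pk by eventually_elim simp
  qed (rule borel_measurable_integrable[OF J'_integrable(2)[OF u p]])
  ultimately show ?thesis by (simp add: J'_def)
qed

lemma action_eq:
  assumes u: "u \<in> W" and m: "w \<in> borel_measurable (lebesgue_on I)" "v \<in> borel_measurable (lebesgue_on I)"
    and ae: "AE t in lebesgue_on I. u t = w t" "AE t in lebesgue_on I. weak_deriv I u t = v t"
  shows "action I F u = (\<integral>t. F t (w t) (v t) \<partial>lebesgue_on I)"
  unfolding action_def action_integrand_def
proof (rule integral_cong_AE)
  show "(\<lambda>t. F t (u t) (weak_deriv I u t)) \<in> borel_measurable (lebesgue_on I)"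
    by (rule admissible_measurable(1)[OF admissible_W[OF u]])
  show "(\<lambda>t. F t (w t) (v t)) \<in> borel_measurable (lebesgue_on I)"
    by (rule superposition_measurable[OF F_continuous m])
  show "AE t in lebesgue_on I. F t (u t) (weak_deriv I u t) = F t (w t) (v t)"
    using ae by eventually_elim simp
qed

lemma J'_bounded_linear:
  assumes u: "u \<in> W" shows "bounded_linear_functional W nrm (J' u)"
  unfolding bounded_linear_functional_def
proof (intro conjI ballI allI)
  let ?v = "weak_deriv I u"
  note adm = admissible_W[OF u]
  have vm: "?v \<in> borel_measurable (lebesgue_on I)" using W_orlicz(2)[OF u] by (simp add: orlicz_iff)
  have wm: "weak_deriv I \<phi> \<in> borel_measurable (lebesgue_on I)" if "\<phi> \<in> W" for \<phi>
    using W_orlicz(2)[OF that] by (simp add: orlicz_iff)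
  have refl: "AE t in lebesgue_on I. ?v t = ?v t" by simp
  show "J' u (\<lambda>t. \<phi> t + \<psi> t) = J' u \<phi> + J' u \<psi>" if p: "\<phi> \<in> W" and q: "\<psi> \<in> W" for \<phi> \<psi>
  proof -
    have "J' u (\<lambda>t. \<phi> t + \<psi> t) = (\<integral>t. Fx t (u t) (?v t) \<bullet> (\<phi> t + \<psi> t) \<partial>lebesgue_on I)
        + (\<integral>t. Fv t (u t) (?v t) \<bullet> (weak_deriv I \<phi> t + weak_deriv I \<psi> t) \<partial>lebesgue_on I)"
      by (rule J'_eq[OF u W_add(1)[OF p q] vm borel_measurable_add[OF wm[OF p] wm[OF q]] refl W_add(2)[OF p q]])
    also have "\<dots> = J' u \<phi> + J' u \<psi>"
      unfolding J'_def inner_add_right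
        Bochner_Integration.integral_add[OF J'_integrable(1)[OF u p] J'_integrable(1)[OF u q]]
        Bochner_Integration.integral_add[OF J'_integrable(2)[OF u p] J'_integrable(2)[OF u q]]
      by simp
    finally show ?thesis .
  qed
  show "J' u (\<lambda>t. r *\<^sub>R \<phi> t) = r * J' u \<phi>" if p: "\<phi> \<in> W" for r \<phi>
  proof -
    have "J' u (\<lambda>t. r *\<^sub>R \<phi> t) = (\<integral>t. Fx t (u t) (?v t) \<bullet> (r *\<^sub>R \<phi> t) \<partial>lebesgue_on I)
        + (\<integral>t. Fv t (u t) (?v t) \<bullet> (r *\<^sub>R weak_deriv I \<phi> t) \<partial>lebesgue_on I)"
      by (rule J'_eq[OF u W_scaleR(1)[OF p] vm borel_measurable_scaleR[OF borel_measurable_const wm[OF p]] refl W_scaleR(2)[OF p]])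
    then show ?thesis by (simp add: J'_def distrib_left)
  qed
  obtain C where C: "\<forall>u\<in>W. AE t in lebesgue_on I. norm (u t) \<le> C * nrm u" using W_sup_bound by blast
  let ?K = "C * (\<integral>t. norm (Fx t (u t) (?v t)) \<partial>lebesgue_on I)
      + ((\<integral>t. fenchel_conj G (Fv t (u t) (?v t)) \<partial>lebesgue_on I) + 1)"
  have "\<bar>J' u \<phi>\<bar> \<le> ?K * nrm \<phi>" if p: "\<phi> \<in> W" for \<phi>
  proof -
    have m: "\<phi> \<in> borel_measurable (lebesgue_on I)" using W_orlicz(1)[OF p] by (simp add: orlicz_iff)
    have 1: "\<bar>\<integral>t. Fx t (u t) (?v t) \<bullet> \<phi> t \<partial>lebesgue_on I\<bar>
        \<le> (C * nrm \<phi>) * (\<integral>t. norm (Fx t (u t) (?v t)) \<partial>lebesgue_on I)"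
      by (rule integrable_inner_bounded(2)[OF admissible_integrable(2)[OF adm] m bspec[OF C p]])
    have nn: "0 \<le> (\<integral>t. fenchel_conj G (Fv t (u t) (?v t)) \<partial>lebesgue_on I)"
      by (rule Bochner_Integration.integral_nonneg) (rule conj_nonneg)
    have "\<bar>\<integral>t. Fv t (u t) (?v t) \<bullet> weak_deriv I \<phi> t \<partial>lebesgue_on I\<bar>
        \<le> ((\<integral>t. fenchel_conj G (Fv t (u t) (?v t)) \<partial>lebesgue_on I) + 1) * luxemburg_norm I G (weak_deriv I \<phi>)"
      by (rule Hoelder_le[OF admissible_measurable(3)[OF adm] admissible_integrable(3)[OF adm] W_orlicz(2)[OF p]])
    also have "\<dots> \<le> ((\<integral>t. fenchel_conj G (Fv t (u t) (?v t)) \<partial>lebesgue_on I) + 1) * nrm \<phi>"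
      using nn by (intro mult_left_mono luxemburg_le_nrm(2)[OF p]) simp
    finally have 2: "\<bar>\<integral>t. Fv t (u t) (?v t) \<bullet> weak_deriv I \<phi> t \<partial>lebesgue_on I\<bar>
        \<le> ((\<integral>t. fenchel_conj G (Fv t (u t) (?v t)) \<partial>lebesgue_on I) + 1) * nrm \<phi>" .
    have "\<bar>J' u \<phi>\<bar> \<le> (C * nrm \<phi>) * (\<integral>t. norm (Fx t (u t) (?v t)) \<partial>lebesgue_on I)
        + ((\<integral>t. fenchel_conj G (Fv t (u t) (?v t)) \<partial>lebesgue_on I) + 1) * nrm \<phi>"
      unfolding J'_def using 1 2 by linarith
    also have "\<dots> = ?K * nrm \<phi>" by (simp add: algebra_simps)
    finally show ?thesis .
  qed
  then show "\<exists>K. \<forall>\<phi>\<in>W. \<bar>J' u \<phi>\<bar> \<le> K * nrm \<phi>" by blast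
qed

text \<open>The factor \<open>r\<close> is free: a large \<open>r\<close> makes the term \<open>1/r\<close> small, and for fixed \<open>r\<close> the conjugate modular is
  small when \<open>w\<close> is close to \<open>u\<close>.\<close>
lemma J'_diff_le:
  assumes u: "u \<in> W" and w: "w \<in> W" and p: "\<phi> \<in> W" and r: "0 < r"
    and C: "\<And>u. u \<in> W \<Longrightarrow> AE t in lebesgue_on I. norm (u t) \<le> C * nrm u"
  shows "\<bar>J' w \<phi> - J' u \<phi>\<bar> \<le>
     (C * (\<integral>t. norm (Fx t (w t) (weak_deriv I w t) - Fx t (u t) (weak_deriv I u t)) \<partial>lebesgue_on I)
      + ((\<integral>t. fenchel_conj G (r *\<^sub>R (Fv t (w t) (weak_deriv I w t) - Fv t (u t) (weak_deriv I u t))) \<partial>lebesgue_on I) + 1) / r) * nrm \<phi>"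
proof -
  define p where "p = (\<lambda>t. Fx t (w t) (weak_deriv I w t) - Fx t (u t) (weak_deriv I u t))"
  define q where "q = (\<lambda>t. Fv t (w t) (weak_deriv I w t) - Fv t (u t) (weak_deriv I u t))"
  note au = admissible_W[OF u] and aw = admissible_W[OF w]
  have pi: "integrable (lebesgue_on I) p"
    unfolding p_def by (intro Bochner_Integration.integrable_diff admissible_integrable au aw)
  have qm: "q \<in> borel_measurable (lebesgue_on I)"
    unfolding q_def by (intro borel_measurable_diff admissible_measurable au aw)
  have rqm: "(\<lambda>t. r *\<^sub>R q t) \<in> borel_measurable (lebesgue_on I)"
    by (intro borel_measurable_scaleR borel_measurable_const qm)
  have ri: "integrable (lebesgue_on I) (\<lambda>t. fenchel_conj G (r *\<^sub>R q t))"
  proof -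
    obtain K D where K: "0 \<le> K" "\<And>y. fenchel_conj G ((2 * r) *\<^sub>R y) \<le> K * fenchel_conj G y + D"
      using conj_scaleR_le by blast
    let ?f = "\<lambda>t. Fv t (w t) (weak_deriv I w t)" and ?g = "\<lambda>t. Fv t (u t) (weak_deriv I u t)"
    show ?thesis
    proof (rule Bochner_Integration.integrable_bound)
      show "integrable (lebesgue_on I) (\<lambda>t. (K * fenchel_conj G (?f t) + D) + (K * fenchel_conj G (?g t) + D))"
        by (intro Bochner_Integration.integrable_add integrable_mult_right admissible_integrable au aw integrable_const_I)
      show "(\<lambda>t. fenchel_conj G (r *\<^sub>R q t)) \<in> borel_measurable (lebesgue_on I)"
        by (rule measurable_compose[OF rqm conj_measurable])
      show "AE t in lebesgue_on I. norm (fenchel_conj G (r *\<^sub>R q t))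
          \<le> norm ((K * fenchel_conj G (?f t) + D) + (K * fenchel_conj G (?g t) + D))"
      proof (rule AE_I2)
        fix t
        have "fenchel_conj G (r *\<^sub>R ?f t + - (r *\<^sub>R ?g t)) \<le> fenchel_conj G (2 *\<^sub>R (r *\<^sub>R ?f t)) + fenchel_conj G (2 *\<^sub>R - (r *\<^sub>R ?g t))"
          by (rule conj_add_le)
        then have "fenchel_conj G (r *\<^sub>R q t) \<le> fenchel_conj G ((2 * r) *\<^sub>R ?f t) + fenchel_conj G ((2 * r) *\<^sub>R ?g t)"
          using conj_even[of "(2 * r) *\<^sub>R ?g t"] by (simp add: q_def scaleR_diff_right)
        then show "norm (fenchel_conj G (r *\<^sub>R q t))
          \<le> norm ((K * fenchel_conj G (?f t) + D) + (K * fenchel_conj G (?g t) + D))"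
          using K(2)[of "?f t"] K(2)[of "?g t"] conj_nonneg[of "r *\<^sub>R q t"] by simp
      qed
    qed
  qed
  have m: "\<phi> \<in> borel_measurable (lebesgue_on I)" using W_orlicz(1)[OF \<open>\<phi> \<in> W\<close>] by (simp add: orlicz_iff)
  have eq: "J' w \<phi> - J' u \<phi> = (\<integral>t. p t \<bullet> \<phi> t \<partial>lebesgue_on I) + (\<integral>t. q t \<bullet> weak_deriv I \<phi> t \<partial>lebesgue_on I)"
    unfolding J'_def p_def q_def inner_diff_left
      Bochner_Integration.integral_diff[OF J'_integrable(1)[OF w \<open>\<phi> \<in> W\<close>] J'_integrable(1)[OF u \<open>\<phi> \<in> W\<close>]]
      Bochner_Integration.integral_diff[OF J'_integrable(2)[OF w \<open>\<phi> \<in> W\<close>] J'_integrable(2)[OF u \<open>\<phi> \<in> W\<close>]]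
    by simp
  have 1: "\<bar>\<integral>t. p t \<bullet> \<phi> t \<partial>lebesgue_on I\<bar> \<le> (C * nrm \<phi>) * (\<integral>t. norm (p t) \<partial>lebesgue_on I)"
    by (rule integrable_inner_bounded(2)[OF pi m C[OF \<open>\<phi> \<in> W\<close>]])
  let ?E = "\<integral>t. fenchel_conj G (r *\<^sub>R q t) \<partial>lebesgue_on I"
  have nn: "0 \<le> ?E" by (rule Bochner_Integration.integral_nonneg) (rule conj_nonneg)
  have "r * \<bar>\<integral>t. q t \<bullet> weak_deriv I \<phi> t \<partial>lebesgue_on I\<bar> = \<bar>\<integral>t. r *\<^sub>R q t \<bullet> weak_deriv I \<phi> t \<partial>lebesgue_on I\<bar>"
    using r by (simp add: abs_mult)
  also have "\<dots> \<le> (?E + 1) * luxemburg_norm I G (weak_deriv I \<phi>)"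
    by (rule Hoelder_le[OF rqm ri W_orlicz(2)[OF \<open>\<phi> \<in> W\<close>]])
  also have "\<dots> \<le> (?E + 1) * nrm \<phi>"
    using nn by (intro mult_left_mono luxemburg_le_nrm(2)[OF \<open>\<phi> \<in> W\<close>]) simp
  finally have 2: "\<bar>\<integral>t. q t \<bullet> weak_deriv I \<phi> t \<partial>lebesgue_on I\<bar> \<le> (?E + 1) * nrm \<phi> / r"
    using r by (simp add: pos_le_divide_eq mult.commute)
  have "\<bar>J' w \<phi> - J' u \<phi>\<bar> \<le> (C * nrm \<phi>) * (\<integral>t. norm (p t) \<partial>lebesgue_on I) + (?E + 1) * nrm \<phi> / r"
    unfolding eq using 1 2 by linarith
  also have "\<dots> = (C * (\<integral>t. norm (p t) \<partial>lebesgue_on I) + (?E + 1) / r) * nrm \<phi>"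
    by (simp add: algebra_simps)
  finally show ?thesis unfolding p_def q_def .
qed

lemma J'_continuous:
  assumes u: "u \<in> W" and e: "0 < \<epsilon>"
  shows "\<exists>\<delta>>0. \<forall>w\<in>W. nrm (\<lambda>t. w t - u t) < \<delta> \<longrightarrow> (\<forall>\<phi>\<in>W. \<bar>J' w \<phi> - J' u \<phi>\<bar> \<le> \<epsilon> * nrm \<phi>)"
proof (rule ccontr)
  assume "\<not> ?thesis"
  then have neg: "\<And>\<delta>. 0 < \<delta> \<Longrightarrow> \<exists>w\<in>W. nrm (\<lambda>t. w t - u t) < \<delta> \<and> (\<exists>\<phi>\<in>W. \<epsilon> * nrm \<phi> < \<bar>J' w \<phi> - J' u \<phi>\<bar>)"
    by (auto simp: not_le)
  define \<delta> :: "nat \<Rightarrow> real" where "\<delta> = (\<lambda>n. (1 / 4) ^ (n + 2))"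
  have "\<forall>n. \<exists>w. w \<in> W \<and> nrm (\<lambda>t. w t - u t) < \<delta> n \<and> (\<exists>\<phi>\<in>W. \<epsilon> * nrm \<phi> < \<bar>J' w \<phi> - J' u \<phi>\<bar>)"
  proof
    fix n
    have "0 < \<delta> n" by (simp add: \<delta>_def)
    from neg[OF this] show "\<exists>w. w \<in> W \<and> nrm (\<lambda>t. w t - u t) < \<delta> n \<and> (\<exists>\<phi>\<in>W. \<epsilon> * nrm \<phi> < \<bar>J' w \<phi> - J' u \<phi>\<bar>)"
      by blast
  qed
  then obtain w where w: "\<And>n. w n \<in> W" "\<And>n. nrm (\<lambda>t. w n t - u t) < \<delta> n"
    and bad: "\<And>n. \<exists>\<phi>\<in>W. \<epsilon> * nrm \<phi> < \<bar>J' (w n) \<phi> - J' u \<phi>\<bar>"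
    by metis
  obtain C where C: "0 \<le> C" "\<And>u. u \<in> W \<Longrightarrow> AE t in lebesgue_on I. norm (u t) \<le> C * nrm u"
    using W_sup_bound by blast
  define x where "x = (\<lambda>n t. w n t - u t)"
  define y where "y = (\<lambda>n. weak_deriv I (x n))"
  have xW: "x n \<in> W" for n unfolding x_def by (rule W_diff(1)[OF w(1) u])
  have y: "AE t in lebesgue_on I. \<forall>n. weak_deriv I (w n) t = weak_deriv I u t + y n t"
    unfolding AE_all_countable
  proof
    fix n
    show "AE t in lebesgue_on I. weak_deriv I (w n) t = weak_deriv I u t + y n t"
      using W_diff(2)[OF w(1) u, of n] unfolding y_def x_def by eventually_elim simp
  qed
  have yo: "y n \<in> orlicz_space I G" for n unfolding y_def by (rule W_orlicz(2)[OF xW])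
  have ylux: "luxemburg_norm I G (y n) < \<delta> n" for n
    using luxemburg_le_nrm(2)[OF xW, of n] w(2)[of n] unfolding y_def x_def by simp
  have x0: "AE t in lebesgue_on I. \<forall>n. norm (x n t) \<le> C * \<delta> n"
    unfolding AE_all_countable
  proof
    fix n
    have le: "C * nrm (x n) \<le> C * \<delta> n" using C(1) w(2)[of n] unfolding x_def by (intro mult_left_mono) auto
    show "AE t in lebesgue_on I. norm (x n t) \<le> C * \<delta> n"
      using C(2)[OF xW, of n] by eventually_elim (use le in linarith)
  qed
  have \<delta>0: "\<delta> \<longlonglongrightarrow> 0"
    unfolding \<delta>_def by (rule LIMSEQ_ignore_initial_segment[OF LIMSEQ_realpow_zero]) auto
  have \<delta>1: "\<delta> n \<le> 1" for n unfolding \<delta>_def by (rule power_le_one) auto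
  \<comment> \<open>the shift by \<open>2\<close> makes the factor at least \<open>4\<close>, so that \<open>f n\<close> also bounds \<open>G (4 *\<^sub>R y n t)\<close>\<close>
  define f where "f = (\<lambda>n t. G ((2 ^ (n + 2)) *\<^sub>R y n t))"
  have pd: "2 ^ (n + 2) * \<delta> n = (1 / 2) ^ (n + 2)" for n
    unfolding \<delta>_def by (simp add: power_mult_distrib[symmetric] del: power_Suc add_2_eq_Suc')
  have "\<exists>h. integrable (lebesgue_on I) h \<and> (AE t in lebesgue_on I. \<forall>n. f n t \<le> h t)"
  proof (rule AE_bounded_of_geometric_integrals)
    show "integrable (lebesgue_on I) (f n)" for n unfolding f_def by (rule orlicz_integrable_scaleR[OF yo])
    show "0 \<le> f n t" for n t by (simp add: f_def nonneg)
    have "(\<integral>t. f n t \<partial>lebesgue_on I) \<le> 2 ^ (n + 2) * \<delta> n" for n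
      unfolding f_def
    proof (rule luxemburg_less_imp_modular_le[OF yo ylux])
      show "2 ^ (n + 2) * \<delta> n \<le> 1" unfolding pd by (rule power_le_one) auto
    qed simp
    moreover have "2 ^ (n + 2) * \<delta> n \<le> (1 / 2) ^ n" for n unfolding pd by (rule power_decreasing) auto
    ultimately show "(\<integral>t. f n t \<partial>lebesgue_on I) \<le> (1 / 2) ^ n" for n using order_trans by blast
  qed
  then obtain h where h: "integrable (lebesgue_on I) h" "AE t in lebesgue_on I. \<forall>n. f n t \<le> h t" by blast
  obtain D where D: "\<And>z. 1 * norm z \<le> G z + D" using G_superlinear_bound by blast
  have y0: "AE t in lebesgue_on I. (\<lambda>n. y n t) \<longlonglongrightarrow> 0"
    using h(2)
  proof eventually_elim
    case (elim t)
    have le: "norm (y n t) \<le> (h t + D) * (1 / 2) ^ (n + 2)" for n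
    proof -
      have "2 ^ (n + 2) * norm (y n t) \<le> h t + D"
        using D[of "(2 ^ (n + 2)) *\<^sub>R y n t"] elim[rule_format, of n] by (simp add: f_def)
      then show ?thesis by (simp add: power_one_over pos_le_divide_eq mult.commute)
    qed
    have "(\<lambda>n. (1 / 2 :: real) ^ (n + 2)) \<longlonglongrightarrow> 0"
      by (rule LIMSEQ_ignore_initial_segment[OF LIMSEQ_realpow_zero]) auto
    then have "(\<lambda>n. (h t + D) * (1 / 2) ^ (n + 2)) \<longlonglongrightarrow> 0" by (rule tendsto_mult_right_zero)
    then show ?case by (rule Lim_null_comparison[rotated]) (use le in auto)
  qed
  let ?R = "C * nrm u + C"
  let ?H = "\<lambda>t. G (4 *\<^sub>R weak_deriv I u t) + h t"
  have R: "AE t in lebesgue_on I. (\<forall>n. norm (w n t) \<le> ?R) \<and> norm (u t) \<le> ?R"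
    using C(2)[OF u] x0
  proof eventually_elim
    case (elim t)
    have "norm (w n t) \<le> ?R" for n
    proof -
      have "norm (w n t) \<le> norm (u t) + norm (x n t)"
        using norm_triangle_ineq[of "u t" "x n t"] by (simp add: x_def)
      moreover have "C * \<delta> n \<le> C * 1" using C(1) \<delta>1 by (intro mult_left_mono)
      ultimately show ?thesis using elim(1) elim(2)[rule_format, of n] by simp
    qed
    then show ?case using elim(1) C(1) by simp
  qed
  have lim: "AE t in lebesgue_on I. (\<lambda>n. w n t) \<longlonglongrightarrow> u t \<and> (\<lambda>n. weak_deriv I (w n) t) \<longlonglongrightarrow> weak_deriv I u t"
    using x0 y0 y
  proof eventually_elim
    case (elim t)
    have "(\<lambda>n. x n t) \<longlonglongrightarrow> 0"
      by (rule Lim_null_comparison[OF _ tendsto_mult_right_zero[OF \<delta>0, of C]])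
         (use elim(1) in simp)
    then have "(\<lambda>n. w n t) \<longlonglongrightarrow> u t" unfolding x_def by (rule LIM_zero_cancel)
    moreover have "(\<lambda>n. weak_deriv I u t + y n t) \<longlonglongrightarrow> weak_deriv I u t + 0"
      by (intro tendsto_add tendsto_const elim(2))
    ultimately show ?case using elim(3) by simp
  qed
  have Hi: "integrable (lebesgue_on I) ?H"
    by (intro Bochner_Integration.integrable_add orlicz_integrable_scaleR W_orlicz u h)
  have H: "AE t in lebesgue_on I. \<forall>n. G (2 *\<^sub>R weak_deriv I (w n) t) \<le> ?H t"
    using y h(2)
  proof eventually_elim
    case (elim t)
    show ?case
    proof
      fix n
      have "G (2 *\<^sub>R weak_deriv I (w n) t) = G (2 *\<^sub>R weak_deriv I u t + 2 *\<^sub>R y n t)"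
        using elim(1) by (simp add: scaleR_add_right)
      also have "\<dots> \<le> G (2 *\<^sub>R (2 *\<^sub>R weak_deriv I u t)) + G (2 *\<^sub>R (2 *\<^sub>R y n t))" by (rule G_add_le)
      also have "G (2 *\<^sub>R (2 *\<^sub>R y n t)) \<le> f n t"
      proof -
        have "(4::real) \<le> 2 ^ (n + 2)" using one_le_power[of "2::real" n] by (simp add: power_add)
        then show ?thesis using G_scaleR_mono[of 4 "2 ^ (n + 2)" "y n t"] by (simp add: f_def)
      qed
      finally show "G (2 *\<^sub>R weak_deriv I (w n) t) \<le> ?H t" using elim(2)[rule_format, of n] by simp
    qed
  qed
  \<comment> \<open>then \<open>1 / r\<close> is \<open>\<epsilon> / 4\<close>, and the two other terms tend to \<open>0\<close>\<close>
  define r where "r = 4 / \<epsilon>"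
  have r: "0 < r" using e by (simp add: r_def)
  note conv = superposition_continuous[OF admissible_W[OF w(1)] admissible_W[OF u] R lim Hi H]
  let ?D = "\<lambda>n. \<integral>t. norm (Fx t (w n t) (weak_deriv I (w n) t) - Fx t (u t) (weak_deriv I u t)) \<partial>lebesgue_on I"
  let ?E = "\<lambda>n. \<integral>t. fenchel_conj G (r *\<^sub>R (Fv t (w n t) (weak_deriv I (w n) t) - Fv t (u t) (weak_deriv I u t))) \<partial>lebesgue_on I"
  have "(\<lambda>n. C * ?D n + (?E n + 1) / r) \<longlonglongrightarrow> C * 0 + (0 + 1) / r"
    using r by (intro tendsto_intros conv) auto
  then have "\<forall>\<^sub>F n in sequentially. C * ?D n + (?E n + 1) / r < \<epsilon>"
    by (rule order_tendstoD(2)) (use e in \<open>simp add: r_def\<close>)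
  then obtain n where n: "C * ?D n + (?E n + 1) / r < \<epsilon>"
    using eventually_happens[of _ "sequentially"] by auto
  obtain \<phi> where p: "\<phi> \<in> W" "\<epsilon> * nrm \<phi> < \<bar>J' (w n) \<phi> - J' u \<phi>\<bar>" using bad by blast
  have "\<bar>J' (w n) \<phi> - J' u \<phi>\<bar> \<le> (C * ?D n + (?E n + 1) / r) * nrm \<phi>"
    by (rule J'_diff_le[OF u w(1) p(1) r C(2)])
  also have "\<dots> \<le> \<epsilon> * nrm \<phi>"
    using n luxemburg_le_nrm(3)[OF p(1)] by (intro mult_right_mono) auto
  finally show False using p(2) by simp
qed

text \<open>The mean value theorem on the segment from \<open>u\<close> to \<open>u + \<phi>\<close> reduces the remainder to a difference of
  derivatives, which is small by continuity.\<close>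
lemma action_has_frechet_deriv:
  assumes u: "u \<in> W"
  shows "has_frechet_deriv W nrm (action I F) (J' u) u"
  unfolding has_frechet_deriv_def
proof (intro conjI allI impI)
  show "bounded_linear_functional W nrm (J' u)" by (rule J'_bounded_linear[OF u])
  fix \<epsilon> :: real assume "0 < \<epsilon>"
  from J'_continuous[OF u this] obtain \<delta> where \<delta>: "0 < \<delta>"
    "\<And>w \<phi>. w \<in> W \<Longrightarrow> nrm (\<lambda>t. w t - u t) < \<delta> \<Longrightarrow> \<phi> \<in> W \<Longrightarrow> \<bar>J' w \<phi> - J' u \<phi>\<bar> \<le> \<epsilon> * nrm \<phi>"
    by blast
  have "\<bar>action I F (\<lambda>t. u t + \<phi> t) - action I F u - J' u \<phi>\<bar> \<le> \<epsilon> * nrm \<phi>"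
    if p: "\<phi> \<in> W" and less: "nrm \<phi> < \<delta>" for \<phi>
  proof -
    let ?v = "weak_deriv I u" and ?k = "weak_deriv I \<phi>"
    note au = admissible_W[OF u] and ap = admissible_W[OF p]
    define g where "g = (\<lambda>s. \<integral>t. F t (u t + s *\<^sub>R \<phi> t) (?v t + s *\<^sub>R ?k t) \<partial>lebesgue_on I)"
    define g' where "g' = (\<lambda>s. (\<integral>t. Fx t (u t + s *\<^sub>R \<phi> t) (?v t + s *\<^sub>R ?k t) \<bullet> \<phi> t \<partial>lebesgue_on I)
       + (\<integral>t. Fv t (u t + s *\<^sub>R \<phi> t) (?v t + s *\<^sub>R ?k t) \<bullet> ?k t \<partial>lebesgue_on I))"
    have deriv: "(g has_real_derivative g' s) (at s)" for s
      unfolding g_def g'_def by (rule action_line_derivative[OF au ap])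
    obtain z where z: "0 < z" "z < 1" "g 1 - g 0 = (1 - 0) * g' z"
      using MVT2[of 0 1 g g'] deriv by auto
    define q where "q = (\<lambda>t. u t + z *\<^sub>R \<phi> t)"
    have q: "q \<in> W" unfolding q_def by (intro W_add(1) W_scaleR(1) u p)
    have m: "?v \<in> borel_measurable (lebesgue_on I)" "?k \<in> borel_measurable (lebesgue_on I)"
      "u \<in> borel_measurable (lebesgue_on I)" "\<phi> \<in> borel_measurable (lebesgue_on I)"
      using W_orlicz[OF u] W_orlicz[OF p] by (simp_all add: orlicz_iff)
    have qv: "AE t in lebesgue_on I. weak_deriv I q t = ?v t + z *\<^sub>R ?k t"
      using W_add(2)[OF u W_scaleR(1)[OF p, of z]] W_scaleR(2)[OF p, of z]
      unfolding q_def by eventually_elim simp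
    have "J' q \<phi> = g' z"
      unfolding g'_def
      by (subst J'_eq[OF q p borel_measurable_add[OF m(1) borel_measurable_scaleR[OF borel_measurable_const m(2)]] m(2) qv])
         (simp_all add: q_def)
    moreover have "action I F (\<lambda>t. u t + \<phi> t) = g 1"
    proof -
      have "action I F (\<lambda>t. u t + \<phi> t) = (\<integral>t. F t (u t + \<phi> t) (?v t + ?k t) \<partial>lebesgue_on I)"
        by (rule action_eq[OF W_add(1)[OF u p] borel_measurable_add[OF m(3,4)] borel_measurable_add[OF m(1,2)] _ W_add(2)[OF u p]])
           simp
      then show ?thesis by (simp add: g_def)
    qed
    moreover have "action I F u = g 0" by (simp add: g_def action_def action_integrand_def)
    moreover have "\<bar>J' q \<phi> - J' u \<phi>\<bar> \<le> \<epsilon> * nrm \<phi>"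
    proof (rule \<delta>(2)[OF q _ p])
      have "nrm (\<lambda>t. q t - u t) = nrm (\<lambda>t. z *\<^sub>R \<phi> t)" by (simp add: q_def)
      also have "\<dots> \<le> nrm \<phi>" using z by (intro nrm_scaleR_le[OF p]) simp
      finally show "nrm (\<lambda>t. q t - u t) < \<delta>" using less by simp
    qed
    ultimately show ?thesis using z(3) by simp
  qed
  then show "\<exists>\<delta>>0. \<forall>\<phi>\<in>W. nrm \<phi> < \<delta> \<longrightarrow>
      \<bar>action I F (\<lambda>t. u t + \<phi> t) - action I F u - J' u \<phi>\<bar> \<le> \<epsilon> * nrm \<phi>"
    using \<delta>(1) by blast
qed

lemma action_C1_functional: "C1_functional W nrm (action I F)"
  unfolding C1_functional_def
  using action_has_frechet_deriv J'_continuous by (intro exI[of _ J']) blast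

lemma action_cong_AE:
  assumes u: "u \<in> W" and w: "w \<in> W" and ae: "AE t in lebesgue_on I. u t = w t"
  shows "action I F u = action I F w"
proof -
  have "action I F u = (\<integral>t. F t (w t) (weak_deriv I w t) \<partial>lebesgue_on I)"
    by (rule action_eq[OF u _ _ ae weak_deriv_cong_AE[OF u w ae]])
       (use W_orlicz[OF w] in \<open>simp_all add: orlicz_iff\<close>)
  then show ?thesis by (simp add: action_def action_integrand_def)
qed

end

theorem theorem5p7:
  fixes I :: "real set"
    and G :: "real ^ 'n \<Rightarrow> real"
    and F :: "real \<Rightarrow> real ^ 'n \<Rightarrow> real ^ 'n \<Rightarrow> real"
    and a b c :: "real \<Rightarrow> real"
  assumes I: "is_interval I" "bounded I"
    and G_nonneg: "\<forall>x. 0 \<le> G x"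
    and G1: "G 0 = 0"
    and G2: "convex_on UNIV G"
    and G3: "\<forall>x. G (- x) = G x"
    and G4: "filterlim (\<lambda>x. G x / norm x) at_top at_infinity"
    and G5: "\<exists>K\<^sub>1\<ge>2. \<exists>M\<^sub>1>0. \<forall>x. norm x \<ge> M\<^sub>1 \<longrightarrow> G (2 *\<^sub>R x) \<le> K\<^sub>1 * G x"
    and G6: "\<exists>K\<^sub>2\<ge>1. \<exists>M\<^sub>2>0. \<forall>x. norm x \<ge> M\<^sub>2 \<longrightarrow> G x \<le> 1 / (2 * K\<^sub>2) * G (K\<^sub>2 *\<^sub>R x)"
    and G7: "C1_on UNIV G"
    and F: "C1_on (I \<times> UNIV \<times> UNIV) (\<lambda>(t, x, v). F t x v)"
    and a: "continuous_on {0..} a" "\<forall>r\<ge>0. 0 \<le> a r"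
    and b: "integrable (lebesgue_on I) b" "\<forall>t\<in>I. 0 \<le> b t"
    and c: "integrable (lebesgue_on I) c" "\<forall>t\<in>I. 0 \<le> c t"
    and F_bound: "\<forall>t\<in>I. \<forall>x v. \<bar>F t x v\<bar> \<le> a (norm x) * (b t + G v)"
    and Fx_bound: "\<forall>t\<in>I. \<forall>x v. norm (grad_x F t x v) \<le> a (norm x) * (b t + G v)"
    and Fv_bound: "\<forall>t\<in>I. \<forall>x v. fenchel_conj G (grad_v F t x v)
                     \<le> a (norm x) * (c t + fenchel_conj G (grad G v))"
  defines "W \<equiv> orlicz_sobolev_space I G"
    and "nrm \<equiv> orlicz_sobolev_norm I G"
  shows "(\<forall>u\<in>W. integrable (lebesgue_on I) (action_integrand I F u))
    \<and> (\<forall>u\<in>W. \<forall>w\<in>W. (AE t in lebesgue_on I. u t = w t) \<longrightarrow> action I F u = action I F w)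
    \<and> C1_functional W nrm (action I F)
    \<and> (\<forall>u\<in>W. \<forall>\<phi>\<in>W.
         integrable (lebesgue_on I) (\<lambda>t. grad_x F t (u t) (weak_deriv I u t) \<bullet> \<phi> t) \<and>
         integrable (lebesgue_on I) (\<lambda>t. grad_v F t (u t) (weak_deriv I u t) \<bullet> weak_deriv I \<phi> t))
    \<and> (\<forall>u\<in>W. has_frechet_deriv W nrm (action I F)
         (\<lambda>\<phi>. (\<integral>t. grad_x F t (u t) (weak_deriv I u t) \<bullet> \<phi> t \<partial>lebesgue_on I)
             + (\<integral>t. grad_v F t (u t) (weak_deriv I u t) \<bullet> weak_deriv I \<phi> t \<partial>lebesgue_on I)) u)"
proof -
  interpret action_functional G I F a b c
    by unfold_locales (use I G_nonneg G1 G2 G3 G4 G5 G6 G7 F a b c F_bound Fx_bound Fv_bound in \<open>simp_all\<close>)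
  have "integrable (lebesgue_on I) (action_integrand I F u)" if "u \<in> W" for u
    using admissible_integrable(1)[OF admissible_W, of u] that
    unfolding W_def action_integrand_def by simp
  moreover have "has_frechet_deriv W nrm (action I F)
      (\<lambda>\<phi>. (\<integral>t. grad_x F t (u t) (weak_deriv I u t) \<bullet> \<phi> t \<partial>lebesgue_on I)
          + (\<integral>t. grad_v F t (u t) (weak_deriv I u t) \<bullet> weak_deriv I \<phi> t \<partial>lebesgue_on I)) u"
    if "u \<in> W" for u
    using action_has_frechet_deriv[of u] that unfolding W_def nrm_def J'_def .
  moreover have "action I F u = action I F w" if "u \<in> W" "w \<in> W" "AE t in lebesgue_on I. u t = w t" for u w
    using action_cong_AE[of u w] that unfolding W_def .
  moreover have "C1_functional W nrm (action I F)"
    unfolding W_def nrm_def by (rule action_C1_functional)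
  moreover have "integrable (lebesgue_on I) (\<lambda>t. grad_x F t (u t) (weak_deriv I u t) \<bullet> \<phi> t)"
      "integrable (lebesgue_on I) (\<lambda>t. grad_v F t (u t) (weak_deriv I u t) \<bullet> weak_deriv I \<phi> t)"
    if "u \<in> W" "\<phi> \<in> W" for u \<phi>
    using J'_integrable[of u \<phi>] that unfolding W_def by blast+
  ultimately show ?thesis by (intro conjI ballI impI)
qed

end
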